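(* Let $(\mathcal{M},\nu)$ be a presymplectic manifold such that $\ker\nu$ has constant dimension, let $H\in\mathcal{C}^\infty(\mathcal{M})$, and let $\mathcal{M}^H\subset\mathcal{M}$ be the hidden constraint set of $H$. Suppose that the nondegeneracy assumption holds: for every $z\in\mathcal{M}$, all critical points of the restriction $H_{[z]}$ of $H$ to the fibre $[z]$ are nondegenerate. Then: 1. The set $\mathcal{M}^H$ is a submanifold of $\mathcal{M}$. 2. At every point $x\in\mathcal{M}^H$, $$T_x\mathcal{M} = T_x\mathcal{M}^H\oplus \ker\nu_x .$$ In particular, the restriction (pull-back) of $\nu$ to $\mathcal{M}^H$ is a symplectic form, so that $\mathcal{M}^H$ is a symplectic manifold. 3. The equation $$\nu_{\gamma(t)}(\dot\gamma(t),\cdot)-\mathrm{d}H(\gamma(t))=0 \quad\text{on } T_{\gamma(t)}\mathcal{M},$$ for smooth curves $t\mapsto\gamma(t)\in\mathcal{M}$, has (locally in time) unique solutions for initial data in $\mathcal{M}^H$. These solutions are the solutions of the Hamiltonian problem on the symplectic manifold $\mathcal{M}^H$ obtained by restricting $H$ to $\mathcal{M}^H$.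
   Context: A presymplectic manifold is a pair $(\mathcal{M},\nu)$ with $\mathcal{M}$ a smooth manifold and $\nu$ a closed 2-form, possibly degenerate. When $\ker\nu$, $\ker\nu_x=\{u\in T_x\mathcal{M}:\nu_x(u,v)=0\ \forall v\in T_x\mathcal{M}\}$, has constant dimension it is an integrable distribution; the leaf of the resulting foliation through $x$ is denoted $[x]$ and called the fibre through $x$, so $T_y[x]=\ker\nu_y$ for $y\in[x]$. $H_{[x]}$ denotes the restriction (pull-back) of $H$ to $[x]$. A critical point is nondegenerate if the Hessian there is nonsingular. The hidden constraint set is $$\mathcal{M}^H=\{z\in\mathcal{M}:\ \mathrm{d}H(z)\in\nu(T_z\mathcal{M})\},\qquad \nu(T_z\mathcal{M})=\{\nu_z(u,\cdot):u\in T_z\mathcal{M}\}\subset T_z^*\mathcal{M}.$$ On a symplectic manifold $(\mathcal{N},\varpi)$, the Hamiltonian problem for a function $K$ is $\varpi(\dot\gamma,\cdot)=\mathrm{d}K(\gamma)$. *)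

theory Defs
  imports "HOL-Analysis.Analysis"
begin

section \<open>Smooth maps between open pieces of subspaces\<close>

text \<open>
  Manifolds of varying dimension are modelled on linear subspaces \<open>E\<close> of one Euclidean space,
  so dimension 0 is included.  The predicates below are meant for sets \<open>S\<close> that are open relative
  to such a subspace; there the derivative within \<open>S\<close> is determined on \<open>E\<close> (only its irrelevant
  extension to the ambient space is free, hence the existential quantifier over \<open>f'\<close>).
\<close>

primrec Ck_on ::
  "nat \<Rightarrow> 'a::euclidean_space set \<Rightarrow> ('a \<Rightarrow> 'b::real_normed_vector) \<Rightarrow> bool" where
  "Ck_on 0 S f \<longleftrightarrow> continuous_on S f"
| "Ck_on (Suc k) S f \<longleftrightarrow>
     (\<exists>f'. (\<forall>x\<in>S. (f has_derivative f' x) (at x within S)) \<and> (\<forall>v. Ck_on k S (\<lambda>x. f' x v)))"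

definition smooth_on :: "'a::euclidean_space set \<Rightarrow> ('a \<Rightarrow> 'b::real_normed_vector) \<Rightarrow> bool" where
  "smooth_on S f \<longleftrightarrow> (\<forall>k. Ck_on k S f)"


section \<open>Smooth manifolds\<close>

text \<open>
  A chart is a pair of its domain and the coordinate map, whose values outside the domain are
  irrelevant.  The dimension of the manifold is \<open>dim (model M)\<close>.
\<close>

record ('p, 'e) manifold =
  mtop :: "'p topology"
  model :: "'e set"
  atlas :: "('p set \<times> ('p \<Rightarrow> 'e)) set"

definition points :: "('p, 'e) manifold \<Rightarrow> 'p set" where
  "points M = topspace (mtop M)"

definition chart :: "('p, 'e::euclidean_space) manifold \<Rightarrow> 'p set \<times> ('p \<Rightarrow> 'e) \<Rightarrow> bool" where
  "chart M = (\<lambda>(U, \<phi>).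
     openin (mtop M) U \<and> openin (top_of_set (model M)) (\<phi> ` U) \<and>
     homeomorphic_map (subtopology (mtop M) U) (top_of_set (\<phi> ` U)) \<phi>)"

definition smooth_transition ::
  "'p set \<times> ('p \<Rightarrow> 'e::euclidean_space) \<Rightarrow> 'p set \<times> ('p \<Rightarrow> 'e) \<Rightarrow> bool" where
  "smooth_transition = (\<lambda>(U, \<phi>) (V, \<psi>). smooth_on (\<phi> ` (U \<inter> V)) (\<psi> \<circ> inv_into U \<phi>))"

definition smooth_manifold :: "('p, 'e::euclidean_space) manifold \<Rightarrow> bool" where
  "smooth_manifold M \<longleftrightarrow>
     Hausdorff_space (mtop M) \<and> second_countable (mtop M) \<and> subspace (model M) \<and>
     (\<forall>c\<in>atlas M. chart M c) \<and> \<Union>(fst ` atlas M) = points M \<and>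
     (\<forall>c\<in>atlas M. \<forall>d\<in>atlas M. smooth_transition c d)"

definition maximal_atlas ::
  "('p, 'e::euclidean_space) manifold \<Rightarrow> ('p set \<times> ('p \<Rightarrow> 'e)) set" where
  "maximal_atlas M =
     {c. chart M c \<and> (\<forall>d\<in>atlas M. smooth_transition c d \<and> smooth_transition d c)}"

text \<open>An open subset \<open>W\<close> of the subspace \<open>F\<close>, as a manifold with the identity as its only chart.\<close>

definition flat :: "'a::euclidean_space set \<Rightarrow> 'a set \<Rightarrow> ('a, 'a) manifold" where
  "flat F W = \<lparr>mtop = top_of_set W, model = F, atlas = {(W, id)}\<rparr>"

abbreviation interval_manifold :: "real set \<Rightarrow> (real, real) manifold" where
  "interval_manifold I \<equiv> flat UNIV I"

abbreviation real_line :: "(real, real) manifold" where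
  "real_line \<equiv> interval_manifold UNIV"

definition smooth_map ::
  "('p, 'e::euclidean_space) manifold \<Rightarrow> ('q, 'f::euclidean_space) manifold \<Rightarrow> ('p \<Rightarrow> 'q) \<Rightarrow> bool"
  where
  "smooth_map M N f \<longleftrightarrow> continuous_map (mtop M) (mtop N) f \<and>
     (\<forall>(U, \<phi>)\<in>atlas M. \<forall>(V, \<psi>)\<in>atlas N. smooth_on (\<phi> ` (U \<inter> f -` V)) (\<psi> \<circ> f \<circ> inv_into U \<phi>))"


section \<open>Tangent vectors and differentials\<close>

text \<open>
  One chart around each point is selected once and for all; a tangent vector at \<open>x\<close> is
  represented by its coordinates with respect to \<open>chart_at M x\<close>.  Thus \<open>T\<^sub>xM\<close> is a copy of the
  model space for each \<open>x\<close>, and the coordinates with respect to another chart \<open>\<phi>\<close> are obtained by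
  applying the differential of \<open>\<phi>\<close>.
\<close>

definition chart_at :: "('p, 'e) manifold \<Rightarrow> 'p \<Rightarrow> 'p set \<times> ('p \<Rightarrow> 'e)" where
  "chart_at M x = (SOME c. c \<in> atlas M \<and> x \<in> fst c)"

definition tangent_space :: "('p, 'e) manifold \<Rightarrow> 'p \<Rightarrow> 'e set" where
  "tangent_space M x = model M"

text \<open>The tangent map of \<open>f\<close> at \<open>x\<close>; it is only meaningful on \<open>tangent_space M x\<close>.\<close>

definition tmap ::
  "('p, 'e::euclidean_space) manifold \<Rightarrow> ('q, 'f::euclidean_space) manifold \<Rightarrow> ('p \<Rightarrow> 'q) \<Rightarrow>
   'p \<Rightarrow> 'e \<Rightarrow> 'f" where
  "tmap M N f x v =
     (let (U, \<phi>) = chart_at M x; (V, \<psi>) = chart_at N (f x)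
      in frechet_derivative (\<psi> \<circ> f \<circ> inv_into U \<phi>) (at (\<phi> x) within \<phi> ` U) v)"

abbreviation differential ::
  "('p, 'e::euclidean_space) manifold \<Rightarrow> ('p \<Rightarrow> real) \<Rightarrow> 'p \<Rightarrow> 'e \<Rightarrow> real" where
  "differential M f \<equiv> tmap M real_line f"

definition velocity ::
  "('p, 'e::euclidean_space) manifold \<Rightarrow> real set \<Rightarrow> (real \<Rightarrow> 'p) \<Rightarrow> real \<Rightarrow> 'e" where
  "velocity M I \<gamma> t = tmap (interval_manifold I) M \<gamma> t 1"


section \<open>Critical points\<close>

text \<open>
  Neither criticality nor, at a critical point, nondegeneracy of the Hessian depends on the chart
  in which it is tested.
\<close>

definition critical_point ::
  "('p, 'e::euclidean_space) manifold \<Rightarrow> ('p \<Rightarrow> real) \<Rightarrow> 'p \<Rightarrow> bool" where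
  "critical_point N f y \<longleftrightarrow> y \<in> points N \<and>
     (\<forall>(U, \<phi>)\<in>atlas N. y \<in> U \<longrightarrow>
       (\<forall>v\<in>model N. frechet_derivative (f \<circ> inv_into U \<phi>) (at (\<phi> y) within \<phi> ` U) v = 0))"

definition hessian ::
  "'p set \<times> ('p \<Rightarrow> 'e::euclidean_space) \<Rightarrow> ('p \<Rightarrow> real) \<Rightarrow> 'p \<Rightarrow> 'e \<Rightarrow> 'e \<Rightarrow> real" where
  "hessian = (\<lambda>(U, \<phi>) f y a b.
     frechet_derivative
       (\<lambda>u. frechet_derivative (f \<circ> inv_into U \<phi>) (at u within \<phi> ` U) a)
       (at (\<phi> y) within \<phi> ` U) b)"

definition nondegenerate_critical_point ::
  "('p, 'e::euclidean_space) manifold \<Rightarrow> ('p \<Rightarrow> real) \<Rightarrow> 'p \<Rightarrow> bool" where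
  "nondegenerate_critical_point N f y \<longleftrightarrow> critical_point N f y \<and>
     (\<exists>c\<in>atlas N. y \<in> fst c \<and>
       (\<forall>a\<in>model N. (\<forall>b\<in>model N. hessian c f y a b = 0) \<longrightarrow> a = 0))"


section \<open>Presymplectic and symplectic manifolds\<close>

definition pullback ::
  "('p, 'e::euclidean_space) manifold \<Rightarrow> ('q, 'f::euclidean_space) manifold \<Rightarrow> ('p \<Rightarrow> 'q) \<Rightarrow>
   ('q \<Rightarrow> 'f \<Rightarrow> 'f \<Rightarrow> real) \<Rightarrow> 'p \<Rightarrow> 'e \<Rightarrow> 'e \<Rightarrow> real" where
  "pullback M N f \<nu> x v w = \<nu> (f x) (tmap M N f x v) (tmap M N f x w)"

text \<open>The coordinate expression of \<open>\<nu>\<close> in a chart, a form on the open subset \<open>\<phi> ` U\<close> of the model.\<close>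

definition local_form ::
  "('p, 'e::euclidean_space) manifold \<Rightarrow> 'p set \<times> ('p \<Rightarrow> 'e) \<Rightarrow> ('p \<Rightarrow> 'e \<Rightarrow> 'e \<Rightarrow> real) \<Rightarrow>
   'e \<Rightarrow> 'e \<Rightarrow> 'e \<Rightarrow> real" where
  "local_form M = (\<lambda>(U, \<phi>) \<nu>. pullback (flat (model M) (\<phi> ` U)) M (inv_into U \<phi>) \<nu>)"

definition smooth_two_form ::
  "('p, 'e::euclidean_space) manifold \<Rightarrow> ('p \<Rightarrow> 'e \<Rightarrow> 'e \<Rightarrow> real) \<Rightarrow> bool" where
  "smooth_two_form M \<nu> \<longleftrightarrow>
     (\<forall>x\<in>points M. \<forall>u\<in>tangent_space M x. \<forall>v\<in>tangent_space M x.
        \<nu> x u v = - \<nu> x v u \<and>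
        (\<forall>w\<in>tangent_space M x. \<forall>r s. \<nu> x (r *\<^sub>R u + s *\<^sub>R v) w = r * \<nu> x u w + s * \<nu> x v w)) \<and>
     (\<forall>(U, \<phi>)\<in>atlas M. \<forall>v\<in>model M. \<forall>w\<in>model M.
        smooth_on (\<phi> ` U) (\<lambda>a. local_form M (U, \<phi>) \<nu> a v w))"

text \<open>
  \<open>d\<nu> (a, b, c) = D\<^sub>a \<nu>(b, c) + D\<^sub>b \<nu>(c, a) + D\<^sub>c \<nu>(a, b)\<close> for constant vector fields
  \<open>a, b, c\<close> on a chart.
\<close>

definition closed_two_form ::
  "('p, 'e::euclidean_space) manifold \<Rightarrow> ('p \<Rightarrow> 'e \<Rightarrow> 'e \<Rightarrow> real) \<Rightarrow> bool" where
  "closed_two_form M \<nu> \<longleftrightarrow>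
     (\<forall>(U, \<phi>)\<in>atlas M. \<forall>u\<in>\<phi> ` U. \<forall>a\<in>model M. \<forall>b\<in>model M. \<forall>c\<in>model M.
        frechet_derivative (\<lambda>y. local_form M (U, \<phi>) \<nu> y b c) (at u within \<phi> ` U) a +
        frechet_derivative (\<lambda>y. local_form M (U, \<phi>) \<nu> y c a) (at u within \<phi> ` U) b +
        frechet_derivative (\<lambda>y. local_form M (U, \<phi>) \<nu> y a b) (at u within \<phi> ` U) c = 0)"

definition presymplectic_manifold ::
  "('p, 'e::euclidean_space) manifold \<Rightarrow> ('p \<Rightarrow> 'e \<Rightarrow> 'e \<Rightarrow> real) \<Rightarrow> bool" where
  "presymplectic_manifold M \<nu> \<longleftrightarrow> smooth_manifold M \<and> smooth_two_form M \<nu> \<and> closed_two_form M \<nu>"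

definition form_ker ::
  "('p, 'e::euclidean_space) manifold \<Rightarrow> ('p \<Rightarrow> 'e \<Rightarrow> 'e \<Rightarrow> real) \<Rightarrow> 'p \<Rightarrow> 'e set" where
  "form_ker M \<nu> x = {u \<in> tangent_space M x. \<forall>v\<in>tangent_space M x. \<nu> x u v = 0}"

definition symplectic_manifold ::
  "('p, 'e::euclidean_space) manifold \<Rightarrow> ('p \<Rightarrow> 'e \<Rightarrow> 'e \<Rightarrow> real) \<Rightarrow> bool" where
  "symplectic_manifold M \<nu> \<longleftrightarrow> presymplectic_manifold M \<nu> \<and> (\<forall>x\<in>points M. form_ker M \<nu> x = {0})"


section \<open>Leaves of a distribution\<close>

text \<open>
  \<open>\<sigma>\<close> is an injective immersion of an open subset \<open>W\<close> of \<open>F\<close> into \<open>M\<close> all of whose tangent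
  spaces are those of the distribution \<open>D\<close>.
\<close>

definition integral_param ::
  "('p, 'e::euclidean_space) manifold \<Rightarrow> ('p \<Rightarrow> 'e set) \<Rightarrow> 'e set \<Rightarrow> 'e set \<Rightarrow> ('e \<Rightarrow> 'p) \<Rightarrow> bool"
  where
  "integral_param M D F W \<sigma> \<longleftrightarrow>
     subspace F \<and> openin (top_of_set F) W \<and> smooth_map (flat F W) M \<sigma> \<and> inj_on \<sigma> W \<and>
     (\<forall>u\<in>W. bij_betw (tmap (flat F W) M \<sigma> u) F (D (\<sigma> u)))"

definition plaque ::
  "('p, 'e::euclidean_space) manifold \<Rightarrow> ('p \<Rightarrow> 'e set) \<Rightarrow> 'p set \<Rightarrow> bool" where
  "plaque M D P \<longleftrightarrow> (\<exists>F W \<sigma>. integral_param M D F W \<sigma> \<and> connected W \<and> P = \<sigma> ` W)"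

text \<open>Two points lie on the same leaf iff they are joined by a finite chain of plaques.\<close>

definition leaf_set ::
  "('p, 'e::euclidean_space) manifold \<Rightarrow> ('p \<Rightarrow> 'e set) \<Rightarrow> 'p \<Rightarrow> 'p set" where
  "leaf_set M D z = {y. (z, y) \<in> {(p, q). \<exists>P. plaque M D P \<and> p \<in> P \<and> q \<in> P}\<^sup>*}"

text \<open>
  The leaf through \<open>z\<close> as an immersed manifold, modelled on the subspace \<open>D z\<close>.  Its charts are
  the inverses of all integral parametrizations with values in the leaf, and it carries the leaf
  topology, generated by the chart domains.  For an integrable distribution of constant dimension
  these domains cover the leaf set, so inserting the latter does not change the topology.
\<close>

definition leaf_atlas ::
  "('p, 'e::euclidean_space) manifold \<Rightarrow> ('p \<Rightarrow> 'e set) \<Rightarrow> 'p \<Rightarrow> ('p set \<times> ('p \<Rightarrow> 'e)) set" where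
  "leaf_atlas M D z =
     {(\<sigma> ` W, inv_into W \<sigma>) | W \<sigma>. integral_param M D (D z) W \<sigma> \<and> \<sigma> ` W \<subseteq> leaf_set M D z}"

definition leaf ::
  "('p, 'e::euclidean_space) manifold \<Rightarrow> ('p \<Rightarrow> 'e set) \<Rightarrow> 'p \<Rightarrow> ('p, 'e) manifold" where
  "leaf M D z =
     \<lparr>mtop = topology_generated_by (insert (leaf_set M D z) (fst ` leaf_atlas M D z)),
      model = D z, atlas = leaf_atlas M D z\<rparr>"

abbreviation fibre ::
  "('p, 'e::euclidean_space) manifold \<Rightarrow> ('p \<Rightarrow> 'e \<Rightarrow> 'e \<Rightarrow> real) \<Rightarrow> 'p \<Rightarrow> ('p, 'e) manifold" where
  "fibre M \<nu> z \<equiv> leaf M (form_ker M \<nu>) z"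


section \<open>Embedded submanifolds\<close>

definition slice_charts ::
  "('p, 'e::euclidean_space) manifold \<Rightarrow> 'e set \<Rightarrow> 'p set \<Rightarrow> ('p set \<times> ('p \<Rightarrow> 'e)) set" where
  "slice_charts M F S = {(U, \<phi>) \<in> maximal_atlas M. \<phi> ` (U \<inter> S) = \<phi> ` U \<inter> F}"

definition submanifold ::
  "('p, 'e::euclidean_space) manifold \<Rightarrow> 'e set \<Rightarrow> 'p set \<Rightarrow> bool" where
  "submanifold M F S \<longleftrightarrow> subspace F \<and> F \<subseteq> model M \<and> S \<subseteq> points M \<and>
     (\<forall>x\<in>S. \<exists>c\<in>slice_charts M F S. x \<in> fst c)"

definition submfd ::
  "('p, 'e::euclidean_space) manifold \<Rightarrow> 'e set \<Rightarrow> 'p set \<Rightarrow> ('p, 'e) manifold" where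
  "submfd M F S =
     \<lparr>mtop = subtopology (mtop M) S, model = F,
      atlas = (\<lambda>(U, \<phi>). (U \<inter> S, \<phi>)) ` slice_charts M F S\<rparr>"

text \<open>\<open>T\<^sub>xS\<close> as a subspace of \<open>T\<^sub>xM\<close>: the image under the tangent map of the inclusion.\<close>

definition sub_tangent_space ::
  "('p, 'e::euclidean_space) manifold \<Rightarrow> 'e set \<Rightarrow> 'p set \<Rightarrow> 'p \<Rightarrow> 'e set" where
  "sub_tangent_space M F S x = tmap (submfd M F S) M id x ` tangent_space (submfd M F S) x"


section \<open>The hidden constraint set and Hamiltonian curves\<close>

definition hidden_constraint_set ::
  "('p, 'e::euclidean_space) manifold \<Rightarrow> ('p \<Rightarrow> 'e \<Rightarrow> 'e \<Rightarrow> real) \<Rightarrow> ('p \<Rightarrow> real) \<Rightarrow> 'p set" where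
  "hidden_constraint_set M \<nu> H =
     {z \<in> points M. \<exists>u\<in>tangent_space M z. \<forall>v\<in>tangent_space M z. differential M H z v = \<nu> z u v}"

definition hamiltonian_curve ::
  "('p, 'e::euclidean_space) manifold \<Rightarrow> ('p \<Rightarrow> 'e \<Rightarrow> 'e \<Rightarrow> real) \<Rightarrow> ('p \<Rightarrow> real) \<Rightarrow>
   real set \<Rightarrow> (real \<Rightarrow> 'p) \<Rightarrow> bool" where
  "hamiltonian_curve M \<nu> H I \<gamma> \<longleftrightarrow> smooth_map (interval_manifold I) M \<gamma> \<and>
     (\<forall>t\<in>I. \<forall>v\<in>tangent_space M (\<gamma> t).
        \<nu> (\<gamma> t) (velocity M I \<gamma> t) v - differential M H (\<gamma> t) v = 0)"

definition open_interval :: "real set \<Rightarrow> bool" where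
  "open_interval I \<longleftrightarrow> open I \<and> is_interval I"

end

theory Submission
  imports Defs
begin

text \<open>
  Near a point \<open>a0\<close> of the hidden constraint set, let \<open>K\<close> be the kernel of \<open>\<nu>\<close> at \<open>a0\<close> and \<open>F\<close> its
  orthogonal complement in a chart.  The form \<open>\<nu>\<close> is nondegenerate on \<open>F\<close> near \<open>a0\<close>, so there is a unique
  smooth \<open>u\<close> with values in \<open>F\<close> and \<open>\<nu>(u, w) = dH(w)\<close> for \<open>w \<in> F\<close>.  Let \<open>G\<close> be the \<open>K\<close>-valued map
  representing \<open>dH - \<nu>(u, \<cdot>)\<close> on \<open>K\<close>.  Then \<open>dH(\<kappa>) = G \<bullet> \<kappa>\<close> for every \<open>\<kappa>\<close> in the kernel of \<open>\<nu>\<close>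
  at a nearby point, hence the hidden constraint set is \<open>{G = 0}\<close>; differentiating this identity along the fibre shows
  that the Hessian of \<open>H\<close> on the fibre is the bilinear form of the derivative of \<open>G\<close> on \<open>K\<close>.  So the
  nondegeneracy assumption makes \<open>G\<close> a submersion along \<open>K\<close>, and the inverse function theorem applied to
  \<open>y \<mapsto> y - P y + G y\<close>, with \<open>P\<close> the projection onto \<open>K\<close>, gives a slice chart transverse to the kernel.

  No integrability theorem for \<open>ker \<nu>\<close> is needed: a point without a chart of its fibre would be
  a critical point of \<open>H\<close> on that fibre vacuously, and nondegeneracy asserts the existence of a chart.
\<close>

section \<open>Derivatives relative to a subspace\<close>

text \<open>The condition that \<open>dH\<close> vanishes on \<open>ker \<nu>\<close> refers to a
  subspace that moves with the point. The map \<open>G\<close> turns it into an equation in the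
  fixed space \<open>K\<close>: since \<open>\<nu>\<close> is nondegenerate on \<open>F\<close>,
  nearby kernels meet \<open>F\<close> only in 0, and constant rank makes \<open>P\<close> carry
  each of them isomorphically onto \<open>K\<close>; a value of \<open>G\<close> orthogonal to such
  a kernel is therefore orthogonal to itself. All slice charts must share one model, whereas
  \<open>K\<close> depends on the point, so a linear isomorphism preserving the model space moves
  each orthogonal complement to one subspace fixed in advance. Once the tangent space is split, the
  comparison of the two Hamilton equations is linear algebra at each point: on the constraint set
  both sides vanish on the kernel, so testing on tangent vectors of the constraint set suffices.
  Existence and uniqueness of curves then come from the symplectic manifold, where the equation is
  an ordinary differential equation in each chart.\<close>

abbreviation fderiv where "fderiv f S x \<equiv> frechet_derivative f (at x within S)"

text \<open>For a subspace the listed properties determine the map, so the choice operator only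
  spares a formula that depends on a basis.\<close>

definition orth_proj :: "'e::euclidean_space set \<Rightarrow> 'e \<Rightarrow> 'e" where
  "orth_proj E = (SOME P. linear P \<and> (\<forall>x. P x \<in> E) \<and> (\<forall>x\<in>E. P x = x) \<and> (\<forall>x. \<forall>y\<in>E. (x - P x) \<bullet> y = 0))"

text \<open>Orthogonal expansion along an orthonormal basis of \<open>E\<close>.\<close>

lemma orth_proj_exists:
  fixes E :: "'e::euclidean_space set"
  assumes "subspace E"
  shows "\<exists>P. linear P \<and> (\<forall>x. P x \<in> E) \<and> (\<forall>x\<in>E. P x = x) \<and> (\<forall>x. \<forall>y\<in>E. (x - P x) \<bullet> y = 0)"
proof -
  obtain B where B: "B \<subseteq> E" "pairwise orthogonal B" "\<And>x. x \<in> B \<Longrightarrow> norm x = 1"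
    "independent B" "card B = dim E" "span B = E"
    using orthonormal_basis_subspace[OF assms] by metis
  have fin: "finite B" using B(4) independent_imp_finite by blast
  define P where "P = (\<lambda>x. \<Sum>b\<in>B. (x \<bullet> b) *\<^sub>R b)"
  have lin: "linear P"
    unfolding P_def by (intro linear_compose_sum ballI linearI) (auto simp: inner_simps algebra_simps)
  have PE: "P x \<in> E" for x
    unfolding P_def using B(1) assms by (auto intro!: subspace_sum subspace_scale)
  have orth: "(x - P x) \<bullet> y = 0" if "y \<in> E" for x y
  proof -
    have b: "(x - P x) \<bullet> y = 0" if "y \<in> B" for y
    proof -
      have "P x \<bullet> y = (\<Sum>b\<in>B. (x \<bullet> b) * (b \<bullet> y))" by (simp add: P_def inner_sum_left)
      also have "\<dots> = (\<Sum>b\<in>B. if b = y then x \<bullet> y else 0)"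
        using B(2,3) that by (intro sum.cong) (auto simp: pairwise_def orthogonal_def dot_square_norm)
      also have "\<dots> = x \<bullet> y" using fin that by simp
      finally show ?thesis by (simp add: inner_simps)
    qed
    have "y \<in> span B" using that B by simp
    moreover have "orthogonal (x - P x) z" if "z \<in> B" for z
      using b[OF that] by (simp add: orthogonal_def)
    ultimately show ?thesis
      using orthogonal_to_span by (metis orthogonal_def)
  qed
  have "P x = x" if "x \<in> E" for x
    using orth[of "x - P x" x] PE[of x] that subspace_diff[OF assms] by auto
  then show ?thesis using lin PE orth by blast
qed

lemma
  assumes "subspace E"
  shows linear_orth_proj: "linear (orth_proj E)"
    and orth_proj_in: "orth_proj E x \<in> E"
    and orth_proj_id: "x \<in> E \<Longrightarrow> orth_proj E x = x"
    and orth_proj_orth: "y \<in> E \<Longrightarrow> (x - orth_proj E x) \<bullet> y = 0"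
  using someI_ex[OF orth_proj_exists[OF assms]] unfolding orth_proj_def[symmetric] by auto

section \<open>Sets open relative to a subspace\<close>

text \<open>The subspace is kept in the predicate because it is the set of directions on which a
  derivative within \<open>S\<close> is determined.\<close>

definition rel_open :: "'e::euclidean_space set \<Rightarrow> 'e set \<Rightarrow> bool" where
  "rel_open E S \<longleftrightarrow> subspace E \<and> openin (top_of_set E) S"

lemma rel_open_subset: "rel_open E S \<Longrightarrow> S \<subseteq> E"
  unfolding rel_open_def using openin_imp_subset by blast

lemma rel_open_subspace: "rel_open E S \<Longrightarrow> subspace E"
  unfolding rel_open_def by blast

lemma rel_open_preimage:
  assumes "rel_open E S" "continuous_on S f" "openin (top_of_set T) V" "f ` S \<subseteq> T"
  shows "rel_open E (S \<inter> f -` V)"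
  using assms unfolding rel_open_def
  by (meson continuous_openin_preimage image_subset_iff_funcset openin_trans)

lemma rel_open_UNIV: "rel_open UNIV S \<longleftrightarrow> open S"
  unfolding rel_open_def by simp

lemma open_vimage_orth_proj:
  assumes "rel_open E S"
  shows "open (orth_proj E -` S)"
proof -
  obtain T where T: "open T" "S = E \<inter> T" using assms unfolding rel_open_def openin_open by blast
  have "orth_proj E -` S = orth_proj E -` T"
    using T orth_proj_in[OF rel_open_subspace[OF assms]] by auto
  moreover have "continuous_on UNIV (orth_proj E)"
    using linear_orth_proj[OF rel_open_subspace[OF assms]] linear_continuous_on linear_conv_bounded_linear by blast
  ultimately show ?thesis
    using open_vimage[OF T(1)] by simp
qed

text \<open>
  Precomposition with the orthogonal projection replaces a derivative within \<open>S\<close> by one on an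
  open set of the ambient space, where it is unique.
\<close>

lemma has_derivative_orth_proj:
  assumes "rel_open E S" "x \<in> S" "(f has_derivative f') (at x within S)"
  shows "((\<lambda>y. f (orth_proj E y)) has_derivative (\<lambda>v. f' (orth_proj E v))) (at x)"
proof -
  let ?P = "orth_proj E"
  have E: "subspace E" using assms rel_open_subspace by blast
  have [simp]: "?P x = x" using orth_proj_id[OF E] rel_open_subset[OF assms(1)] assms(2) by auto
  have "(?P has_derivative ?P) (at x within ?P -` S)"
    using linear_orth_proj[OF E] by (intro bounded_linear_imp_has_derivative) (simp add: linear_conv_bounded_linear)
  moreover have "(f has_derivative f') (at (?P x) within ?P ` (?P -` S))"
    using assms(3) by (auto intro: has_derivative_subset)
  ultimately have "(f \<circ> ?P has_derivative f' \<circ> ?P) (at x within ?P -` S)"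
    by (rule diff_chain_within)
  then show ?thesis
    using at_within_open[OF _ open_vimage_orth_proj[OF assms(1)]] assms(2) by (simp add: o_def)
qed

text \<open>After precomposition with the projection both candidates are derivatives at an interior
  point of the ambient space, and the projection fixes \<open>v\<close>.\<close>

lemma has_derivative_rel_unique:
  assumes "rel_open E S" "x \<in> S" "(f has_derivative f') (at x within S)"
    "(f has_derivative f'') (at x within S)" "v \<in> E"
  shows "f' v = f'' v"
  using has_derivative_unique[OF has_derivative_orth_proj[OF assms(1-3)]
      has_derivative_orth_proj[OF assms(1,2,4)]] assms(5)
    orth_proj_id[OF rel_open_subspace[OF assms(1)]] by metis

lemma fderiv_eq:
  assumes "rel_open E S" "x \<in> S" "(f has_derivative f') (at x within S)" "v \<in> E"
  shows "fderiv f S x v = f' v"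
  using assms has_derivative_rel_unique frechet_derivative_works differentiableI by metis

text \<open>Near \<open>x\<close> the set \<open>T\<close>, and hence \<open>S\<close> between
  \<open>T\<close> and \<open>E\<close>, fills all of \<open>E\<close>.\<close>

lemma at_within_rel_open:
  assumes "rel_open E S" "rel_open E T" "T \<subseteq> S" "x \<in> T"
  shows "at x within S = at x within T"
proof -
  obtain V where V: "open V" "T = E \<inter> V" using assms(2) unfolding rel_open_def openin_open by blast
  then show ?thesis
    using assms rel_open_subset[OF assms(1)] by (intro at_within_nhd[of _ V]) auto
qed

lemma has_derivative_rel_cong:
  assumes "rel_open E S" "rel_open E S'" "rel_open E T" "T \<subseteq> S" "T \<subseteq> S'" "x \<in> T"
    "\<And>y. y \<in> T \<Longrightarrow> f y = g y" "(f has_derivative f') (at x within S)"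
  shows "(g has_derivative f') (at x within S')"
  using assms at_within_rel_open[OF assms(1,3,4,6)] at_within_rel_open[OF assms(2,3,5,6)]
  by (metis has_derivative_transform)

text \<open>The value of \<open>frechet_derivative\<close> is chosen from the set of all
  derivatives. These sets are equal for the two functions, so the chosen maps agree on the whole
  ambient space and not only on \<open>E\<close>.\<close>

lemma fderiv_rel_cong:
  assumes "rel_open E S" "rel_open E S'" "rel_open E T" "T \<subseteq> S" "T \<subseteq> S'" "x \<in> T"
    "\<And>y. y \<in> T \<Longrightarrow> f y = g y"
  shows "fderiv f S x = fderiv g S' x"
proof -
  have "(f has_derivative f') (at x within S) = (g has_derivative f') (at x within S')" for f'
    using has_derivative_rel_cong[OF assms] has_derivative_rel_cong[OF assms(2,1,3,5,4,6) assms(7)[symmetric]]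
    by (intro iffI)
  then show ?thesis unfolding frechet_derivative_def by simp
qed

text \<open>Increments between points of \<open>S\<close> lie in \<open>E\<close>, so the values of
  the derivative off \<open>E\<close> never enter.\<close>

lemma has_derivative_rel_mono:
  assumes "rel_open E S" "x \<in> S" "(f has_derivative f') (at x within S)" "\<And>v. v \<in> E \<Longrightarrow> f' v = f'' v" "bounded_linear f''"
  shows "(f has_derivative f'') (at x within S)"
proof -
  have "\<And>y. y \<in> S \<Longrightarrow> f' (y - x) = f'' (y - x)"
    using assms rel_open_subset[OF assms(1)] subspace_diff[OF rel_open_subspace[OF assms(1)]]
    by blast
  then show ?thesis using assms unfolding has_derivative_within_alt by metis
qed

text \<open>Projecting the values onto \<open>F\<close> does not change \<open>f\<close> on
  \<open>S\<close> but projects its derivative, so uniqueness makes \<open>f' v\<close> a fixed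
  point of the projection.\<close>

lemma has_derivative_in_closed_subspace:
  fixes f :: "'a::euclidean_space \<Rightarrow> 'b::euclidean_space"
  assumes "rel_open E S" "x \<in> S" "(f has_derivative f') (at x within S)" "v \<in> E"
    "subspace F" "f ` S \<subseteq> F"
  shows "f' v \<in> F"
proof -
  let ?P = "orth_proj F"
  have "bounded_linear ?P" using linear_orth_proj[OF assms(5)] linear_conv_bounded_linear by blast
  then have "((\<lambda>x. ?P (f x)) has_derivative (\<lambda>v. ?P (f' v))) (at x within S)"
    using assms(3) bounded_linear.has_derivative by blast
  moreover have "\<And>y. y \<in> S \<Longrightarrow> ?P (f y) = f y" using assms orth_proj_id by blast
  ultimately have "(f has_derivative (\<lambda>v. ?P (f' v))) (at x within S)"
    using has_derivative_transform[OF assms(2), of f "\<lambda>x. ?P (f x)"] by metis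
  then show ?thesis using has_derivative_rel_unique[OF assms(1-3) _ assms(4)] orth_proj_in[OF assms(5)] by metis
qed

section \<open>Calculus of smooth maps\<close>

lemma Ck_on_SucI:
  assumes "\<And>x. x\<in>S \<Longrightarrow> (f has_derivative f' x) (at x within S)" "\<And>v. Ck_on k S (\<lambda>x. f' x v)"
  shows "Ck_on (Suc k) S f"
  using assms by auto

lemma Ck_on_SucE:
  assumes "Ck_on (Suc k) S f"
  obtains f' where "\<And>x. x\<in>S \<Longrightarrow> (f has_derivative f' x) (at x within S)" "\<And>v. Ck_on k S (\<lambda>x. f' x v)"
  using assms by auto

declare Ck_on.simps(2) [simp del]

lemma Ck_on_subset: "Ck_on k S f \<Longrightarrow> T \<subseteq> S \<Longrightarrow> Ck_on k T f"
proof (induction k arbitrary: f)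
  case (Suc k)
  from Suc.prems(1) obtain f' where f': "\<And>x. x\<in>S \<Longrightarrow> (f has_derivative f' x) (at x within S)" "\<And>v. Ck_on k S (\<lambda>x. f' x v)"
    by (rule Ck_on_SucE) (rule that)
  show ?case
  proof (rule Ck_on_SucI)
    show "(f has_derivative f' x) (at x within T)" if "x \<in> T" for x
      using f'(1) Suc.prems(2) that has_derivative_subset by blast
  qed (rule Suc.IH[OF f'(2) Suc.prems(2)])
qed (auto intro: continuous_on_subset)

lemma Ck_on_cong: "Ck_on k S f \<Longrightarrow> (\<And>x. x \<in> S \<Longrightarrow> f x = g x) \<Longrightarrow> Ck_on k S g"
proof (cases k)
  case (Suc j)
  assume f: "Ck_on k S f" and eq: "\<And>x. x \<in> S \<Longrightarrow> f x = g x"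
  from f obtain f' where f': "\<And>x. x\<in>S \<Longrightarrow> (f has_derivative f' x) (at x within S)" "\<And>v. Ck_on j S (\<lambda>x. f' x v)"
    unfolding Suc by (rule Ck_on_SucE) (rule that)
  show ?thesis unfolding Suc
  proof (rule Ck_on_SucI[OF _ f'(2)])
    show "(g has_derivative f' x) (at x within S)" if "x\<in>S" for x
      using has_derivative_transform[OF that, of g f] eq f'(1)[OF that] by metis
  qed
qed (auto cong: continuous_on_cong)

lemma Ck_on_imp_continuous_on: "Ck_on k S f \<Longrightarrow> continuous_on S f"
proof (cases k)
  case (Suc j)
  assume "Ck_on k S f"
  then have "Ck_on (Suc j) S f" using Suc by simp
  then show ?thesis by (rule Ck_on_SucE) (rule has_derivative_continuous_on)
qed simp

lemma Ck_on_Suc_imp: "Ck_on (Suc k) S f \<Longrightarrow> Ck_on k S f"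
proof (induction k arbitrary: f)
  case 0
  then show ?case using Ck_on_imp_continuous_on[of "Suc 0"] by simp
next
  case (Suc k)
  from Suc.prems(1) obtain f' where f': "\<And>x. x\<in>S \<Longrightarrow> (f has_derivative f' x) (at x within S)" "\<And>v. Ck_on (Suc k) S (\<lambda>x. f' x v)"
    by (rule Ck_on_SucE) (rule that)
  show ?case by (rule Ck_on_SucI[OF f'(1) Suc.IH[OF f'(2)]])
qed

lemma Ck_on_const: "Ck_on k S (\<lambda>x. c)"
proof (induction k arbitrary: c)
  case (Suc k)
  show ?case by (rule Ck_on_SucI[where f' = "\<lambda>x v. 0"]) (simp_all add: Suc)
qed auto

lemma Ck_on_bounded_linear: "bounded_linear L \<Longrightarrow> Ck_on k S f \<Longrightarrow> Ck_on k S (\<lambda>x. L (f x))"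
proof (induction k arbitrary: f)
  case 0
  then show ?case by (auto intro: bounded_linear.continuous_on)
next
  case (Suc k)
  from Suc.prems(2) obtain f' where f': "\<And>x. x\<in>S \<Longrightarrow> (f has_derivative f' x) (at x within S)" "\<And>v. Ck_on k S (\<lambda>x. f' x v)"
    by (rule Ck_on_SucE) (rule that)
  show ?case
    by (rule Ck_on_SucI[OF bounded_linear.has_derivative[OF Suc.prems(1) f'(1)] Suc.IH[OF Suc.prems(1) f'(2)]])
qed

lemma Ck_on_id: "Ck_on k S (\<lambda>x. x)"
proof (cases k)
  case (Suc j)
  show ?thesis unfolding Suc
    by (rule Ck_on_SucI[where f' = "\<lambda>x v. v"]) (simp_all add: Ck_on_const)
qed simp

lemma Ck_on_add: "Ck_on k S f \<Longrightarrow> Ck_on k S g \<Longrightarrow> Ck_on k S (\<lambda>x. f x + g x)"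
proof (induction k arbitrary: f g)
  case (Suc k)
  obtain f' where f': "\<And>x. x\<in>S \<Longrightarrow> (f has_derivative f' x) (at x within S)" "\<And>v. Ck_on k S (\<lambda>x. f' x v)"
    using Suc.prems(1) by (rule Ck_on_SucE) (rule that)
  obtain g' where g': "\<And>x. x\<in>S \<Longrightarrow> (g has_derivative g' x) (at x within S)" "\<And>v. Ck_on k S (\<lambda>x. g' x v)"
    using Suc.prems(2) by (rule Ck_on_SucE) (rule that)
  show ?case
    by (rule Ck_on_SucI[OF has_derivative_add[OF f'(1) g'(1)] Suc.IH[OF f'(2) g'(2)]])
qed (auto intro: continuous_on_add)

lemma Ck_on_sum: "(\<And>i. i \<in> I \<Longrightarrow> Ck_on k S (f i)) \<Longrightarrow> Ck_on k S (\<lambda>x. \<Sum>i\<in>I. f i x)"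
  by (induction I rule: infinite_finite_induct) (auto intro: Ck_on_add Ck_on_const)

lemma Ck_on_minus: "Ck_on k S f \<Longrightarrow> Ck_on k S (\<lambda>x. - f x)"
  by (rule Ck_on_bounded_linear[OF bounded_linear_minus[OF bounded_linear_ident]])

lemma Ck_on_diff: "Ck_on k S f \<Longrightarrow> Ck_on k S g \<Longrightarrow> Ck_on k S (\<lambda>x. f x - g x)"
  using Ck_on_add[OF _ Ck_on_minus, of k S f g] by simp

text \<open>The product rule expresses the derivative by products of one factor with a derivative of
  the other; the induction covers these because the undifferentiated factor is also of class
  \<open>k\<close>.\<close>

lemma Ck_on_bilinear:
  assumes "bounded_bilinear B"
  shows "Ck_on k S f \<Longrightarrow> Ck_on k S g \<Longrightarrow> Ck_on k S (\<lambda>x. B (f x) (g x))"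
proof (induction k arbitrary: f g)
  case 0
  then show ?case using assms by (auto intro: bounded_bilinear.continuous_on)
next
  case (Suc k)
  obtain f' where f': "\<And>x. x\<in>S \<Longrightarrow> (f has_derivative f' x) (at x within S)" "\<And>v. Ck_on k S (\<lambda>x. f' x v)"
    using Suc.prems(1) by (rule Ck_on_SucE) (rule that)
  obtain g' where g': "\<And>x. x\<in>S \<Longrightarrow> (g has_derivative g' x) (at x within S)" "\<And>v. Ck_on k S (\<lambda>x. g' x v)"
    using Suc.prems(2) by (rule Ck_on_SucE) (rule that)
  show ?case
    by (rule Ck_on_SucI[OF bounded_bilinear.FDERIV[OF assms f'(1) g'(1)]
          Ck_on_add[OF Suc.IH[OF Ck_on_Suc_imp[OF Suc.prems(1)] g'(2)]
            Suc.IH[OF f'(2) Ck_on_Suc_imp[OF Suc.prems(2)]]]])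
qed

lemmas Ck_on_scaleR = Ck_on_bilinear[OF bounded_bilinear_scaleR]
lemmas Ck_on_inner_left = Ck_on_bounded_linear[OF bounded_linear_inner_left]

lemma linear_euclidean_expand:
  assumes "linear f"
  shows "f w = (\<Sum>b\<in>Basis. (w \<bullet> b) *\<^sub>R f b)"
proof -
  have "f w = f (\<Sum>b\<in>Basis. (w \<bullet> b) *\<^sub>R b)" by (simp add: euclidean_representation)
  also have "\<dots> = (\<Sum>b\<in>Basis. (w \<bullet> b) *\<^sub>R f b)" by (simp add: linear_sum[OF assms] linear_scale[OF assms])
  finally show ?thesis .
qed

lemma Ck_on_linear_apply:
  fixes w :: "'a::euclidean_space \<Rightarrow> 'b::euclidean_space"
  assumes "\<And>x. x \<in> S \<Longrightarrow> linear (A x)" "\<And>v. Ck_on k S (\<lambda>x. A x v)" "Ck_on k S w"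
  shows "Ck_on k S (\<lambda>x. A x (w x))"
proof -
  have "Ck_on k S (\<lambda>x. \<Sum>b\<in>Basis. (w x \<bullet> b) *\<^sub>R A x b)"
    using assms by (intro Ck_on_sum Ck_on_scaleR Ck_on_inner_left)
  then show ?thesis
    by (rule Ck_on_cong) (simp add: linear_euclidean_expand[OF assms(1), symmetric])
qed

text \<open>The chain rule gives a linear map depending on \<open>x\<close> applied to a vector
  depending on \<open>x\<close>, which is the situation of
  \<open>Ck_on_linear_apply\<close>.\<close>

lemma Ck_on_compose:
  fixes f :: "'b::euclidean_space \<Rightarrow> 'c::real_normed_vector" and g :: "'a::euclidean_space \<Rightarrow> 'b"
  assumes "Ck_on k T f" "Ck_on k S g" "g ` S \<subseteq> T"
  shows "Ck_on k S (\<lambda>x. f (g x))"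
  using assms
proof (induction k arbitrary: f)
  case 0
  then show ?case by (auto intro: continuous_on_compose2)
next
  case (Suc k)
  obtain f' where f': "\<And>x. x\<in>T \<Longrightarrow> (f has_derivative f' x) (at x within T)" "\<And>v. Ck_on k T (\<lambda>x. f' x v)"
    using Suc.prems(1) by (rule Ck_on_SucE) (rule that)
  obtain g' where g': "\<And>x. x\<in>S \<Longrightarrow> (g has_derivative g' x) (at x within S)" "\<And>v. Ck_on k S (\<lambda>x. g' x v)"
    using Suc.prems(2) by (rule Ck_on_SucE) (rule that)
  have g: "Ck_on k S g" using Suc Ck_on_Suc_imp by blast
  show ?case
  proof (rule Ck_on_SucI)
    show "((\<lambda>x. f (g x)) has_derivative (\<lambda>v. f' (g x) (g' x v))) (at x within S)" if "x\<in>S" for x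
    proof -
      have "(f has_derivative f' (g x)) (at (g x) within g ` S)"
        using f'(1)[of "g x"] that Suc.prems(3) by (auto intro: has_derivative_subset)
      from diff_chain_within[OF g'(1)[OF that] this] show ?thesis by (simp add: o_def)
    qed
    show "Ck_on k S (\<lambda>x. f' (g x) (g' x v))" for v
    proof (rule Ck_on_linear_apply)
      show "linear (f' (g x))" if "x\<in>S" for x
        using f'(1)[of "g x"] that Suc.prems(3) has_derivative_linear by blast
      show "Ck_on k S (\<lambda>x. f' (g x) v)" for v
        using Suc.IH[OF f'(2) g] Suc.prems by blast
    qed (rule g')
  qed
qed

text \<open>Replaces the existentially quantified derivative by the canonical one. Directions
  outside \<open>E\<close> are covered by composing it with the projection, which changes nothing on
  increments within \<open>S\<close>.\<close>

lemma Ck_on_Suc_iff: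
  assumes "rel_open E S"
  shows "Ck_on (Suc k) S f \<longleftrightarrow>
    (\<forall>x\<in>S. f differentiable (at x within S)) \<and> (\<forall>v\<in>E. Ck_on k S (\<lambda>x. fderiv f S x v))" (is "?L = ?R")
proof
  assume ?L
  then obtain f' where f': "\<And>x. x\<in>S \<Longrightarrow> (f has_derivative f' x) (at x within S)" "\<And>v. Ck_on k S (\<lambda>x. f' x v)"
    by (rule Ck_on_SucE) (rule that)
  have "f differentiable (at x within S)" if "x \<in> S" for x
    using f'(1)[OF that] differentiableI by blast
  moreover have "Ck_on k S (\<lambda>x. fderiv f S x v)" if "v \<in> E" for v
    by (rule Ck_on_cong[OF f'(2)]) (rule fderiv_eq[OF assms _ f'(1) that, symmetric])
  ultimately show ?R by simp
next
  assume R: ?R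
  let ?f' = "\<lambda>x v. fderiv f S x (orth_proj E v)"
  have E: "subspace E" using assms rel_open_subspace by blast
  show ?L
  proof (rule Ck_on_SucI)
    show "(f has_derivative ?f' x) (at x within S)" if "x\<in>S" for x
    proof (rule has_derivative_rel_mono[OF assms that])
      show d: "(f has_derivative fderiv f S x) (at x within S)" using R that frechet_derivative_works by blast
      show "bounded_linear (?f' x)"
        using d linear_orth_proj[OF E]
        by (simp add: bounded_linear_compose has_derivative_bounded_linear linear_conv_bounded_linear)
    qed (simp add: orth_proj_id[OF E])
    show "Ck_on k S (\<lambda>x. ?f' x v)" for v using R orth_proj_in[OF E] by blast
  qed
qed

text \<open>The canonical derivative of \<open>Ck_on_Suc_iff\<close> is the same on \<open>S\<close>
  and on each piece \<open>T\<close>, so no choices of derivatives have to be glued.\<close>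

lemma Ck_on_local:
  assumes "rel_open E S" "\<And>x. x\<in>S \<Longrightarrow> \<exists>T. rel_open E T \<and> x \<in> T \<and> T \<subseteq> S \<and> Ck_on k T f"
  shows "Ck_on k S f"
  using assms(2)
proof (induction k arbitrary: f)
  case 0
  show ?case unfolding Ck_on.simps continuous_on_eq_continuous_within
  proof
    fix x assume "x \<in> S"
    then obtain T where T: "rel_open E T" "x \<in> T" "T \<subseteq> S" "continuous_on T f" using 0 by auto
    then show "continuous (at x within S) f"
      using at_within_rel_open[OF assms(1) T(1,3,2)] continuous_on_eq_continuous_within by metis
  qed
next
  case (Suc k)
  show ?case unfolding Ck_on_Suc_iff[OF assms(1)]
  proof (intro conjI ballI Suc.IH)
    fix x assume "x \<in> S"
    then obtain T where T: "rel_open E T" "x \<in> T" "T \<subseteq> S" "Ck_on (Suc k) T f" using Suc by blast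
    then show "f differentiable at x within S"
      using at_within_rel_open[OF assms(1) T(1,3,2)] Ck_on_Suc_iff[OF T(1)] by metis
    fix v assume "v \<in> E"
    then have "Ck_on k T (\<lambda>x. fderiv f T x v)" using T Ck_on_Suc_iff[OF T(1)] by metis
    then have "Ck_on k T (\<lambda>x. fderiv f S x v)"
      by (rule Ck_on_cong) (metis T(1,3) assms(1) at_within_rel_open)
    then show "\<exists>T. rel_open E T \<and> x \<in> T \<and> T \<subseteq> S \<and> Ck_on k T (\<lambda>x. fderiv f S x v)" using T by blast
  qed
qed

section \<open>Closure properties of smooth maps\<close>

lemma smooth_on_subset: "smooth_on S f \<Longrightarrow> T \<subseteq> S \<Longrightarrow> smooth_on T f"
  unfolding smooth_on_def using Ck_on_subset by blast

lemma smooth_on_cong: "smooth_on S f \<Longrightarrow> (\<And>x. x \<in> S \<Longrightarrow> f x = g x) \<Longrightarrow> smooth_on S g"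
  unfolding smooth_on_def using Ck_on_cong by blast

lemma smooth_on_continuous_on: "smooth_on S f \<Longrightarrow> continuous_on S f"
  unfolding smooth_on_def using Ck_on_imp_continuous_on by blast

lemma smooth_on_const: "smooth_on S (\<lambda>x. c)"
  unfolding smooth_on_def using Ck_on_const by blast

lemma smooth_on_id: "smooth_on S (\<lambda>x. x)"
  unfolding smooth_on_def using Ck_on_id by blast

lemma smooth_on_bounded_linear: "bounded_linear L \<Longrightarrow> smooth_on S f \<Longrightarrow> smooth_on S (\<lambda>x. L (f x))"
  by (simp add: smooth_on_def Ck_on_bounded_linear)

lemma smooth_on_add: "smooth_on S f \<Longrightarrow> smooth_on S g \<Longrightarrow> smooth_on S (\<lambda>x. f x + g x)"
  by (simp add: smooth_on_def Ck_on_add)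

lemma smooth_on_diff: "smooth_on S f \<Longrightarrow> smooth_on S g \<Longrightarrow> smooth_on S (\<lambda>x. f x - g x)"
  by (simp add: smooth_on_def Ck_on_diff)

lemma smooth_on_sum: "(\<And>i. i \<in> I \<Longrightarrow> smooth_on S (f i)) \<Longrightarrow> smooth_on S (\<lambda>x. \<Sum>i\<in>I. f i x)"
  by (simp add: smooth_on_def Ck_on_sum)

lemma smooth_on_scaleR: "smooth_on S f \<Longrightarrow> smooth_on S g \<Longrightarrow> smooth_on S (\<lambda>x. f x *\<^sub>R g x)"
  by (simp add: smooth_on_def Ck_on_scaleR)

lemma smooth_on_inner_left: "smooth_on S f \<Longrightarrow> smooth_on S (\<lambda>x. f x \<bullet> w)"
  by (simp add: smooth_on_def Ck_on_inner_left)

lemma smooth_on_linear_apply: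
  fixes w :: "'a::euclidean_space \<Rightarrow> 'b::euclidean_space"
  assumes "\<And>x. x \<in> S \<Longrightarrow> linear (A x)" "\<And>v. smooth_on S (\<lambda>x. A x v)" "smooth_on S w"
  shows "smooth_on S (\<lambda>x. A x (w x))"
  unfolding smooth_on_def by (rule allI, rule Ck_on_linear_apply) (use assms in \<open>auto simp: smooth_on_def\<close>)

lemma smooth_on_compose:
  fixes f :: "'b::euclidean_space \<Rightarrow> 'c::real_normed_vector" and g :: "'a::euclidean_space \<Rightarrow> 'b"
  shows "smooth_on T f \<Longrightarrow> smooth_on S g \<Longrightarrow> g ` S \<subseteq> T \<Longrightarrow> smooth_on S (\<lambda>x. f (g x))"
  unfolding smooth_on_def using Ck_on_compose[of _ T f S g] by simp

lemma smooth_on_local: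
  assumes "rel_open E S" "\<And>x. x\<in>S \<Longrightarrow> \<exists>T. rel_open E T \<and> x \<in> T \<and> T \<subseteq> S \<and> smooth_on T f"
  shows "smooth_on S f"
  unfolding smooth_on_def
proof (intro allI Ck_on_local[OF assms(1)])
  fix k x assume "x \<in> S"
  then show "\<exists>T. rel_open E T \<and> x \<in> T \<and> T \<subseteq> S \<and> Ck_on k T f"
    using assms(2)[of x] unfolding smooth_on_def by auto
qed

lemma smooth_on_has_derivative:
  assumes "smooth_on S f" "x \<in> S"
  shows "(f has_derivative fderiv f S x) (at x within S)"
proof -
  have "Ck_on (Suc 0) S f" using assms unfolding smooth_on_def by blast
  then have "f differentiable (at x within S)" by (rule Ck_on_SucE) (meson assms(2) differentiableI)
  then show ?thesis using frechet_derivative_works by blast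
qed

lemma smooth_on_fderiv:
  assumes "rel_open E S" "smooth_on S f" "v \<in> E"
  shows "smooth_on S (\<lambda>x. fderiv f S x v)"
  using assms(2,3) unfolding smooth_on_def by (metis Ck_on_Suc_iff[OF assms(1)])

lemma linear_fderiv:
  assumes "smooth_on S f" "x \<in> S"
  shows "linear (fderiv f S x)"
  using smooth_on_has_derivative[OF assms] has_derivative_linear by blast

lemma fderiv_in:
  fixes f :: "'a::euclidean_space \<Rightarrow> 'b::euclidean_space"
  assumes "rel_open E S" "smooth_on S f" "x \<in> S" "v \<in> E" "subspace F" "f ` S \<subseteq> F"
  shows "fderiv f S x v \<in> F"
  using has_derivative_in_closed_subspace[OF assms(1,3) smooth_on_has_derivative] assms by blast

lemma fderiv_compose:
  fixes f :: "'b::euclidean_space \<Rightarrow> 'c::real_normed_vector" and g :: "'a::euclidean_space \<Rightarrow> 'b"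
  assumes "rel_open E S" "smooth_on S g" "smooth_on T f" "g ` S \<subseteq> T" "x \<in> S" "v \<in> E"
  shows "fderiv (\<lambda>x. f (g x)) S x v = fderiv f T (g x) (fderiv g S x v)"
proof (rule fderiv_eq[OF assms(1,5) _ assms(6)])
  have "(f has_derivative fderiv f T (g x)) (at (g x) within g ` S)"
    using smooth_on_has_derivative[OF assms(3), of "g x"] assms has_derivative_subset by blast
  from diff_chain_within[OF smooth_on_has_derivative[OF assms(2,5)] this]
  show "((\<lambda>x. f (g x)) has_derivative (\<lambda>v. fderiv f T (g x) (fderiv g S x v))) (at x within S)"
    by (simp add: o_def)
qed

lemma fderiv_id:
  assumes "rel_open E S" "x \<in> S" "v \<in> E"
  shows "fderiv (\<lambda>x. x) S x v = v"
  by (rule fderiv_eq[OF assms(1,2) _ assms(3)]) simp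

section \<open>Linear systems, inverse functions and second derivatives\<close>

text \<open>Injectivity amounts to a positive lower bound, which survives a small perturbation. The
  bound is uniform on \<open>T\<close>, and this yields continuity of solutions of the linear
  system.\<close>

lemma inj_linear_near:
  fixes A :: "'a::euclidean_space \<Rightarrow> 'e::euclidean_space \<Rightarrow> 'e"
  assumes "rel_open E S" "x0 \<in> S" "\<And>x. x \<in> S \<Longrightarrow> linear (A x)"
    "\<And>v. continuous_on S (\<lambda>x. A x v)" "inj (A x0)"
  obtains T c where "rel_open E T" "x0 \<in> T" "T \<subseteq> S" "c > 0" "\<And>x v. x \<in> T \<Longrightarrow> c * norm v \<le> norm (A x v)"
proof -
  obtain c where c: "c > 0" "\<And>v. c * norm v \<le> norm (A x0 v)"
    using linear_inj_bounded_below_pos[OF assms(3)[OF assms(2)] assms(5)] by blast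
  \<comment> \<open>Continuous in \<open>x\<close>, zero at \<open>x0\<close>, and an upper bound
    for the operator norm of \<open>A x - A x0\<close>.\<close>
  define n where "n = (\<lambda>x. \<Sum>b\<in>Basis. norm (A x b - A x0 b))"
  have n: "continuous_on S n"
    unfolding n_def by (intro continuous_intros assms)
  define T where "T = S \<inter> n -` {..<c/2}"
  have T: "rel_open E T" unfolding T_def
    by (rule rel_open_preimage[OF assms(1) n, of UNIV]) auto
  have x0: "x0 \<in> T" using assms c by (simp add: T_def n_def)
  have "(c/2) * norm v \<le> norm (A x v)" if x: "x \<in> T" for x v
  proof -
    have l: "linear (A x)" "linear (A x0)" using assms that T_def by auto
    have "A x v - A x0 v = (\<Sum>b\<in>Basis. (v \<bullet> b) *\<^sub>R (A x b - A x0 b))"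
      unfolding linear_euclidean_expand[OF l(1), of v] linear_euclidean_expand[OF l(2), of v]
      by (simp add: sum_subtractf algebra_simps)
    also have "norm \<dots> \<le> (\<Sum>b\<in>Basis. norm v * norm (A x b - A x0 b))"
      by (rule sum_norm_le) (simp add: Basis_le_norm mult_right_mono)
    also have "\<dots> = norm v * n x" by (simp add: n_def sum_distrib_left)
    also have "\<dots> \<le> norm v * (c/2)" using x by (intro mult_left_mono) (auto simp: T_def)
    finally have "norm (A x v - A x0 v) \<le> (c/2) * norm v" by (simp add: mult.commute)
    moreover have "norm (A x0 v) \<le> norm (A x v) + norm (A x v - A x0 v)"
      by (metis norm_minus_commute norm_triangle_sub)
    ultimately show ?thesis using c(2)[of v] by (simp add: field_simps)
  qed
  then show ?thesis using that[of T "c/2"] T x0 c by (auto simp: T_def)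
qed

text \<open>A product rule in which one factor is merely continuous, at the price that the other
  vanishes at the point. It permits differentiating an expression in a solution whose own
  differentiability is still to be shown.\<close>

lemma has_derivative_continuous_scaleR:
  fixes g :: "'a::euclidean_space \<Rightarrow> 'b::real_normed_vector" and f :: "'a \<Rightarrow> real"
  assumes "continuous (at x within S) f" "(g has_derivative g') (at x within S)" "g x = 0"
  shows "((\<lambda>y. f y *\<^sub>R g y) has_derivative (\<lambda>h. f x *\<^sub>R g' h)) (at x within S)"
proof -
  \<comment> \<open>Here \<open>f y - f x\<close> tends to 0 while \<open>g y\<close> is of order
    \<open>norm (y - x)\<close>, because \<open>g\<close> vanishes at \<open>x\<close>.\<close>
  have "((\<lambda>y. (f y - f x) *\<^sub>R g y) has_derivative (\<lambda>h. 0)) (at x within S)"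
    unfolding has_derivative_within_alt2
  proof (intro conjI allI impI)
    fix e :: real assume e: "e > 0"
    have bl: "bounded_linear g'" using assms(2) has_derivative_bounded_linear by blast
    then obtain K where K: "K > 0" "\<And>v. norm (g' v) \<le> norm v * K" using bounded_linear.pos_bounded by blast
    have 1: "\<forall>\<^sub>F y in at x within S. norm (g y - g x - g' (y - x)) \<le> 1 * norm (y - x)"
      using assms(2) unfolding has_derivative_within_alt2 by (meson zero_less_one)
    have 2: "\<forall>\<^sub>F y in at x within S. dist (f y) (f x) < e / (1 + K)"
      using assms(1) e K unfolding continuous_within tendsto_iff by (meson add_pos_pos divide_pos_pos zero_less_one)
    show "\<forall>\<^sub>F y in at x within S. norm ((f y - f x) *\<^sub>R g y - (f x - f x) *\<^sub>R g x - 0) \<le> e * norm (y - x)"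
      using 1 2
    proof eventually_elim
      case (elim y)
      have "norm (g y) \<le> norm (g y - g x - g' (y - x)) + norm (g' (y - x))"
        using norm_triangle_ineq[of "g y - g x - g' (y - x)" "g' (y - x)"] assms(3) by simp
      also have "\<dots> \<le> (1 + K) * norm (y - x)" using elim(1) K(2)[of "y - x"] by (simp add: algebra_simps)
      finally have g: "norm (g y) \<le> (1 + K) * norm (y - x)" .
      have "norm ((f y - f x) *\<^sub>R g y) \<le> (e / (1 + K)) * ((1 + K) * norm (y - x))"
        unfolding norm_scaleR using elim(2) g e K by (intro mult_mono) (auto simp: dist_real_def)
      then show ?case using K by simp
    qed
  qed simp
  moreover have "((\<lambda>y. f x *\<^sub>R g y) has_derivative (\<lambda>h. f x *\<^sub>R g' h)) (at x within S)"
    using assms(2) by (rule has_derivative_scaleR_right)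
  ultimately have "((\<lambda>y. (f y - f x) *\<^sub>R g y + f x *\<^sub>R g y) has_derivative (\<lambda>h. 0 + f x *\<^sub>R g' h)) (at x within S)"
    by (rule has_derivative_add)
  then show ?thesis by (simp add: algebra_simps)
qed

text \<open>
  A derivative of the solution \<open>w\<close> of \<open>A w = y\<close> solves \<open>A w' = y' - A' w\<close>, a system of the same
  form, so \<open>w\<close> is as regular as \<open>A\<close> and \<open>y\<close>.
\<close>

lemma Ck_on_linear_solve:
  fixes A :: "'a::euclidean_space \<Rightarrow> 'e::euclidean_space \<Rightarrow> 'e"
  assumes "rel_open E S" "\<And>x. x \<in> S \<Longrightarrow> linear (A x)" "\<And>x. x \<in> S \<Longrightarrow> inj (A x)"
  shows "(\<And>v. Ck_on k S (\<lambda>x. A x v)) \<Longrightarrow> Ck_on k S y \<Longrightarrow> (\<And>x. x \<in> S \<Longrightarrow> A x (w x) = y x) \<Longrightarrow> Ck_on k S w"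
proof (induction k arbitrary: y w)
  case 0
  have Ac: "continuous_on S (\<lambda>x. A x v)" for v using 0(1)[of v] by simp
  have yc: "continuous_on S y" using 0(2) by simp
  have "continuous (at x0 within S) w" if x0: "x0 \<in> S" for x0
  proof -
    obtain T c where T: "rel_open E T" "x0 \<in> T" "T \<subseteq> S" "c > 0" "\<And>x v. x \<in> T \<Longrightarrow> c * norm v \<le> norm (A x v)"
      using inj_linear_near[OF assms(1) x0 assms(2) Ac assms(3)[OF x0]] by blast
    have "((\<lambda>x. A x (w x0)) \<longlongrightarrow> A x0 (w x0)) (at x0 within S)" "(y \<longlongrightarrow> y x0) (at x0 within S)"
      using Ac[of "w x0"] yc x0 unfolding continuous_on_def by blast+
    then have lim: "((\<lambda>x. y x - A x (w x0)) \<longlongrightarrow> y x0 - A x0 (w x0)) (at x0 within T)"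
      unfolding at_within_rel_open[OF assms(1) T(1,3,2)] by (intro tendsto_diff)
    have b: "norm (w x - w x0) \<le> norm (y x - A x (w x0)) * (1 / c)" if "x \<in> T" for x
    proof -
      have x: "x \<in> S" using that T(3) by blast
      have "A x (w x - w x0) = y x - A x (w x0)"
        using linear_diff[OF assms(2)[OF x]] 0(3)[OF x] by simp
      then have "c * norm (w x - w x0) \<le> norm (y x - A x (w x0))"
        using T(5)[OF that, of "w x - w x0"] by metis
      then show ?thesis using T(4) by (simp add: pos_le_divide_eq mult.commute)
    qed
    have "((\<lambda>x. norm (y x - A x (w x0)) * (1/c)) \<longlongrightarrow> 0) (at x0 within T)"
      using tendsto_mult_right[OF tendsto_norm[OF lim], of "1/c"] 0(3)[OF x0] by simp
    then have "((\<lambda>x. w x - w x0) \<longlongrightarrow> 0) (at x0 within T)"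
      by (rule Lim_null_comparison[rotated]) (use b in \<open>simp add: eventually_at_topological, blast\<close>)
    then show ?thesis
      using at_within_rel_open[OF assms(1) T(1,3,2)] by (simp add: continuous_within LIM_zero_iff)
  qed
  then show ?case by (simp add: continuous_on_eq_continuous_within)
next
  case (Suc k)
  have "\<exists>f'. (\<forall>x\<in>S. ((\<lambda>x. A x v) has_derivative f' x) (at x within S)) \<and> (\<forall>h. Ck_on k S (\<lambda>x. f' x h))" for v
    using Suc.prems(1)[of v] unfolding Ck_on.simps(2) .
  then obtain A' where A': "\<And>v x. x\<in>S \<Longrightarrow> ((\<lambda>x. A x v) has_derivative A' v x) (at x within S)"
    "\<And>v h. Ck_on k S (\<lambda>x. A' v x h)" by metis
  obtain y' where y': "\<And>x. x\<in>S \<Longrightarrow> (y has_derivative y' x) (at x within S)" "\<And>v. Ck_on k S (\<lambda>x. y' x v)"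
    using Suc.prems(2) by (rule Ck_on_SucE) (rule that)
  have Ak: "Ck_on k S (\<lambda>x. A x v)" for v by (rule Ck_on_Suc_imp[OF Suc.prems(1)])
  have wk: "Ck_on k S w" by (rule Suc.IH[OF Ak Ck_on_Suc_imp[OF Suc.prems(2)] Suc.prems(3)])
  \<comment> \<open>The sum is the derivative of \<open>A\<close> applied to \<open>w\<close>,
    written in the basis since \<open>A'\<close> is given for each fixed basis vector.\<close>
  define r where "r = (\<lambda>x h. y' x h - (\<Sum>b\<in>Basis. (w x \<bullet> b) *\<^sub>R A' b x h))"
  have rk: "Ck_on k S (\<lambda>x. r x h)" for h
    unfolding r_def by (intro Ck_on_diff y' Ck_on_sum Ck_on_scaleR Ck_on_inner_left wk A')
  have "\<exists>B. linear B \<and> (\<forall>v. B (A x v) = v) \<and> (\<forall>v. A x (B v) = v)" if "x \<in> S" for x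
    using linear_injective_isomorphism[OF assms(2,3)] that by auto
  then obtain B where B: "\<And>x. x \<in> S \<Longrightarrow> linear (B x)" "\<And>x v. x \<in> S \<Longrightarrow> B x (A x v) = v" "\<And>x v. x \<in> S \<Longrightarrow> A x (B x v) = v"
    by metis
  show ?case
  proof (rule Ck_on_SucI)
    show "(w has_derivative (\<lambda>h. B x (r x h))) (at x within S)" if x: "x \<in> S" for x
    proof -
      have wc: "continuous (at x within S) w"
        using Ck_on_imp_continuous_on[OF wk] x continuous_on_eq_continuous_within by blast
      have d: "((\<lambda>z. (w z \<bullet> b) *\<^sub>R (A z b - A x b)) has_derivative (\<lambda>h. (w x \<bullet> b) *\<^sub>R A' b x h)) (at x within S)" for b
      proof (rule has_derivative_continuous_scaleR)
        show "((\<lambda>z. A z b - A x b) has_derivative A' b x) (at x within S)"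
          using has_derivative_diff[OF A'(1)[OF x] has_derivative_const] by simp
      qed (use wc in \<open>auto intro: continuous_intros\<close>)
      have blB: "bounded_linear (B x)" using B(1)[OF x] linear_conv_bounded_linear by blast
      \<comment> \<open>With the operator frozen at \<open>x\<close>, \<open>w z\<close> equals
        \<open>B x\<close> of \<open>y z - (A z - A x) (w z)\<close>. The second term is a
        continuous factor times one vanishing at \<open>x\<close>, so it can be differentiated
        before \<open>w\<close> is known to be differentiable.\<close>
      have D: "((\<lambda>z. B x (y z - (\<Sum>b\<in>Basis. (w z \<bullet> b) *\<^sub>R (A z b - A x b)))) has_derivative (\<lambda>h. B x (r x h))) (at x within S)"
        unfolding r_def
        by (rule bounded_linear.has_derivative[OF blB has_derivative_diff[OF y'(1)[OF x] has_derivative_sum[OF d]]])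
      have "B x (y z - (\<Sum>b\<in>Basis. (w z \<bullet> b) *\<^sub>R (A z b - A x b))) = w z" if "z \<in> S" for z
      proof -
        have "(\<Sum>b\<in>Basis. (w z \<bullet> b) *\<^sub>R (A z b - A x b)) = A z (w z) - A x (w z)"
          unfolding linear_euclidean_expand[OF assms(2)[OF that], of "w z"]
            linear_euclidean_expand[OF assms(2)[OF x], of "w z"]
          by (simp add: sum_subtractf algebra_simps)
        then show ?thesis using Suc.prems(3)[OF that] B(2)[OF x] by simp
      qed
      then show ?thesis using has_derivative_transform[OF x _ D, of w] by simp
    qed
    show "Ck_on k S (\<lambda>x. B x (r x h))" for h
      by (rule Suc.IH[OF Ak rk]) (simp add: B)
  qed
qed

lemma smooth_on_linear_solve:
  fixes A :: "'a::euclidean_space \<Rightarrow> 'e::euclidean_space \<Rightarrow> 'e"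
  assumes "rel_open E S" "\<And>x. x \<in> S \<Longrightarrow> linear (A x)" "\<And>x. x \<in> S \<Longrightarrow> inj (A x)"
    "\<And>v. smooth_on S (\<lambda>x. A x v)" "smooth_on S y" "\<And>x. x \<in> S \<Longrightarrow> A x (w x) = y x"
  shows "smooth_on S w"
  unfolding smooth_on_def
proof
  fix k show "Ck_on k S w"
    by (rule Ck_on_linear_solve[of E S A k y]) (use assms in \<open>auto simp: smooth_on_def\<close>)
qed

text \<open>Regularity of the inverse is raised step by step: its derivative in direction
  \<open>v\<close> solves a linear system whose coefficients are the derivative of \<open>f\<close>
  composed with \<open>g\<close>, hence as regular as \<open>g\<close> is already known to
  be.\<close>

lemma smooth_inverse_function:
  fixes f :: "'e::euclidean_space \<Rightarrow> 'e"
  assumes "open U" "smooth_on U f" "x0 \<in> U" "inj (fderiv f U x0)"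
  obtains U' V g where "open U'" "U' \<subseteq> U" "x0 \<in> U'" "open V" "f x0 \<in> V" "homeomorphism U' V f g" "smooth_on V g"
proof -
  have ro: "rel_open UNIV U" using assms rel_open_UNIV by blast
  have der: "(f has_derivative fderiv f U x) (at x)" if "x \<in> U" for x
    using smooth_on_has_derivative[OF assms(2) that] at_within_open[OF that assms(1)] by simp
  define f' where "f' = (\<lambda>x. Blinfun (fderiv f U x))"
  have f': "blinfun_apply (f' x) = fderiv f U x" if "x \<in> U" for x
    unfolding f'_def using der[OF that] has_derivative_bounded_linear bounded_linear_Blinfun_apply by blast
  have sm: "smooth_on U (\<lambda>x. fderiv f U x v)" for v
    using smooth_on_fderiv[OF ro assms(2)] by simp
  have cont: "continuous_on U f'"
  proof (rule continuous_on_blinfun_componentwise)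
    show "continuous_on U (\<lambda>x. blinfun_apply (f' x) i)" for i
      using smooth_on_continuous_on[OF sm[of i]] f' by (simp cong: continuous_on_cong)
  qed
  obtain B where B: "linear B" "\<And>v. B (fderiv f U x0 v) = v"
    using linear_injective_left_inverse[OF linear_fderiv[OF assms(2,3)] assms(4)] by (auto simp: fun_eq_iff)
  have "Blinfun B o\<^sub>L f' x0 = id_blinfun"
    using B(2) f'[OF assms(3)] bounded_linear_Blinfun_apply[OF B(1)[unfolded linear_conv_bounded_linear]]
    by (intro blinfun_eqI) simp
  then obtain U' V g g' where g: "open U'" "U' \<subseteq> U" "x0 \<in> U'" "open V" "f x0 \<in> V" "homeomorphism U' V f g"
    "\<And>y. y \<in> V \<Longrightarrow> (g has_derivative (g' y)) (at y)"
    "\<And>y. y \<in> V \<Longrightarrow> g' y = inv (blinfun_apply (f'(g y)))"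
    "\<And>y. y \<in> V \<Longrightarrow> bij (blinfun_apply (f'(g y)))"
    using inverse_function_theorem[OF assms(1) _ cont assms(3)] der f' by metis
  have gU: "g y \<in> U" if "y \<in> V" for y
    using g(2,6) that unfolding homeomorphism_def by blast
  have "Ck_on k V g" for k
  proof (induction k)
    case 0
    then show ?case using g(6) unfolding homeomorphism_def by simp
  next
    case (Suc k)
    show ?case
    proof (rule Ck_on_SucI)
      show "(g has_derivative g' y) (at y within V)" if "y \<in> V" for y
        using g(7)[OF that] has_derivative_at_withinI by blast
      show "Ck_on k V (\<lambda>y. g' y v)" for v
      proof (rule Ck_on_linear_solve[of UNIV V "\<lambda>y. fderiv f U (g y)" k "\<lambda>y. v"])
        show "inj (fderiv f U (g y))" if "y \<in> V" for y
          using g(9)[OF that] f'[OF gU[OF that]] bij_is_inj by metis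
        show "Ck_on k V (\<lambda>x. fderiv f U (g x) v)" for v
          using Ck_on_compose[OF _ Suc, of U "\<lambda>x. fderiv f U x v"] sm[of v] gU unfolding smooth_on_def by blast
        show "fderiv f U (g y) (g' y v) = v" if "y \<in> V" for y
          using g(8,9)[OF that] f'[OF gU[OF that]] by (simp add: bij_is_surj surj_f_inv_f)
      qed (use g gU in \<open>auto simp: rel_open_UNIV Ck_on_const linear_fderiv[OF assms(2)]\<close>)
    qed
  qed
  then show ?thesis using that g unfolding smooth_on_def by blast
qed

section \<open>Symmetry of second derivatives\<close>

lemma has_derivative_along_line:
  assumes "rel_open E S" "smooth_on S f" "a \<in> E" "p + s *\<^sub>R a \<in> S" "\<And>t. t \<in> I \<Longrightarrow> p + t *\<^sub>R a \<in> S"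
  shows "((\<lambda>t. f (p + t *\<^sub>R a)) has_derivative (\<lambda>h. h *\<^sub>R fderiv f S (p + s *\<^sub>R a) a)) (at s within I)"
proof -
  have "((\<lambda>t. p + t *\<^sub>R a) has_derivative (\<lambda>h. h *\<^sub>R a)) (at s within I)"
    by (auto intro!: derivative_eq_intros)
  moreover have "(f has_derivative fderiv f S (p + s *\<^sub>R a)) (at (p + s *\<^sub>R a) within (\<lambda>t. p + t *\<^sub>R a) ` I)"
    using smooth_on_has_derivative[OF assms(2,4)] assms(5) by (auto intro: has_derivative_subset)
  ultimately have "(f \<circ> (\<lambda>t. p + t *\<^sub>R a) has_derivative fderiv f S (p + s *\<^sub>R a) \<circ> (\<lambda>h. h *\<^sub>R a)) (at s within I)"
    by (rule diff_chain_within)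
  then show ?thesis
    using linear_scale[OF linear_fderiv[OF assms(2,4)]] by (simp add: o_def)
qed

text \<open>The mean value theorem twice: along \<open>a\<close> for the increment of
  \<open>f\<close> in direction \<open>b\<close>, then along \<open>b\<close> for the derivative in
  direction \<open>a\<close>.\<close>

lemma second_difference:
  fixes f :: "'e::euclidean_space \<Rightarrow> real"
  assumes "rel_open E S" "smooth_on S f" "a \<in> E" "b \<in> E" "r > 0"
    and S: "\<And>s t. 0 \<le> s \<Longrightarrow> s \<le> r \<Longrightarrow> 0 \<le> t \<Longrightarrow> t \<le> r \<Longrightarrow> x + s *\<^sub>R a + t *\<^sub>R b \<in> S"
  obtains s t where "0 \<le> s" "s \<le> r" "0 \<le> t" "t \<le> r"
    "f (x + r *\<^sub>R a + r *\<^sub>R b) - f (x + r *\<^sub>R a) - (f (x + r *\<^sub>R b) - f x) =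
       r * r * fderiv (\<lambda>y. fderiv f S y a) S (x + s *\<^sub>R a + t *\<^sub>R b) b"
proof -
  have S': "x + t *\<^sub>R b + s *\<^sub>R a \<in> S" if "0 \<le> s" "s \<le> r" "0 \<le> t" "t \<le> r" for s t
    using S[OF that] by (simp add: add.assoc add.commute[of "t *\<^sub>R b"])
  have S0: "x + s *\<^sub>R a \<in> S" if "0 \<le> s" "s \<le> r" for s
    using S[OF that, of 0] assms(5) by simp
  define \<phi> where "\<phi> = (\<lambda>s. f (x + r *\<^sub>R b + s *\<^sub>R a) - f (x + s *\<^sub>R a))"
  have "(\<phi> has_derivative (\<lambda>h. h *\<^sub>R fderiv f S (x + r *\<^sub>R b + s *\<^sub>R a) a - h *\<^sub>R fderiv f S (x + s *\<^sub>R a) a)) (at s within {0..r})"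
    if "0 \<le> s" "s \<le> r" for s
    unfolding \<phi>_def using that assms(5) S' S0
    by (intro has_derivative_diff has_derivative_along_line[OF assms(1-3)]) auto
  from mvt_simple[OF assms(5) this] obtain s where "s \<in> {0<..<r}" and s3:
    "\<phi> r - \<phi> 0 = r * (fderiv f S (x + r *\<^sub>R b + s *\<^sub>R a) a - fderiv f S (x + s *\<^sub>R a) a)"
    by (auto simp: right_diff_distrib)
  then have s: "0 \<le> s" "s \<le> r" by auto
  define \<psi> where "\<psi> = (\<lambda>t. fderiv f S (x + s *\<^sub>R a + t *\<^sub>R b) a)"
  have "(\<psi> has_derivative (\<lambda>h. h *\<^sub>R fderiv (\<lambda>y. fderiv f S y a) S (x + s *\<^sub>R a + t *\<^sub>R b) b)) (at t within {0..r})"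
    if "0 \<le> t" "t \<le> r" for t
    unfolding \<psi>_def using that s S
    by (intro has_derivative_along_line[OF assms(1) smooth_on_fderiv[OF assms(1,2,3)] assms(4)]) auto
  from mvt_simple[OF assms(5) this] obtain t where "t \<in> {0<..<r}" and t3:
    "\<psi> r - \<psi> 0 = r * fderiv (\<lambda>y. fderiv f S y a) S (x + s *\<^sub>R a + t *\<^sub>R b) b"
    by auto
  then have t: "0 \<le> t" "t \<le> r" by auto
  show ?thesis
    by (rule that[OF s(1,2) t(1,2)]) (use s3 t3 in \<open>simp add: \<phi>_def \<psi>_def algebra_simps\<close>)
qed

text \<open>The second difference is symmetric in \<open>a\<close> and \<open>b\<close>, so both
  mixed derivatives take a common value at points of arbitrarily small parallelograms at
  \<open>x\<close>; continuity finishes.\<close>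

lemma second_derivative_symmetric_real:
  fixes f :: "'e::euclidean_space \<Rightarrow> real"
  assumes "rel_open E S" "smooth_on S f" "x \<in> S" "a \<in> E" "b \<in> E"
  shows "fderiv (\<lambda>y. fderiv f S y a) S x b = fderiv (\<lambda>y. fderiv f S y b) S x a"
proof (rule ccontr)
  let ?F = "fderiv (\<lambda>y. fderiv f S y a) S" and ?G = "fderiv (\<lambda>y. fderiv f S y b) S"
  assume ne: "?F x b \<noteq> ?G x a"
  \<comment> \<open>Half the gap: one number cannot be closer than \<open>e\<close> to both
    sides.\<close>
  define e where "e = \<bar>?F x b - ?G x a\<bar> / 2"
  have e: "e > 0" using ne by (simp add: e_def)
  have c: "continuous_on S (\<lambda>y. ?F y b)" "continuous_on S (\<lambda>y. ?G y a)"
    using assms by (auto intro!: smooth_on_continuous_on smooth_on_fderiv[OF assms(1)])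
  obtain d1 where d1: "d1 > 0" "\<And>y. y \<in> S \<Longrightarrow> dist y x < d1 \<Longrightarrow> dist (?F y b) (?F x b) < e"
    using c(1) assms(3) e unfolding continuous_on_iff by meson
  obtain d2 where d2: "d2 > 0" "\<And>y. y \<in> S \<Longrightarrow> dist y x < d2 \<Longrightarrow> dist (?G y a) (?G x a) < e"
    using c(2) assms(3) e unfolding continuous_on_iff by meson
  obtain d3 where d3: "d3 > 0" "\<And>y. y \<in> E \<Longrightarrow> dist y x < d3 \<Longrightarrow> y \<in> S"
    using assms(1,3) unfolding rel_open_def openin_euclidean_subtopology_iff by blast
  have E: "subspace E" using assms rel_open_subspace by blast
  define d where "d = min d1 (min d2 d3)"
  \<comment> \<open>Small enough that the parallelogram with sides \<open>r *\<^sub>R a\<close> and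
    \<open>r *\<^sub>R b\<close> stays within \<open>d\<close> of \<open>x\<close>; the summand 1
    covers \<open>a = b = 0\<close>.\<close>
  define r where "r = d / (2 * (norm a + norm b + 1))"
  have d: "d > 0" using d1 d2 d3 by (simp add: d_def)
  have r: "r > 0" unfolding r_def using d by (intro divide_pos_pos) (auto intro: add_nonneg_pos)
  have near: "dist (x + s *\<^sub>R a + t *\<^sub>R b) x < d" if "0 \<le> s" "s \<le> r" "0 \<le> t" "t \<le> r" for s t
  proof -
    have "dist (x + s *\<^sub>R a + t *\<^sub>R b) x = norm (s *\<^sub>R a + t *\<^sub>R b)" by (simp add: dist_norm)
    also have "\<dots> \<le> s * norm a + t * norm b" using norm_triangle_ineq[of "s *\<^sub>R a" "t *\<^sub>R b"] that by simp
    also have "\<dots> \<le> r * norm a + r * norm b" using that by (intro add_mono mult_right_mono) auto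
    also have "\<dots> < r * (2 * (norm a + norm b + 1))" using r by (simp add: algebra_simps add_nonneg_pos add_pos_nonneg)
    also have "\<dots> = d"
    proof -
      have "norm a + norm b + 1 > 0" by (intro add_nonneg_pos) auto
      then show ?thesis by (simp add: r_def)
    qed
    finally show ?thesis .
  qed
  have inS: "x + s *\<^sub>R a + t *\<^sub>R b \<in> S" if "0 \<le> s" "s \<le> r" "0 \<le> t" "t \<le> r" for s t
    using near[OF that] assms E rel_open_subset[OF assms(1)]
    by (intro d3) (auto simp: d_def intro!: subspace_add subspace_scale)
  have inS': "x + t *\<^sub>R b + s *\<^sub>R a \<in> S" if "0 \<le> t" "t \<le> r" "0 \<le> s" "s \<le> r" for s t
    using inS[OF that(3,4,1,2)] by (simp add: add.assoc add.commute[of "t *\<^sub>R b"])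
  obtain s t where st: "0 \<le> s" "s \<le> r" "0 \<le> t" "t \<le> r"
    "f (x + r *\<^sub>R a + r *\<^sub>R b) - f (x + r *\<^sub>R a) - (f (x + r *\<^sub>R b) - f x) = r * r * ?F (x + s *\<^sub>R a + t *\<^sub>R b) b"
    by (rule second_difference[OF assms(1,2,4,5) r inS])
  obtain t' s' where st': "0 \<le> t'" "t' \<le> r" "0 \<le> s'" "s' \<le> r"
    "f (x + r *\<^sub>R b + r *\<^sub>R a) - f (x + r *\<^sub>R b) - (f (x + r *\<^sub>R a) - f x) = r * r * ?G (x + t' *\<^sub>R b + s' *\<^sub>R a) a"
    by (rule second_difference[OF assms(1,2,5,4) r inS'])
  have "r * r * ?F (x + s *\<^sub>R a + t *\<^sub>R b) b = r * r * ?G (x + t' *\<^sub>R b + s' *\<^sub>R a) a"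
    unfolding st(5)[symmetric] st'(5)[symmetric] by (simp add: add_ac)
  then have eq: "?F (x + s *\<^sub>R a + t *\<^sub>R b) b = ?G (x + s' *\<^sub>R a + t' *\<^sub>R b) a" using r by (simp add: add_ac)
  have "dist (?F (x + s *\<^sub>R a + t *\<^sub>R b) b) (?F x b) < e"
    using near[OF st(1-4)] inS[OF st(1-4)] by (intro d1) (auto simp: d_def)
  moreover have "dist (?G (x + s' *\<^sub>R a + t' *\<^sub>R b) a) (?G x a) < e"
    using near[OF st'(3,4,1,2)] inS[OF st'(3,4,1,2)] by (intro d2) (auto simp: d_def)
  ultimately show False unfolding eq e_def dist_real_def by (smt (verit) field_sum_of_halves)
qed

text \<open>Taking components commutes with both derivatives and reduces this to real values. The
  vector-valued version serves transition maps.\<close>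

lemma second_derivative_symmetric:
  fixes f :: "'e::euclidean_space \<Rightarrow> 'f::euclidean_space"
  assumes "rel_open E S" "smooth_on S f" "x \<in> S" "a \<in> E" "b \<in> E"
  shows "fderiv (\<lambda>y. fderiv f S y a) S x b = fderiv (\<lambda>y. fderiv f S y b) S x a"
proof (rule euclidean_eqI)
  fix i :: 'f
  have comp: "fderiv (\<lambda>y. g y \<bullet> i) S y v = fderiv g S y v \<bullet> i" if "smooth_on S g" "y \<in> S" "v \<in> E" for g :: "'e \<Rightarrow> 'f" and y v
    by (rule fderiv_eq[OF assms(1) that(2) _ that(3)])
      (rule has_derivative_inner_left[OF smooth_on_has_derivative[OF that(1,2)]])
  have "fderiv (\<lambda>y. fderiv f S y c) S x d \<bullet> i = fderiv (\<lambda>y. fderiv (\<lambda>z. f z \<bullet> i) S y c) S x d" if "c \<in> E" "d \<in> E" for c d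
  proof -
    have "fderiv (\<lambda>y. fderiv f S y c) S x d \<bullet> i = fderiv (\<lambda>y. fderiv f S y c \<bullet> i) S x d"
      using comp[OF smooth_on_fderiv[OF assms(1,2) that(1)] assms(3) that(2)] by simp
    also have "\<dots> = fderiv (\<lambda>y. fderiv (\<lambda>z. f z \<bullet> i) S y c) S x d"
      by (rule arg_cong[of _ _ "\<lambda>F. F d"], rule fderiv_rel_cong[OF assms(1,1,1) _ _ assms(3)])
        (use comp[OF assms(2)] that in auto)
    finally show ?thesis .
  qed
  then show "fderiv (\<lambda>y. fderiv f S y a) S x b \<bullet> i = fderiv (\<lambda>y. fderiv f S y b) S x a \<bullet> i"
    using second_derivative_symmetric_real[OF assms(1) smooth_on_inner_left[OF assms(2)] assms(3-5)] assms(4,5) by simp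
qed

section \<open>Ordinary differential equations\<close>

text \<open>The operator norm of the derivative is at most the sum of the norms of its values on the
  basis, which is bounded on the compact ball; convexity turns this into a Lipschitz
  constant.\<close>

lemma smooth_on_lipschitz_cball:
  fixes X :: "'e::euclidean_space \<Rightarrow> 'f::euclidean_space"
  assumes "open \<Omega>" "smooth_on \<Omega> X" "cball a r \<subseteq> \<Omega>"
  obtains L where "L \<ge> 0" "\<And>x y. x \<in> cball a r \<Longrightarrow> y \<in> cball a r \<Longrightarrow> norm (X x - X y) \<le> L * norm (x - y)"
proof -
  let ?n = "\<lambda>x. \<Sum>b\<in>Basis. norm (fderiv X \<Omega> x b)"
  have ro: "rel_open UNIV \<Omega>" using assms rel_open_UNIV by blast
  have "continuous_on (cball a r) ?n"
    by (rule continuous_on_subset[OF _ assms(3)])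
      (intro continuous_on_sum continuous_on_norm smooth_on_continuous_on smooth_on_fderiv[OF ro assms(2)] UNIV_I)
  then have "bounded (?n ` cball a r)" using compact_continuous_image compact_cball compact_imp_bounded by blast
  then obtain L where L: "\<And>x. x \<in> cball a r \<Longrightarrow> norm (?n x) \<le> L"
    unfolding bounded_iff by blast
  \<comment> \<open>The maximum with 0 covers the empty ball, on which the bound \<open>L\<close>
    may be negative.\<close>
  have L': "onorm (fderiv X \<Omega> x) \<le> max 0 L" if "x \<in> cball a r" for x
  proof (rule onorm_le)
    fix v
    have x: "x \<in> \<Omega>" using that assms(3) by blast
    have "norm (fderiv X \<Omega> x v) = norm (\<Sum>b\<in>Basis. (v \<bullet> b) *\<^sub>R fderiv X \<Omega> x b)"
      using linear_euclidean_expand[OF linear_fderiv[OF assms(2) x], of v] by simp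
    also have "\<dots> \<le> (\<Sum>b\<in>Basis. norm v * norm (fderiv X \<Omega> x b))"
      by (rule sum_norm_le) (simp add: Basis_le_norm mult_right_mono)
    also have "\<dots> = ?n x * norm v" by (simp add: sum_distrib_left mult.commute)
    also have "\<dots> \<le> max 0 L * norm v" using L[OF that] by (intro mult_right_mono) auto
    finally show "norm (fderiv X \<Omega> x v) \<le> max 0 L * norm v" .
  qed
  have der: "(X has_derivative fderiv X \<Omega> x) (at x within cball a r)" if "x \<in> cball a r" for x
    using has_derivative_subset[OF smooth_on_has_derivative[OF assms(2)] assms(3)] that assms(3) by blast
  show ?thesis
    by (rule that[of "max 0 L"]) (use differentiable_bound[OF convex_cball der L'] in auto)
qed

text \<open>
  Composed with the projection onto a small ball, \<open>X\<close> becomes globally Lipschitz, and the Picard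
  operator is a contraction of the bounded continuous functions on the line if time is frozen outside
  a short interval.
\<close>

lemma ode_existence:
  fixes X :: "'e::euclidean_space \<Rightarrow> 'e"
  assumes "open \<Omega>" "smooth_on \<Omega> X" "a \<in> \<Omega>"
  obtains \<epsilon> y where "\<epsilon> > 0" "y t0 = a"
    "\<And>t. t \<in> {t0-\<epsilon><..<t0+\<epsilon>} \<Longrightarrow> y t \<in> \<Omega>"
    "\<And>t. t \<in> {t0-\<epsilon><..<t0+\<epsilon>} \<Longrightarrow> (y has_vector_derivative X (y t)) (at t)"
proof -
  obtain r where r: "r > 0" "cball a r \<subseteq> \<Omega>" using assms open_contains_cball by blast
  obtain L where L: "L \<ge> 0" "\<And>x y. x \<in> cball a r \<Longrightarrow> y \<in> cball a r \<Longrightarrow> norm (X x - X y) \<le> L * norm (x - y)"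
    using smooth_on_lipschitz_cball[OF assms(1,2) r(2)] by blast
  have "compact (X ` cball a r)"
    using smooth_on_continuous_on[OF assms(2)] r by (intro compact_continuous_image) (auto intro: continuous_on_subset)
  then obtain B where B: "B > 0" "\<And>x. x \<in> cball a r \<Longrightarrow> norm (X x) \<le> B"
    using compact_imp_bounded bounded_pos by (metis imageI)
  define p where "p = closest_point (cball a r)"
  have p: "p x \<in> cball a r" "x \<in> cball a r \<Longrightarrow> p x = x" for x
    unfolding p_def using r closest_point_in_set[of "cball a r"] closest_point_self[of x] by auto
  have pl: "norm (p x - p y) \<le> norm (x - y)" for x y
    unfolding p_def dist_norm[symmetric] using r by (intro closest_point_lipschitz) auto
  define Y where "Y = (\<lambda>x. X (p x))"
  have YL: "norm (Y x - Y y) \<le> L * norm (x - y)" for x y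
    using L(2)[OF p(1) p(1), of x y] mult_left_mono[OF pl L(1), of x y] unfolding Y_def by linarith
  have YB: "norm (Y x) \<le> B" for x unfolding Y_def using B p by blast
  have Yc: "continuous_on UNIV Y"
  proof (rule lipschitz_on_continuous_on)
    show "L-lipschitz_on UNIV Y" using YL L by (intro lipschitz_onI) (auto simp: dist_norm)
  qed
  \<comment> \<open>Each of the two integrals in the Picard operator runs over a length of at most
    \<open>2 * \<epsilon>\<close>. The first bound keeps the fixed point in the ball, the second
    gives contraction factor 1/2; \<open>L + 1\<close> avoids division by zero.\<close>
  define \<epsilon> where "\<epsilon> = min (r / (4 * B)) (1 / (8 * (L + 1)))"
  have \<epsilon>: "\<epsilon> > 0" "4 * \<epsilon> * B \<le> r" "4 * \<epsilon> * L \<le> 1/2"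
  proof -
    show "\<epsilon> > 0" using r B L by (simp add: \<epsilon>_def)
    have "\<epsilon> \<le> r / (4 * B)" by (simp add: \<epsilon>_def)
    then show "4 * \<epsilon> * B \<le> r" using B by (simp add: field_simps)
    have "\<epsilon> \<le> 1 / (8 * (L + 1))" by (simp add: \<epsilon>_def)
    then have "8 * \<epsilon> * (L + 1) \<le> 1" using L by (simp add: field_simps)
    then show "4 * \<epsilon> * L \<le> 1/2" using \<open>\<epsilon> > 0\<close> by (simp add: algebra_simps)
  qed
  define l where "l = t0 - \<epsilon>"
  define u where "u = t0 + \<epsilon>"
  define c where "c = (\<lambda>t. max l (min u t))"
  have c: "c t \<in> {l..u}" "t \<in> {l..u} \<Longrightarrow> c t = t" for t using \<epsilon> by (auto simp: c_def l_def u_def)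
  have t0: "t0 \<in> {l..u}" using \<epsilon> by (simp add: l_def u_def)
  have cc: "continuous_on UNIV c" unfolding c_def by (intro continuous_intros)
  \<comment> \<open>Integrating from the left end \<open>l\<close> keeps the bounds in order for all
    \<open>t\<close>; the oriented integral from \<open>t0\<close> is recovered as
    \<open>I f t - I f t0\<close>.\<close>
  define I where "I = (\<lambda>(f::real \<Rightarrow>\<^sub>C 'e) t. integral {l..t} (\<lambda>s. Y (apply_bcontfun f s)))"
  have Yf: "continuous_on S (\<lambda>s. Y (apply_bcontfun f s))" for S and f :: "real \<Rightarrow>\<^sub>C 'e"
    by (rule continuous_on_compose2[OF Yc]) auto
  have Ic: "continuous_on {l..u} (I f)" for f
    unfolding I_def by (rule indefinite_integral_continuous_1[OF integrable_continuous_interval[OF Yf]])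
  have Ibound: "norm (I f t) \<le> 2 * \<epsilon> * B" if "t \<in> {l..u}" for f t
  proof -
    have "norm (I f t) \<le> B * (t - l)" unfolding I_def
      by (rule integral_bound) (use that YB Yf in auto)
    also have "\<dots> \<le> B * (2 * \<epsilon>)" using that B by (intro mult_left_mono) (auto simp: l_def u_def)
    finally show ?thesis by (simp add: mult_ac)
  qed
  have Idiff: "norm (I f t - I g t) \<le> 2 * \<epsilon> * (L * dist f g)" if "t \<in> {l..u}" for f g t
  proof -
    have "I f t - I g t = integral {l..t} (\<lambda>s. Y (apply_bcontfun f s) - Y (apply_bcontfun g s))"
      unfolding I_def by (rule integral_diff[symmetric]) (rule integrable_continuous_interval[OF Yf])+
    also have "norm \<dots> \<le> (L * dist f g) * (t - l)"
    proof (rule integral_bound)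
      fix s
      have "norm (Y (apply_bcontfun f s) - Y (apply_bcontfun g s)) \<le> L * dist (apply_bcontfun f s) (apply_bcontfun g s)"
        using YL by (simp add: dist_norm)
      also have "\<dots> \<le> L * dist f g" using L dist_bounded by (intro mult_left_mono) auto
      finally show "norm (Y (apply_bcontfun f s) - Y (apply_bcontfun g s)) \<le> L * dist f g" .
    qed (use that Yf in \<open>auto intro: continuous_on_diff\<close>)
    also have "\<dots> \<le> (L * dist f g) * (2 * \<epsilon>)" using that L by (intro mult_left_mono) (auto simp: l_def u_def)
    finally show ?thesis by (simp add: mult_ac)
  qed
  define F where "F = (\<lambda>f t. a + (I f (c t) - I f t0))"
  define T where "T = (\<lambda>f. Bcontfun (F f))"
  have F: "F f \<in> bcontfun" for f
  proof (rule bcontfun_normI)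
    show "continuous_on UNIV (F f)" unfolding F_def
      by (intro continuous_intros continuous_on_compose2[OF Ic cc]) (use c in auto)
    show "norm (F f t) \<le> norm a + (2 * \<epsilon> * B + 2 * \<epsilon> * B)" for t unfolding F_def
      by (rule order_trans[OF norm_triangle_ineq add_left_mono], rule order_trans[OF norm_triangle_ineq4 add_mono])
        (use Ibound c t0 in auto)
  qed
  have T: "apply_bcontfun (T f) = F f" for f
    unfolding T_def using F by (rule Bcontfun_inverse)
  have "dist (T f) (T g) \<le> 1/2 * dist f g" for f g
  proof (rule dist_bound)
    fix t
    have "dist (apply_bcontfun (T f) t) (apply_bcontfun (T g) t) = norm ((I f (c t) - I g (c t)) - (I f t0 - I g t0))"
      unfolding T F_def dist_norm by (simp add: algebra_simps)
    also have "\<dots> \<le> 2 * \<epsilon> * (L * dist f g) + 2 * \<epsilon> * (L * dist f g)"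
      by (rule order_trans[OF norm_triangle_ineq4 add_mono]) (use Idiff c t0 in auto)
    also have "\<dots> = (4 * \<epsilon> * L) * dist f g" by simp
    also have "\<dots> \<le> 1/2 * dist f g" using \<epsilon>(3) by (rule mult_right_mono) simp
    finally show "dist (apply_bcontfun (T f) t) (apply_bcontfun (T g) t) \<le> 1/2 * dist f g" .
  qed
  then have "\<exists>!f. T f = f" by (intro banach_fix_type[of "1/2"]) auto
  then obtain f where f: "T f = f" by blast
  define y where "y = apply_bcontfun f"
  have y: "y t = a + (I f t - I f t0)" if "t \<in> {l..u}" for t
    using T[of f] c that unfolding f F_def y_def by (metis (no_types))
  \<comment> \<open>In the ball the projection \<open>p\<close> is the identity, so the fixed point
    solves the original equation and not only the modified one.\<close>
  have yb: "y t \<in> cball a r" if "t \<in> {l..u}" for t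
  proof -
    have "norm (I f t - I f t0) \<le> 2 * \<epsilon> * B + 2 * \<epsilon> * B"
      by (rule order_trans[OF norm_triangle_ineq4 add_mono]) (use Ibound that t0 in auto)
    then show ?thesis using y[OF that] \<epsilon>(2) by (simp add: dist_norm norm_minus_commute[of "I f t0"] mult_ac)
  qed
  have der: "(y has_vector_derivative X (y t)) (at t)" if t: "t \<in> {l<..<u}" for t
  proof -
    have tc: "t \<in> {l..u}" using t by auto
    have "(I f has_vector_derivative Y (y t)) (at t within {l..u})"
      unfolding I_def y_def by (rule integral_has_vector_derivative[OF Yf tc])
    then have "((\<lambda>t. a + (I f t - I f t0)) has_vector_derivative Y (y t)) (at t within {l..u})"
      using has_vector_derivative_add[OF has_vector_derivative_const[of a] has_vector_derivative_diff[OF _ has_vector_derivative_const[of "I f t0"]]] by fastforce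
    then have "(y has_vector_derivative Y (y t)) (at t within {l..u})"
      by (rule has_vector_derivative_transform[OF tc y, rotated])
    then have "(y has_vector_derivative Y (y t)) (at t)"
      using at_within_interior[of t "{l..u}"] t by simp
    then show ?thesis using p(2)[OF yb[OF tc]] by (simp add: Y_def)
  qed
  show ?thesis
    by (rule that[OF \<epsilon>(1), of y]) (use y[OF t0] yb r der in \<open>auto simp: l_def u_def subset_iff\<close>)
qed

text \<open>On an interval of radius \<open>\<delta>\<close> with
  \<open>L * \<delta> \<le> 1/2\<close> the maximal distance of the two solutions is at most half of
  itself, hence zero.\<close>

lemma ode_local_unique:
  fixes X :: "'e::euclidean_space \<Rightarrow> 'e"
  assumes "open \<Omega>" "smooth_on \<Omega> X" "open K" "t1 \<in> K" "y t1 = z t1"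
    and y: "\<And>t. t \<in> K \<Longrightarrow> y t \<in> \<Omega>" "\<And>t. t \<in> K \<Longrightarrow> (y has_vector_derivative X (y t)) (at t)"
    and z: "\<And>t. t \<in> K \<Longrightarrow> z t \<in> \<Omega>" "\<And>t. t \<in> K \<Longrightarrow> (z has_vector_derivative X (z t)) (at t)"
  obtains \<delta> where "\<delta> > 0" "\<And>t. dist t t1 < \<delta> \<Longrightarrow> y t = z t"
proof -
  obtain r where r: "r > 0" "cball (y t1) r \<subseteq> \<Omega>" using assms(1,4) y(1) open_contains_cball by blast
  obtain L where L: "L \<ge> 0" "\<And>p q. p \<in> cball (y t1) r \<Longrightarrow> q \<in> cball (y t1) r \<Longrightarrow> norm (X p - X q) \<le> L * norm (p - q)"
    using smooth_on_lipschitz_cball[OF assms(1,2) r(2)] by blast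
  have c: "isCont y t" "isCont z t" if "t \<in> K" for t
    using y(2)[OF that] z(2)[OF that] has_vector_derivative_continuous by auto
  obtain d1 where d1: "d1 > 0" "\<And>t. dist t t1 < d1 \<Longrightarrow> dist (y t) (y t1) < r"
    using c(1)[OF assms(4)] r(1) unfolding continuous_at_eps_delta by blast
  obtain d2 where d2: "d2 > 0" "\<And>t. dist t t1 < d2 \<Longrightarrow> dist (z t) (z t1) < r"
    using c(2)[OF assms(4)] r(1) unfolding continuous_at_eps_delta by blast
  obtain d3 where d3: "d3 > 0" "\<And>t. dist t t1 < d3 \<Longrightarrow> t \<in> K"
    using assms(3,4) unfolding open_dist by blast
  \<comment> \<open>The halves make room for the closed ball of radius \<open>\<delta>\<close>, on
    which a maximum is attained; the last term gives \<open>L * \<delta> \<le> 1/2\<close>.\<close>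
  define \<delta> where "\<delta> = min (min (d1/2) (d2/2)) (min (d3/2) (1 / (2 * (L + 1))))"
  have \<delta>: "\<delta> > 0" "\<delta> < d1" "\<delta> < d2" "\<delta> < d3" "L * \<delta> \<le> 1/2"
  proof -
    show "\<delta> > 0" "\<delta> < d1" "\<delta> < d2" "\<delta> < d3" using d1 d2 d3 L by (auto simp: \<delta>_def)
    have "\<delta> \<le> 1 / (2 * (L + 1))" by (simp add: \<delta>_def)
    then have "2 * \<delta> * (L + 1) \<le> 1" using L by (simp add: field_simps)
    then show "L * \<delta> \<le> 1/2" using \<open>\<delta> > 0\<close> by (simp add: algebra_simps)
  qed
  have JK: "t \<in> K" "y t \<in> cball (y t1) r" "z t \<in> cball (y t1) r" if "t \<in> cball t1 \<delta>" for t
    using d1(2)[of t] d2(2)[of t] d3(2)[of t] that \<delta> assms(5) by (auto simp: dist_commute intro: less_imp_le)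
  define w where "w = (\<lambda>t. y t - z t)"
  have "continuous_on (cball t1 \<delta>) (\<lambda>t. norm (w t))"
    unfolding w_def using c JK(1) by (intro continuous_intros continuous_at_imp_continuous_on) auto
  then obtain s where s: "s \<in> cball t1 \<delta>" "\<And>t. t \<in> cball t1 \<delta> \<Longrightarrow> norm (w t) \<le> norm (w s)"
    using continuous_attains_sup[of "cball t1 \<delta>"] \<delta>(1) by (metis compact_cball cball_eq_empty not_less_iff_gr_or_eq)
  have b: "norm (w t - w t1) \<le> (L * norm (w s)) * norm (t - t1)" if "t \<in> cball t1 \<delta>" for t
  proof (rule differentiable_bound[OF convex_cball])
    show "(w has_derivative (\<lambda>h. h *\<^sub>R (X (y t) - X (z t)))) (at t within cball t1 \<delta>)" if "t \<in> cball t1 \<delta>" for t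
      using has_vector_derivative_diff[OF y(2) z(2), OF JK(1) JK(1), OF that that]
      unfolding w_def has_vector_derivative_def by (rule has_derivative_at_withinI)
    show "onorm (\<lambda>h. h *\<^sub>R (X (y t) - X (z t))) \<le> L * norm (w s)" if "t \<in> cball t1 \<delta>" for t
    proof (rule onorm_le)
      fix h :: real
      have "norm (X (y t) - X (z t)) \<le> L * norm (w t)" unfolding w_def using L(2) JK[OF that] by blast
      also have "\<dots> \<le> L * norm (w s)" using s(2)[OF that] L(1) by (rule mult_left_mono)
      finally have "norm h * norm (X (y t) - X (z t)) \<le> norm h * (L * norm (w s))"
        by (rule mult_left_mono) simp
      then show "norm (h *\<^sub>R (X (y t) - X (z t))) \<le> L * norm (w s) * norm h"
        by (simp add: mult.commute)
    qed
  qed (use that \<delta>(1) in auto)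
  have w1: "w t1 = 0" using assms(5) by (simp add: w_def)
  have "norm (w s) \<le> (L * norm (w s)) * norm (s - t1)" using b[OF s(1)] w1 by simp
  also have "\<dots> \<le> (L * norm (w s)) * \<delta>"
    using s(1) L by (intro mult_left_mono) (auto simp: dist_norm norm_minus_commute)
  also have "\<dots> = (L * \<delta>) * norm (w s)" by simp
  also have "\<dots> \<le> 1/2 * norm (w s)" using \<delta>(5) by (rule mult_right_mono) simp
  finally have "norm (w s) = 0" by simp
  then have "w t = 0" if "t \<in> cball t1 \<delta>" for t using s(2)[OF that] by simp
  then show ?thesis using that[OF \<delta>(1)] by (auto simp: w_def dist_commute)
qed

text \<open>Bootstrapping: the derivative of \<open>y\<close> is \<open>X\<close> along
  \<open>y\<close>, so it is as regular as \<open>y\<close> already is.\<close>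

lemma ode_solution_smooth:
  fixes X :: "'e::euclidean_space \<Rightarrow> 'e"
  assumes "smooth_on \<Omega> X" "\<And>t. t \<in> K \<Longrightarrow> y t \<in> \<Omega>" "\<And>t. t \<in> K \<Longrightarrow> (y has_vector_derivative X (y t)) (at t within K)"
  shows "smooth_on K y"
  unfolding smooth_on_def
proof
  fix k show "Ck_on k K y"
  proof (induction k)
    case 0
    show ?case unfolding Ck_on.simps(1) continuous_on_eq_continuous_within
      using assms(3) has_vector_derivative_continuous by blast
  next
    case (Suc k)
    show ?case
    proof (rule Ck_on_SucI)
      show "(y has_derivative (\<lambda>h. h *\<^sub>R X (y t))) (at t within K)" if "t \<in> K" for t
        using assms(3)[OF that] unfolding has_vector_derivative_def .
      have "Ck_on k K (\<lambda>t. X (y t))"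
        by (rule Ck_on_compose[OF _ Suc]) (use assms in \<open>auto simp: smooth_on_def\<close>)
      then show "Ck_on k K (\<lambda>t. v *\<^sub>R X (y t))" for v
        by (rule Ck_on_scaleR[OF Ck_on_const])
    qed
  qed
qed

section \<open>Skew forms and the local slice theorem\<close>

lemma subspace_add_cancel_right: "subspace F \<Longrightarrow> x \<in> F \<Longrightarrow> y + x \<in> F \<longleftrightarrow> y \<in> F"
  by (metis add_diff_cancel_right' subspace_add subspace_diff)

lemma subspace_add_cancel_left: "subspace F \<Longrightarrow> x \<in> F \<Longrightarrow> x + y \<in> F \<longleftrightarrow> y \<in> F"
  using subspace_add_cancel_right[of F x y] by (simp add: add.commute)

text \<open>\<open>L\<close> is assembled from an isometry of \<open>F0\<close> onto
  \<open>F\<close>, an isometry of their orthogonal complements within \<open>E\<close>, and the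
  identity orthogonally to \<open>E\<close>. It lets slice charts at different points share the
  model \<open>F\<close>, and its injectivity on the ambient space suits the inverse function
  theorem there.\<close>

lemma linear_map_onto_subspace:
  fixes E :: "'e::euclidean_space set"
  assumes "subspace E" "subspace F0" "subspace F" "F0 \<subseteq> E" "F \<subseteq> E" "dim F0 = dim F"
  obtains L where "linear L" "inj L" "\<And>v. L v \<in> E \<longleftrightarrow> v \<in> E" "\<And>v. L v \<in> F \<longleftrightarrow> v \<in> F0"
proof -
  define G0 where "G0 = {y\<in>E. \<forall>x\<in>F0. orthogonal x y}"
  define G where "G = {y\<in>E. \<forall>x\<in>F. orthogonal x y}"
  have sub: "subspace G0" "subspace G"
    using assms unfolding G0_def G_def orthogonal_def
    by (auto intro!: subspaceI simp: subspace_0 subspace_add subspace_scale inner_simps)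
  have "dim G0 = dim G"
    using dim_subspace_orthogonal_to_vectors[OF assms(2,1,4)] dim_subspace_orthogonal_to_vectors[OF assms(3,1,5)]
      assms(6) unfolding G0_def G_def by linarith
  then obtain g where g: "linear g" "g ` G0 = G" "\<And>x. x \<in> G0 \<Longrightarrow> norm (g x) = norm x"
    using isometry_subspaces[OF sub] by blast
  obtain f where f: "linear f" "f ` F0 = F" "\<And>x. x \<in> F0 \<Longrightarrow> norm (f x) = norm x"
    using isometry_subspaces[OF assms(2,3,6)] by blast
  define P where "P = orth_proj E"
  define Q where "Q = orth_proj F0"
  note P = linear_orth_proj[OF assms(1), folded P_def] orth_proj_in[OF assms(1), folded P_def]
    orth_proj_id[OF assms(1), folded P_def] orth_proj_orth[OF assms(1), folded P_def]
  note Q = linear_orth_proj[OF assms(2), folded Q_def] orth_proj_in[OF assms(2), folded Q_def]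
    orth_proj_id[OF assms(2), folded Q_def] orth_proj_orth[OF assms(2), folded Q_def]
  have R: "P v - Q v \<in> G0" for v
  proof -
    have "P v - Q v \<in> E" using P(2) Q(2) assms(1,4) subspace_diff by blast
    moreover have "x \<bullet> (P v - Q v) = 0" if "x \<in> F0" for x
      using P(4)[of x v] Q(4)[of x v] that assms(4) by (auto simp: inner_simps inner_commute)
    ultimately show ?thesis by (simp add: G0_def orthogonal_def)
  qed
  define L where "L = (\<lambda>v. f (Q v) + g (P v - Q v) + (v - P v))"
  have lin: "linear L"
    unfolding L_def by (rule linearI)
      (simp_all add: linear_add[OF P(1)] linear_add[OF Q(1)] linear_add[OF f(1)] linear_add[OF g(1)] linear_diff[OF g(1)]
        linear_scale[OF P(1)] linear_scale[OF Q(1)] linear_scale[OF f(1)] linear_scale[OF g(1)] algebra_simps)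
  have fQ: "f (Q v) \<in> F" and gR: "g (P v - Q v) \<in> G" for v using f(2) g(2) Q(2) R by blast+
  have GE: "G \<subseteq> E" by (auto simp: G_def)
  have LE: "L v \<in> E \<longleftrightarrow> v \<in> E" for v
  proof
    assume "v \<in> E"
    then have "L v = f (Q v) + g (P v - Q v)" using P(3) by (simp add: L_def)
    moreover have "f (Q v) \<in> E" "g (P v - Q v) \<in> E" using fQ gR GE assms by blast+
    ultimately show "L v \<in> E" using assms(1) subspace_add by metis
  next
    assume "L v \<in> E"
    then have "L v - (f (Q v) + g (P v - Q v)) \<in> E"
      using fQ gR GE assms by (intro subspace_diff subspace_add) auto
    then have "v - P v \<in> E" by (simp add: L_def)
    then have "(v - P v) \<bullet> (v - P v) = 0" using P(4) by blast
    then show "v \<in> E" using P(2)[of v] by simp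
  qed
  have LF: "L v \<in> F \<longleftrightarrow> v \<in> F0" for v
  proof
    assume "v \<in> F0"
    then show "L v \<in> F" using f(2) P(3) Q(3) assms(4) by (auto simp: L_def linear_0[OF g(1)])
  next
    assume LF: "L v \<in> F"
    then have vE: "v \<in> E" using LE assms by blast
    then have "L v - f (Q v) = g (P v - Q v)" using P(3) by (simp add: L_def)
    moreover have "L v - f (Q v) \<in> F" using LF fQ assms subspace_diff by blast
    ultimately have "g (P v - Q v) \<bullet> g (P v - Q v) = 0" using gR by (auto simp: G_def orthogonal_def)
    then have "P v - Q v = 0" using g(3)[OF R[of v]] by simp
    then show "v \<in> F0" using P(3)[OF vE] Q(2)[of v] by simp
  qed
  have "inj L"
    unfolding linear_injective_0[OF lin]
  proof (intro allI impI)
    fix v assume v: "L v = 0"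
    then have vF: "v \<in> F0" using LF[of v] assms subspace_0 by metis
    then have "L v = f v" using P(3) Q(3) assms(4) by (auto simp: L_def linear_0[OF g(1)])
    then show "v = 0" using f(3)[OF vF] v by simp
  qed
  then show ?thesis using that lin LE LF by blast
qed

section \<open>Skew forms and their kernels\<close>

text \<open>Linearity is required in the first argument only, as skewness transfers it to the
  second; everything is restricted to \<open>E\<close>, since a form on a tangent space has no
  meaning outside it.\<close>

definition skew_form :: "'e::euclidean_space set \<Rightarrow> ('e \<Rightarrow> 'e \<Rightarrow> real) \<Rightarrow> bool" where
  "skew_form E B \<longleftrightarrow> (\<forall>u\<in>E. \<forall>v\<in>E. B u v = - B v u \<and>
     (\<forall>w\<in>E. \<forall>r s. B (r *\<^sub>R u + s *\<^sub>R v) w = r * B u w + s * B v w))"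

definition kern :: "'e::euclidean_space set \<Rightarrow> ('e \<Rightarrow> 'e \<Rightarrow> real) \<Rightarrow> 'e set" where
  "kern E B = {u\<in>E. \<forall>v\<in>E. B u v = 0}"

lemma skew_form_subset: "skew_form E B \<Longrightarrow> F \<subseteq> E \<Longrightarrow> skew_form F B"
  unfolding skew_form_def by blast

lemma skew_form_skew: "skew_form E B \<Longrightarrow> u \<in> E \<Longrightarrow> v \<in> E \<Longrightarrow> B u v = - B v u"
  unfolding skew_form_def by blast

text \<open>Inserting a linear map into \<open>E\<close> makes the form linear on the whole ambient
  space, so that it can be expanded in the standard basis although the basis vectors need not lie in
  \<open>E\<close>.\<close>

lemma skew_form_linear_left:
  assumes "skew_form E B" "w \<in> E" "linear Q" "\<And>v. Q v \<in> E"
  shows "linear (\<lambda>u. B (Q u) w)"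
proof (rule linearI)
  have *: "B (r *\<^sub>R u + s *\<^sub>R v) w = r * B u w + s * B v w" if "u \<in> E" "v \<in> E" for u v r s
    using assms(1,2) that unfolding skew_form_def by blast
  show "B (Q (u + v)) w = B (Q u) w + B (Q v) w" for u v
    using *[of "Q u" "Q v" 1 1] assms(4) by (simp add: linear_add[OF assms(3)])
  show "B (Q (r *\<^sub>R u)) w = r *\<^sub>R B (Q u) w" for r u
    using *[of "Q u" "Q u" r 0] assms(4) by (simp add: linear_scale[OF assms(3)])
qed

lemma skew_form_linear_right:
  assumes "skew_form E B" "w \<in> E" "linear Q" "\<And>v. Q v \<in> E"
  shows "linear (\<lambda>u. B w (Q u))"
proof -
  have "(\<lambda>u. B w (Q u)) = (\<lambda>u. - B (Q u) w)"
    using skew_form_skew[OF assms(1,2)] assms(4) by blast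
  then show ?thesis using linear_compose_neg[OF skew_form_linear_left[OF assms]] by simp
qed

lemma skew_form_add_left: "skew_form E B \<Longrightarrow> u \<in> E \<Longrightarrow> v \<in> E \<Longrightarrow> w \<in> E \<Longrightarrow> B (u + v) w = B u w + B v w"
  unfolding skew_form_def by (metis mult_1 scaleR_one)

lemma skew_form_diff_left: "skew_form E B \<Longrightarrow> u \<in> E \<Longrightarrow> v \<in> E \<Longrightarrow> w \<in> E \<Longrightarrow> B (u - v) w = B u w - B v w"
  unfolding skew_form_def by (metis (no_types, opaque_lifting) diff_conv_add_uminus mult_1 mult_minus_left scaleR_minus_left scaleR_one)

lemma skew_form_add_right:
  assumes "skew_form E B" "subspace E" "u \<in> E" "v \<in> E" "w \<in> E"
  shows "B w (u + v) = B w u + B w v"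
  using skew_form_add_left[OF assms(1,3-5)] skew_form_skew[OF assms(1,5)] assms subspace_add[OF assms(2-4)] by simp

lemma skew_form_diff_right:
  assumes "skew_form E B" "subspace E" "u \<in> E" "v \<in> E" "w \<in> E"
  shows "B w (u - v) = B w u - B w v"
  using skew_form_diff_left[OF assms(1,3-5)] skew_form_skew[OF assms(1,5)] assms subspace_diff[OF assms(2-4)] by simp

lemma subspace_kern:
  assumes "skew_form E B" "subspace E"
  shows "subspace (kern E B)"
proof (rule subspaceI)
  have z: "B 0 w = 0" if "w \<in> E" for w
    using skew_form_add_left[OF assms(1) subspace_0[OF assms(2)] subspace_0[OF assms(2)] that] by simp
  then show "0 \<in> kern E B" using subspace_0[OF assms(2)] by (simp add: kern_def)
  show "x + y \<in> kern E B" if "x \<in> kern E B" "y \<in> kern E B" for x y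
    using that skew_form_add_left[OF assms(1)] subspace_add[OF assms(2)] by (auto simp: kern_def)
  show "c *\<^sub>R x \<in> kern E B" if "x \<in> kern E B" for c x
  proof -
    have "B (c *\<^sub>R x) w = 0" if "w \<in> E" for w
      using linear_scale[OF skew_form_linear_left[OF assms(1) that linear_orth_proj[OF assms(2)] orth_proj_in[OF assms(2)]], of c x]
        \<open>x \<in> kern E B\<close> that orth_proj_id[OF assms(2)] subspace_scale[OF assms(2)] by (auto simp: kern_def)
    then show ?thesis using that subspace_scale[OF assms(2)] by (auto simp: kern_def)
  qed
qed

text \<open>A vector of \<open>F\<close> that annihilates \<open>F\<close> also annihilates the
  kernel, hence all of \<open>E\<close>; so it lies in the kernel and is orthogonal to
  itself.\<close>

lemma kern_complement:
  assumes "skew_form E B" "subspace E"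
  defines "F \<equiv> {y\<in>E. \<forall>x\<in>kern E B. orthogonal x y}"
  shows "subspace F" "kern F B = {0}"
proof -
  show F: "subspace F" unfolding F_def orthogonal_def
    by (auto intro!: subspaceI simp: subspace_0[OF assms(2)] subspace_add[OF assms(2)] subspace_scale[OF assms(2)] inner_simps)
  have FE: "F \<subseteq> E" by (auto simp: F_def)
  have K: "subspace (kern E B)" by (rule subspace_kern[OF assms(1,2)])
  have KE: "kern E B \<subseteq> E" by (auto simp: kern_def)
  define P where "P = orth_proj (kern E B)"
  note P = orth_proj_in[OF K, folded P_def] orth_proj_orth[OF K, folded P_def]
  have PE: "P v \<in> E" for v using P(1) KE by blast
  show "kern F B = {0}"
  proof
    show "kern F B \<subseteq> {0}"
    proof
      fix u assume u: "u \<in> kern F B"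
      then have uF: "u \<in> F" and uE: "u \<in> E" using FE by (auto simp: kern_def)
      have "B u w = 0" if w: "w \<in> E" for w
      proof -
        have Q: "w - P w \<in> F"
          using P(2) subspace_diff[OF assms(2) w PE] by (auto simp: F_def orthogonal_def inner_commute)
        have "B u w = B u (P w) + B u (w - P w)"
          using skew_form_add_right[OF assms(1,2) PE _ uE, of "w - P w" w] Q FE by auto
        moreover have "B u (P w) = 0"
          using skew_form_skew[OF assms(1) uE PE] P(1)[of w] uE by (auto simp: kern_def)
        moreover have "B u (w - P w) = 0" using u Q by (auto simp: kern_def)
        ultimately show ?thesis by simp
      qed
      then have "u \<in> kern E B" using uE by (simp add: kern_def)
      then show "u \<in> {0}" using uF by (auto simp: F_def orthogonal_def)
    qed
    show "{0} \<subseteq> kern F B"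
      using subspace_0[OF subspace_kern[OF skew_form_subset[OF assms(1) FE] F]] by simp
  qed
qed

text \<open>One slot at a time by \<open>smooth_on_linear_apply\<close>, with the projection
  supplying linearity off \<open>F\<close>.\<close>

lemma smooth_on_form_apply:
  assumes "subspace F" "\<And>a. a \<in> T \<Longrightarrow> skew_form F (B a)"
    "\<And>v w. v \<in> F \<Longrightarrow> w \<in> F \<Longrightarrow> smooth_on T (\<lambda>a. B a v w)"
    "smooth_on T u" "smooth_on T w" "u ` T \<subseteq> F" "w ` T \<subseteq> F"
  shows "smooth_on T (\<lambda>a. B a (u a) (w a))"
proof -
  define Q where "Q = orth_proj F"
  note Q = linear_orth_proj[OF assms(1), folded Q_def] orth_proj_in[OF assms(1), folded Q_def]
    orth_proj_id[OF assms(1), folded Q_def]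
  have 1: "smooth_on T (\<lambda>a. B a (Q (u a)) (Q v))" for v
  proof (rule smooth_on_linear_apply[where A = "\<lambda>a x. B a (Q x) (Q v)"])
    show "linear (\<lambda>x. B a (Q x) (Q v))" if "a \<in> T" for a
      by (rule skew_form_linear_left[OF assms(2)[OF that] Q(2,1,2)])
  qed (intro assms Q)+
  have "smooth_on T (\<lambda>a. B a (Q (u a)) (Q (w a)))"
  proof (rule smooth_on_linear_apply[where A = "\<lambda>a x. B a (Q (u a)) (Q x)"])
    show "linear (\<lambda>x. B a (Q (u a)) (Q x))" if "a \<in> T" for a
      by (rule skew_form_linear_right[OF assms(2)[OF that] Q(2,1,2)])
  qed (intro assms 1)+
  then show ?thesis
    by (rule smooth_on_cong) (use assms Q in \<open>auto simp: image_subset_iff\<close>)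
qed

text \<open>Used with \<open>F\<close> a complement of the kernel for the slice, and with
  \<open>F\<close> the whole model for the Hamiltonian vector field. The equation on
  \<open>F\<close> becomes an equation for an injective operator on the ambient space.\<close>

lemma nondegenerate_form_solve:
  fixes B :: "'a::euclidean_space \<Rightarrow> 'e::euclidean_space \<Rightarrow> 'e \<Rightarrow> real"
  assumes "rel_open E \<Omega>" "a0 \<in> \<Omega>" "subspace F" "\<And>a. a \<in> \<Omega> \<Longrightarrow> skew_form F (B a)"
    "\<And>v w. v \<in> F \<Longrightarrow> w \<in> F \<Longrightarrow> smooth_on \<Omega> (\<lambda>a. B a v w)"
    "kern F (B a0) = {0}"
    "\<And>a. a \<in> \<Omega> \<Longrightarrow> linear (h a)" "\<And>w. w \<in> F \<Longrightarrow> smooth_on \<Omega> (\<lambda>a. h a w)"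
  obtains T u where "rel_open E T" "a0 \<in> T" "T \<subseteq> \<Omega>" "smooth_on T u" "\<And>a. a \<in> T \<Longrightarrow> u a \<in> F"
    "\<And>a w. a \<in> T \<Longrightarrow> w \<in> F \<Longrightarrow> B a (u a) w = h a w" "\<And>a. a \<in> T \<Longrightarrow> kern F (B a) = {0}"
proof -
  define Q where "Q = orth_proj F"
  note Q = linear_orth_proj[OF assms(3), folded Q_def] orth_proj_in[OF assms(3), folded Q_def]
    orth_proj_id[OF assms(3), folded Q_def] orth_proj_orth[OF assms(3), folded Q_def]
  \<comment> \<open>The vector representing the form in the inner product, plus the component
    orthogonal to \<open>F\<close>: a square system that is injective exactly where the form is
    nondegenerate on \<open>F\<close>.\<close>
  define A where "A = (\<lambda>a u. (u - Q u) + (\<Sum>b\<in>Basis. B a (Q u) (Q b) *\<^sub>R b))"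
  have linr: "linear (\<lambda>v. B a u (Q v))" if "a \<in> \<Omega>" "u \<in> F" for a u
    using skew_form_linear_right[OF assms(4)[OF that(1)] that(2) Q(1,2)] .
  have linl: "linear (\<lambda>u. B a (Q u) v)" if "a \<in> \<Omega>" "v \<in> F" for a v
    using skew_form_linear_left[OF assms(4)[OF that(1)] that(2) Q(1,2)] .
  have repr: "(\<Sum>b\<in>Basis. l b *\<^sub>R b) \<bullet> v = l v" if "linear l" for l :: "'e \<Rightarrow> real" and v
    using linear_euclidean_expand[OF that, of v] by (simp add: inner_sum_left inner_commute[of v] mult.commute)
  have Ain: "A a u \<bullet> v = (u - Q u) \<bullet> v + B a (Q u) (Q v)" if "a \<in> \<Omega>" for a u v
    using repr[OF linr[OF that Q(2)]] by (simp add: A_def inner_add_left)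
  have linA: "linear (A a)" if "a \<in> \<Omega>" for a
  proof (rule linearI; rule vector_eq_rdot[THEN iffD1], intro allI)
    show "A a (x + y) \<bullet> z = (A a x + A a y) \<bullet> z" for x y z
      using linear_add[OF linl[OF that Q(2), of z], of x y]
      by (simp add: Ain[OF that] inner_add_left inner_diff_left linear_add[OF Q(1)])
    show "A a (r *\<^sub>R x) \<bullet> z = (r *\<^sub>R A a x) \<bullet> z" for r x z
      using linear_scale[OF linl[OF that Q(2), of z], of r x]
      by (simp add: Ain[OF that] inner_add_left inner_diff_left linear_scale[OF Q(1)] algebra_simps)
  qed
  \<comment> \<open>Testing against \<open>u - Q u\<close> kills all terms that pass through
    \<open>Q\<close> and leaves the squared norm of \<open>u - Q u\<close>, so solutions
    automatically lie in \<open>F\<close>.\<close>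
  have Afix: "u \<in> F" "\<And>w. w \<in> F \<Longrightarrow> B a u w = l w"
    if "a \<in> \<Omega>" "linear l" "\<And>v. A a u \<bullet> v = l (Q v)" for a u l
  proof -
    have "Q (u - Q u) = 0" using Q by (simp add: linear_diff)
    moreover have "B a (Q u) 0 = 0" "l 0 = 0"
      using linear_0[OF linr[OF that(1) Q(2)]] linear_0[OF Q(1)] linear_0[OF that(2)] by auto
    ultimately have "(u - Q u) \<bullet> (u - Q u) = 0" using that(3)[of "u - Q u"] Ain[OF that(1), of u "u - Q u"] by simp
    then have u: "u = Q u" by simp
    then show "u \<in> F" using Q(2) by metis
    show "B a u w = l w" if "w \<in> F" for w
      using Ain[OF \<open>a \<in> \<Omega>\<close>, of u w] \<open>\<And>v. A a u \<bullet> v = l (Q v)\<close>[of w] u Q(3)[OF that] by simp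
  qed
  have inj0: "inj (A a0)"
    unfolding linear_injective_0[OF linA[OF assms(2)]]
  proof (intro allI impI)
    fix u assume "A a0 u = 0"
    then have "u \<in> F" "\<And>w. w \<in> F \<Longrightarrow> B a0 u w = 0"
      using Afix[OF assms(2), of "\<lambda>_. 0" u] by (auto simp: linear_zero)
    then show "u = 0" using assms(6) by (auto simp: kern_def)
  qed
  have smA: "smooth_on \<Omega> (\<lambda>a. A a v)" for v
    unfolding A_def using Q(2)
    by (auto intro!: smooth_on_add smooth_on_diff smooth_on_const smooth_on_sum smooth_on_scaleR assms(5))
  obtain T c where T: "rel_open E T" "a0 \<in> T" "T \<subseteq> \<Omega>" "c > 0" "\<And>x v. x \<in> T \<Longrightarrow> c * norm v \<le> norm (A x v)"
    using inj_linear_near[OF assms(1,2) linA smooth_on_continuous_on[OF smA] inj0] by blast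
  have injA: "inj (A a)" if "a \<in> T" for a
  proof -
    have a: "a \<in> \<Omega>" using that T(3) by blast
    have "v = 0" if "A a v = 0" for v
      using T(5)[OF \<open>a \<in> T\<close>, of v] that T(4) by (simp add: mult_le_0_iff)
    then show ?thesis unfolding linear_injective_0[OF linA[OF a]] by blast
  qed
  define y where "y = (\<lambda>a. \<Sum>b\<in>Basis. h a (Q b) *\<^sub>R b)"
  have hQ: "linear (\<lambda>v. h a (Q v))" if "a \<in> \<Omega>" for a
    using linear_compose[OF Q(1) assms(7)[OF that]] by (simp add: o_def)
  have yin: "y a \<bullet> v = h a (Q v)" if "a \<in> \<Omega>" for a v
    unfolding y_def by (rule repr[OF hQ[OF that]])
  have "\<exists>u. A a u = y a" if "a \<in> T" for a
    using linear_injective_imp_surjective[OF linA injA[OF that]] that T(3) by (metis subsetD surjD)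
  then obtain u where u: "\<And>a. a \<in> T \<Longrightarrow> A a (u a) = y a" by metis
  have smu: "smooth_on T u"
  proof (rule smooth_on_linear_solve[OF T(1), of A y])
    show "smooth_on T y" unfolding y_def using T(3) Q(2)
      by (auto intro!: smooth_on_sum smooth_on_scaleR smooth_on_const smooth_on_subset[OF assms(8)])
  qed (use T linA injA u smooth_on_subset[OF smA] in auto)
  show ?thesis
  proof (rule that[OF T(1-3) smu])
    fix a assume a: "a \<in> T"
    then have a': "a \<in> \<Omega>" using T(3) by blast
    have "A a (u a) \<bullet> v = h a (Q v)" for v using u[OF a] yin[OF a'] by simp
    then show "u a \<in> F" "\<And>w. w \<in> F \<Longrightarrow> B a (u a) w = h a w"
      using Afix[OF a' assms(7)[OF a'], of "u a"] by blast+
    show "kern F (B a) = {0}"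
    proof
      show "{0} \<subseteq> kern F (B a)" using subspace_0[OF subspace_kern[OF assms(4)[OF a'] assms(3)]] by simp
      show "kern F (B a) \<subseteq> {0}"
      proof
        fix x assume x: "x \<in> kern F (B a)"
        have "A a x \<bullet> v = 0" for v
          using Ain[OF a', of x v] x Q(2,3) by (auto simp: kern_def)
        then have "A a x = 0" by (metis inner_eq_zero_iff)
        then show "x \<in> {0}" using injA[OF a] unfolding linear_injective_0[OF linA[OF a']] by blast
      qed
    qed
  qed
qed


text \<open>The range of the form is the annihilator of its kernel: solve on the orthogonal
  complement of the kernel, and note that both sides vanish on the kernel itself.\<close>

lemma skew_form_range:
  assumes "skew_form E B" "subspace E" "linear l" "\<And>\<kappa>. \<kappa> \<in> kern E B \<Longrightarrow> l \<kappa> = 0"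
  obtains u where "u \<in> E" "\<And>v. v \<in> E \<Longrightarrow> l v = B u v"
proof -
  define F where "F = {y\<in>E. \<forall>x\<in>kern E B. orthogonal x y}"
  note F = kern_complement[OF assms(1,2), folded F_def]
  have FE: "F \<subseteq> E" by (auto simp: F_def)
  \<comment> \<open>The family is constant over the real line, and only its member at 0 is
    used.\<close>
  have ro: "rel_open (UNIV :: real set) UNIV" by (simp add: rel_open_UNIV)
  obtain T u where u: "(0::real) \<in> T" "\<And>a. a \<in> T \<Longrightarrow> u a \<in> F" "\<And>a w. a \<in> T \<Longrightarrow> w \<in> F \<Longrightarrow> B (u a) w = l w"
    by (rule nondegenerate_form_solve[OF ro UNIV_I[of 0] F(1), of "\<lambda>_. B" "\<lambda>_. l"])
      (use skew_form_subset[OF assms(1) FE] F(2) assms(3) in \<open>auto intro: smooth_on_const\<close>)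
  have K: "subspace (kern E B)" by (rule subspace_kern[OF assms(1,2)])
  define P where "P = orth_proj (kern E B)"
  note P = orth_proj_in[OF K, folded P_def] orth_proj_orth[OF K, folded P_def]
  have PE: "P v \<in> E" for v using P(1)[of v] by (simp add: kern_def)
  have uE: "u 0 \<in> E" using u(1,2) FE by blast
  have "l v = B (u 0) v" if v: "v \<in> E" for v
  proof -
    have Q: "v - P v \<in> F"
      using P(2) subspace_diff[OF assms(2) v PE] by (auto simp: F_def orthogonal_def inner_commute)
    have "B (u 0) (P v) = 0"
      using skew_form_skew[OF assms(1) uE PE] P(1)[of v] uE by (auto simp: kern_def)
    then have "B (u 0) v = B (u 0) (v - P v)"
      using skew_form_add_right[OF assms(1,2) PE _ uE, of "v - P v" v] Q FE by auto
    also have "\<dots> = l (v - P v)" using u Q by blast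
    also have "\<dots> = l v" using linear_diff[OF assms(3)] assms(4)[OF P(1)] by simp
    finally show ?thesis by simp
  qed
  then show ?thesis using that uE by blast
qed

text \<open>
  At a zero of \<open>G\<close> the second derivative of \<open>\<sigma>\<close> drops out of the Hessian of \<open>h \<circ> \<sigma>\<close>.
\<close>

lemma hessian_along_kernel:
  fixes h :: "'e::euclidean_space \<Rightarrow> real" and \<sigma> :: "'a::euclidean_space \<Rightarrow> 'e"
  assumes "rel_open E \<Omega>" "smooth_on \<Omega> h" "rel_open E T" "T \<subseteq> \<Omega>" "smooth_on T G" "G (\<sigma> u0) = 0"
    and G: "\<And>y \<kappa>. y \<in> T \<Longrightarrow> \<kappa> \<in> K y \<Longrightarrow> fderiv h \<Omega> y \<kappa> = G y \<bullet> \<kappa>"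
    and \<sigma>: "rel_open F W" "u0 \<in> W" "smooth_on W \<sigma>" "\<sigma> ` W \<subseteq> \<Omega>" "\<sigma> u0 \<in> T"
      "\<And>u a. u \<in> W \<Longrightarrow> a \<in> F \<Longrightarrow> fderiv \<sigma> W u a \<in> K (\<sigma> u)"
    and ab: "a \<in> F" "b \<in> F"
  shows "fderiv (\<lambda>u. fderiv (\<lambda>u. h (\<sigma> u)) W u a) W u0 b = fderiv G T (\<sigma> u0) (fderiv \<sigma> W u0 b) \<bullet> fderiv \<sigma> W u0 a"
proof -
  \<comment> \<open>Here \<open>\<sigma>\<close> stays in \<open>T\<close>, where the representation
    of the derivative of \<open>h\<close> by \<open>G\<close> holds.\<close>
  define W1 where "W1 = W \<inter> \<sigma> -` T"
  have W1: "rel_open F W1" unfolding W1_def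
    using rel_open_preimage[OF \<sigma>(1) smooth_on_continuous_on[OF \<sigma>(3)], of E T] assms(1,3) \<sigma>(4)
      rel_open_subset[OF assms(1)] unfolding rel_open_def by blast
  have u0: "u0 \<in> W1" using \<sigma> by (simp add: W1_def)
  have eq: "fderiv (\<lambda>u. h (\<sigma> u)) W u a = G (\<sigma> u) \<bullet> fderiv \<sigma> W u a" if "u \<in> W1" for u
    using fderiv_compose[OF \<sigma>(1,3) assms(2) \<sigma>(4) _ ab(1), of u] G \<sigma>(6)[OF _ ab(1), of u] that
    by (simp add: W1_def)
  have "fderiv (\<lambda>u. fderiv (\<lambda>u. h (\<sigma> u)) W u a) W u0 = fderiv (\<lambda>u. G (\<sigma> u) \<bullet> fderiv \<sigma> W u a) W1 u0"
    by (rule fderiv_rel_cong[OF \<sigma>(1) W1 W1 _ _ u0 eq]) (auto simp: W1_def)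
  moreover have "fderiv (\<lambda>u. G (\<sigma> u) \<bullet> fderiv \<sigma> W u a) W1 u0 b =
      G (\<sigma> u0) \<bullet> fderiv (\<lambda>u. fderiv \<sigma> W u a) W1 u0 b + fderiv (\<lambda>u. G (\<sigma> u)) W1 u0 b \<bullet> fderiv \<sigma> W u0 a"
  proof (rule fderiv_eq[OF W1 u0 _ ab(2)])
    have "smooth_on W1 (\<lambda>u. G (\<sigma> u))"
      by (rule smooth_on_compose[OF assms(5) smooth_on_subset[OF \<sigma>(3)]]) (auto simp: W1_def)
    moreover have "smooth_on W1 (\<lambda>u. fderiv \<sigma> W u a)"
      by (rule smooth_on_subset[OF smooth_on_fderiv[OF \<sigma>(1,3) ab(1)]]) (auto simp: W1_def)
    ultimately show "((\<lambda>u. G (\<sigma> u) \<bullet> fderiv \<sigma> W u a) has_derivative (\<lambda>b.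
        G (\<sigma> u0) \<bullet> fderiv (\<lambda>u. fderiv \<sigma> W u a) W1 u0 b + fderiv (\<lambda>u. G (\<sigma> u)) W1 u0 b \<bullet> fderiv \<sigma> W u0 a)) (at u0 within W1)"
      using u0 by (intro has_derivative_inner smooth_on_has_derivative)
  qed
  moreover have "fderiv (\<lambda>u. G (\<sigma> u)) W1 u0 b = fderiv G T (\<sigma> u0) (fderiv \<sigma> W1 u0 b)"
    by (rule fderiv_compose[OF W1 smooth_on_subset[OF \<sigma>(3)] assms(5) _ u0 ab(2)]) (auto simp: W1_def)
  moreover have "fderiv \<sigma> W1 u0 = fderiv \<sigma> W u0"
    by (rule fderiv_rel_cong[OF W1 \<sigma>(1) W1 _ _ u0]) (auto simp: W1_def)
  ultimately show ?thesis using assms(6) by simp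
qed

text \<open>The slice theorem in coordinates. \<open>\<sigma>\<close> stands for the fibre through
  \<open>a0\<close>; it is tied to the kernel by tangency along \<open>W\<close> and surjectivity at
  \<open>u0\<close>. The last conclusion says that the zero set is transverse to the kernel at
  \<open>a0\<close>.\<close>

lemma local_slice:
  fixes lf :: "'e::euclidean_space \<Rightarrow> 'e \<Rightarrow> 'e \<Rightarrow> real" and h :: "'e \<Rightarrow> real"
    and \<sigma> :: "'a::euclidean_space \<Rightarrow> 'e"
  assumes \<Omega>: "rel_open E \<Omega>" "a0 \<in> \<Omega>"
    and lf: "\<And>a. a \<in> \<Omega> \<Longrightarrow> skew_form E (lf a)"
      "\<And>v w. v \<in> E \<Longrightarrow> w \<in> E \<Longrightarrow> smooth_on \<Omega> (\<lambda>a. lf a v w)"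
      "\<And>a. a \<in> \<Omega> \<Longrightarrow> dim (kern E (lf a)) = k"
    and h: "smooth_on \<Omega> h" "\<And>\<kappa>. \<kappa> \<in> kern E (lf a0) \<Longrightarrow> fderiv h \<Omega> a0 \<kappa> = 0"
    and \<sigma>: "rel_open F' W" "u0 \<in> W" "smooth_on W \<sigma>" "\<sigma> ` W \<subseteq> \<Omega>" "\<sigma> u0 = a0"
      "\<And>u a. u \<in> W \<Longrightarrow> a \<in> F' \<Longrightarrow> fderiv \<sigma> W u a \<in> kern E (lf (\<sigma> u))"
      "kern E (lf a0) \<subseteq> fderiv \<sigma> W u0 ` F'"
    and nondeg: "\<And>a. a \<in> F' \<Longrightarrow>
        (\<And>b. b \<in> F' \<Longrightarrow> fderiv (\<lambda>u. fderiv (\<lambda>u. h (\<sigma> u)) W u a) W u0 b = 0) \<Longrightarrow> a = 0"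
    and F: "subspace F" "F \<subseteq> E" "dim F + k = dim E"
  obtains A \<Theta> g where "rel_open E A" "a0 \<in> A" "A \<subseteq> \<Omega>" "smooth_on A \<Theta>" "rel_open E (\<Theta> ` A)"
    "smooth_on (\<Theta> ` A) g" "\<And>y. y \<in> A \<Longrightarrow> g (\<Theta> y) = y"
    "\<And>y. y \<in> A \<Longrightarrow> \<Theta> y \<in> F \<longleftrightarrow> (\<forall>\<kappa>\<in>kern E (lf y). fderiv h \<Omega> y \<kappa> = 0)"
    "\<And>v. v \<in> kern E (lf a0) \<Longrightarrow> fderiv \<Theta> A a0 v \<in> F \<Longrightarrow> v = 0"
proof -
  have E: "subspace E" using \<Omega> rel_open_subspace by blast
  define K0 where "K0 = kern E (lf a0)"
  define F0 where "F0 = {y\<in>E. \<forall>x\<in>K0. orthogonal x y}"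
  define P where "P = orth_proj E"
  define P0 where "P0 = orth_proj K0"
  have K0: "subspace K0" unfolding K0_def by (rule subspace_kern[OF lf(1)[OF \<Omega>(2)] E])
  have K0E: "K0 \<subseteq> E" by (auto simp: K0_def kern_def)
  note F0 = kern_complement(1)[OF lf(1)[OF \<Omega>(2)] E, folded K0_def, folded F0_def]
    and nd0 = kern_complement(2)[OF lf(1)[OF \<Omega>(2)] E, folded K0_def, folded F0_def]
  have F0E: "F0 \<subseteq> E" by (auto simp: F0_def)
  have orth: "x \<bullet> y = 0" "y \<bullet> x = 0" if "x \<in> K0" "y \<in> F0" for x y
    using that by (auto simp: F0_def orthogonal_def inner_commute)
  note P = linear_orth_proj[OF E, folded P_def] orth_proj_in[OF E, folded P_def]
    orth_proj_id[OF E, folded P_def] orth_proj_orth[OF E, folded P_def]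
  note P0 = linear_orth_proj[OF K0, folded P0_def] orth_proj_in[OF K0, folded P0_def]
    orth_proj_id[OF K0, folded P0_def] orth_proj_orth[OF K0, folded P0_def]
  have P0E: "P0 v \<in> E" for v using P0(2) K0E by blast
  have Q: "v - P0 v \<in> F0" if "v \<in> E" for v
    using P0(4) that subspace_diff[OF E that P0E] by (auto simp: F0_def orthogonal_def inner_commute)
  have dh: "linear (fderiv h \<Omega> a)" if "a \<in> \<Omega>" for a using linear_fderiv[OF h(1) that] .
  obtain T u where T: "rel_open E T" "a0 \<in> T" "T \<subseteq> \<Omega>" and u: "smooth_on T u" "\<And>a. a \<in> T \<Longrightarrow> u a \<in> F0"
    "\<And>a w. a \<in> T \<Longrightarrow> w \<in> F0 \<Longrightarrow> lf a (u a) w = fderiv h \<Omega> a w" "\<And>a. a \<in> T \<Longrightarrow> kern F0 (lf a) = {0}"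
  proof (rule nondegenerate_form_solve[OF \<Omega> F0, of lf "fderiv h \<Omega>"])
    show "skew_form F0 (lf a)" if "a \<in> \<Omega>" for a using skew_form_subset[OF lf(1)[OF that] F0E] .
    show "smooth_on \<Omega> (\<lambda>a. lf a v w)" if "v \<in> F0" "w \<in> F0" for v w
      using lf(2) F0E that by blast
    show "smooth_on \<Omega> (\<lambda>a. fderiv h \<Omega> a w)" if "w \<in> F0" for w
      using smooth_on_fderiv[OF \<Omega>(1) h(1)] F0E that by blast
  qed (use nd0 dh in auto)
  have uE: "u a \<in> E" if "a \<in> T" for a using u(2)[OF that] F0E by blast
  \<comment> \<open>Its inner product with \<open>v\<close> is the defect of the equation for
    \<open>u a\<close> on the \<open>K0\<close> component of \<open>v\<close>.\<close>
  define G where "G = (\<lambda>a. \<Sum>b\<in>Basis. (fderiv h \<Omega> a (P0 b) - lf a (u a) (P0 b)) *\<^sub>R b)"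
  have G_in: "G a \<bullet> v = fderiv h \<Omega> a (P0 v) - lf a (u a) (P0 v)" if a: "a \<in> T" for a v
  proof -
    have a': "a \<in> \<Omega>" using a T by blast
    have "linear (\<lambda>v. fderiv h \<Omega> a (P0 v))" using linear_compose[OF P0(1) dh[OF a']] by (simp add: o_def)
    moreover have "linear (\<lambda>v. lf a (u a) (P0 v))"
      by (rule skew_form_linear_right[OF lf(1)[OF a'] uE[OF a] P0(1) P0E])
    ultimately have "linear (\<lambda>v. fderiv h \<Omega> a (P0 v) - lf a (u a) (P0 v))" by (rule linear_compose_sub)
    from linear_euclidean_expand[OF this, of v] show ?thesis
      by (simp add: G_def inner_sum_left inner_commute[of v] mult.commute)
  qed
  \<comment> \<open>The defect vanishes on vectors orthogonal to \<open>K0\<close>, in particular on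
    the component of \<open>G a\<close> orthogonal to \<open>K0\<close>.\<close>
  have G_K0: "G a \<in> K0" if a: "a \<in> T" for a
  proof -
    have "P0 (G a - P0 (G a)) = 0" using P0 by (simp add: linear_diff)
    then have 1: "G a \<bullet> (G a - P0 (G a)) = 0"
      using G_in[OF a, of "G a - P0 (G a)"] G_in[OF a, of 0] by (simp add: linear_0[OF P0(1)])
    have "P0 (G a) \<bullet> (G a - P0 (G a)) = 0" using P0(4)[OF P0(2), of "G a" "G a"] by (simp add: inner_commute)
    with 1 have "(G a - P0 (G a)) \<bullet> (G a - P0 (G a)) = 0" by (simp add: inner_diff_left)
    then show ?thesis using P0(2)[of "G a"] by simp
  qed
  \<comment> \<open>On the \<open>F0\<close> component of \<open>\<kappa>\<close> the derivative of
    \<open>h\<close> equals the form applied to \<open>u a\<close>, and the form applied to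
    \<open>u a\<close> and all of \<open>\<kappa>\<close> is zero; what remains is the
    defect.\<close>
  have G_kern: "fderiv h \<Omega> a \<kappa> = G a \<bullet> \<kappa>" if a: "a \<in> T" and \<kappa>: "\<kappa> \<in> kern E (lf a)" for a \<kappa>
  proof -
    have a': "a \<in> \<Omega>" using a T by blast
    have \<kappa>E: "\<kappa> \<in> E" using \<kappa> by (simp add: kern_def)
    have "fderiv h \<Omega> a \<kappa> = fderiv h \<Omega> a (P0 \<kappa>) + fderiv h \<Omega> a (\<kappa> - P0 \<kappa>)"
      using linear_add[OF dh[OF a'], of "P0 \<kappa>" "\<kappa> - P0 \<kappa>"] by simp
    also have "fderiv h \<Omega> a (\<kappa> - P0 \<kappa>) = lf a (u a) (\<kappa> - P0 \<kappa>)" using u(3)[OF a Q[OF \<kappa>E]] by simp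
    also have "\<dots> = lf a (u a) \<kappa> - lf a (u a) (P0 \<kappa>)"
      using skew_form_diff_right[OF lf(1)[OF a'] E \<kappa>E P0E uE[OF a]] .
    also have "lf a (u a) \<kappa> = 0"
      using skew_form_skew[OF lf(1)[OF a'] uE[OF a] \<kappa>E] \<kappa> uE[OF a] by (simp add: kern_def)
    finally show ?thesis using G_in[OF a, of \<kappa>] by simp
  qed
  have G_zero: "G a = 0 \<longleftrightarrow> (\<forall>\<kappa>\<in>kern E (lf a). fderiv h \<Omega> a \<kappa> = 0)" if a: "a \<in> T" for a
  proof
    assume "\<forall>\<kappa>\<in>kern E (lf a). fderiv h \<Omega> a \<kappa> = 0"
    then have 0: "G a \<bullet> \<kappa> = 0" if "\<kappa> \<in> kern E (lf a)" for \<kappa> using G_kern[OF a] that by simp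
    have a': "a \<in> \<Omega>" using a T by blast
    have sk: "subspace (kern E (lf a))" by (rule subspace_kern[OF lf(1)[OF a'] E])
    \<comment> \<open>A difference killed by \<open>P0\<close> lies in \<open>F0\<close> and in the
      kernel at \<open>a\<close>, hence in the kernel of the form restricted to \<open>F0\<close>,
      which is zero. Equal dimensions then make \<open>P0\<close> surjective onto
      \<open>K0\<close>.\<close>
    have "inj_on P0 (kern E (lf a))"
    proof (rule inj_onI)
      fix x y assume xy: "x \<in> kern E (lf a)" "y \<in> kern E (lf a)" "P0 x = P0 y"
      then have d: "x - y \<in> kern E (lf a)" using sk subspace_diff by blast
      then have "x - y - P0 (x - y) \<in> F0" using Q by (auto simp: kern_def)
      then have "x - y \<in> F0" using xy(3) by (simp add: linear_diff[OF P0(1)])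
      then have "x - y \<in> kern F0 (lf a)" using d F0E by (auto simp: kern_def)
      then show "x = y" using u(4)[OF a] by simp
    qed
    then have "dim (P0 ` kern E (lf a)) = dim (kern E (lf a))"
      using dim_image_eq[OF P0(1), of "kern E (lf a)"] span_eq_iff[THEN iffD2, OF sk] by simp
    then have "dim (P0 ` kern E (lf a)) = dim K0" using lf(3) a' \<Omega>(2) by (simp add: K0_def)
    then have "P0 ` kern E (lf a) = K0"
      using subspace_dim_equal[of "P0 ` kern E (lf a)" K0] linear_subspace_image[OF P0(1) sk] K0 P0(2)
      by auto
    then obtain \<kappa> where \<kappa>: "\<kappa> \<in> kern E (lf a)" "G a = P0 \<kappa>" using G_K0[OF a] by blast
    have "(\<kappa> - P0 \<kappa>) \<bullet> G a = 0" using P0(4)[OF G_K0[OF a]] .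
    then have "G a \<bullet> G a = G a \<bullet> \<kappa>" using \<kappa>(2) by (simp add: inner_simps inner_commute)
    then show "G a = 0" using 0[OF \<kappa>(1)] by simp
  qed (simp add: G_kern[OF a])
  have smG: "smooth_on T G"
    unfolding G_def
  proof (intro smooth_on_sum smooth_on_scaleR smooth_on_diff smooth_on_const)
    fix b :: 'e
    show "smooth_on T (\<lambda>a. fderiv h \<Omega> a (P0 b))"
      using smooth_on_subset[OF smooth_on_fderiv[OF \<Omega>(1) h(1) P0E] T(3)] .
    show "smooth_on T (\<lambda>a. lf a (u a) (P0 b))"
    proof (rule smooth_on_form_apply[OF E, where w = "\<lambda>_. P0 b"])
      show "smooth_on T (\<lambda>a. lf a v w)" if "v \<in> E" "w \<in> E" for v w
        using smooth_on_subset[OF lf(2)[OF that] T(3)] .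
    qed (use T(3) lf(1) u uE P0E in \<open>auto intro: smooth_on_const\<close>)
  qed
  define D where "D = fderiv G T a0"
  have linD: "linear D" unfolding D_def by (rule linear_fderiv[OF smG T(2)])
  have D_K0: "D v \<in> K0" if "v \<in> E" for v
    unfolding D_def by (rule fderiv_in[OF T(1) smG T(2) that K0]) (use G_K0 in auto)
  have Ga0: "G a0 = 0" using G_zero[OF T(2)] h(2) by simp
  have D_inj: "v = 0" if v: "v \<in> K0" "D v = 0" for v
  proof -
    obtain b where b: "b \<in> F'" "v = fderiv \<sigma> W u0 b" using \<sigma>(7) v(1) by (auto simp: K0_def)
    have sm: "smooth_on W (\<lambda>u. h (\<sigma> u))" by (rule smooth_on_compose[OF h(1) \<sigma>(3,4)])
    have "b = 0"
    proof (rule nondeg[OF b(1)])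
      fix a assume a: "a \<in> F'"
      \<comment> \<open>Symmetry moves \<open>b\<close> to the slot in which \<open>G\<close> is
        differentiated, so that the assumption \<open>D v = 0\<close> applies.\<close>
      have "fderiv (\<lambda>u. fderiv (\<lambda>u. h (\<sigma> u)) W u b) W u0 a = fderiv (\<lambda>u. fderiv (\<lambda>u. h (\<sigma> u)) W u a) W u0 b"
        by (rule second_derivative_symmetric_real[OF \<sigma>(1) sm \<sigma>(2) b(1) a])
      also have "\<dots> = fderiv G T (\<sigma> u0) (fderiv \<sigma> W u0 b) \<bullet> fderiv \<sigma> W u0 a"
        by (rule hessian_along_kernel[where K = "\<lambda>y. kern E (lf y)" and \<sigma> = \<sigma> and ?u0.0 = u0, OF \<Omega>(1) h(1) T(1,3) smG _ G_kern \<sigma>(1-4) _ \<sigma>(6) a b(1)])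
          (simp_all add: \<sigma>(5) Ga0 T)
      also have "\<dots> = 0" using v(2) b(2) \<sigma>(5) by (simp add: D_def)
      finally show "fderiv (\<lambda>u. fderiv (\<lambda>u. h (\<sigma> u)) W u b) W u0 a = 0" .
    qed
    then show ?thesis using b(2) linear_0[OF linear_fderiv[OF \<sigma>(3,2)]] by simp
  qed
  have "dim F0 + dim K0 = dim E"
    unfolding F0_def by (rule dim_subspace_orthogonal_to_vectors[OF K0 E K0E])
  then have dims: "dim F0 = dim F" using F(3) lf(3)[OF \<Omega>(2)] unfolding K0_def by simp
  obtain L where L: "linear L" "inj L" "\<And>v. L v \<in> E \<longleftrightarrow> v \<in> E" "\<And>v. L v \<in> F \<longleftrightarrow> v \<in> F0"
    using linear_map_onto_subspace[OF E F0 F(1) F0E F(2) dims] by blast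
  have blL: "bounded_linear L" "bounded_linear P" "bounded_linear P0"
    using L(1) P(1) P0(1) linear_conv_bounded_linear by blast+
  define U where "U = P -` T"
  have U: "open U" unfolding U_def P_def by (rule open_vimage_orth_proj[OF T(1)])
  \<comment> \<open>On \<open>E\<close> the \<open>K0\<close> component of \<open>y\<close> is
    replaced by \<open>G y\<close>, and \<open>L\<close> takes \<open>F0\<close> to
    \<open>F\<close>; so the zero set of \<open>G\<close> becomes the part in \<open>F\<close>.
    Before \<open>L\<close>, the map is the identity modulo \<open>E\<close>, which makes it fit for
    the inverse function theorem in the ambient space.\<close>
  define \<Theta> where "\<Theta> = (\<lambda>y. L (y - P0 y + G (P y)))"
  have sm\<Theta>: "smooth_on U \<Theta>"
    unfolding \<Theta>_def by (intro smooth_on_bounded_linear[OF blL(1)] smooth_on_add smooth_on_diff smooth_on_id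
        smooth_on_bounded_linear[OF blL(3)] smooth_on_compose[OF smG] smooth_on_bounded_linear[OF blL(2)])
      (auto simp: U_def)
  have a0E: "a0 \<in> E" using \<Omega> rel_open_subset by blast
  have a0U: "a0 \<in> U" using T(2) P(3)[OF a0E] by (simp add: U_def)
  have roU: "rel_open UNIV U" using U rel_open_UNIV by blast
  have der: "fderiv \<Theta> U a0 v = L (v - P0 v + D (P v))" for v
  proof (rule fderiv_eq[OF roU a0U _ UNIV_I])
    have "((\<lambda>y. G (P y)) has_derivative (\<lambda>v. D (P v))) (at a0 within U)"
      unfolding P_def D_def
      using has_derivative_orth_proj[OF T(1,2) smooth_on_has_derivative[OF smG T(2)]] by (rule has_derivative_at_withinI)
    then show "(\<Theta> has_derivative (\<lambda>v. L (v - P0 v + D (P v)))) (at a0 within U)"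
      unfolding \<Theta>_def
      by (intro bounded_linear.has_derivative[OF blL(1)] has_derivative_add has_derivative_diff has_derivative_ident
          bounded_linear.has_derivative[OF blL(3)])
  qed
  have "inj (fderiv \<Theta> U a0)"
    unfolding linear_injective_0[OF linear_fderiv[OF sm\<Theta> a0U]]
  proof (intro allI impI)
    fix v assume "fderiv \<Theta> U a0 v = 0"
    then have e: "v - P0 v + D (P v) = 0" using der L(1,2) linear_injective_0 by metis
    \<comment> \<open>The projection kills \<open>v - P0 v\<close> and fixes \<open>D (P v)\<close>,
      so the two parts of the equation vanish separately.\<close>
    have "P0 (v - P0 v + D (P v)) = D (P v)"
      using P0 D_K0[OF P(2)] by (simp add: linear_add linear_diff)
    then have "D (P v) = 0" using e linear_0[OF P0(1)] by simp
    with e have "v = P0 v" by simp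
    then have vK: "v \<in> K0" using P0(2) by metis
    then have "P v = v" using P(3) K0E by blast
    then show "v = 0" using D_inj[OF vK] \<open>D (P v) = 0\<close> by simp
  qed
  then obtain U' V g where inv: "open U'" "U' \<subseteq> U" "a0 \<in> U'" "open V" "\<Theta> a0 \<in> V" "homeomorphism U' V \<Theta> g" "smooth_on V g"
    using smooth_inverse_function[OF U sm\<Theta> a0U] by blast
  define A where "A = E \<inter> U'"
  have A: "rel_open E A" unfolding rel_open_def A_def using E inv(1) by (auto simp: openin_open)
  have AT: "A \<subseteq> T" using inv(2) P(3) by (auto simp: A_def U_def)
  \<comment> \<open>The equivalence makes the image of \<open>A\<close> all of
    \<open>E \<inter> V\<close>, hence open relative to \<open>E\<close>.\<close>
  have \<Theta>E: "\<Theta> y \<in> E \<longleftrightarrow> y \<in> E" if "y \<in> U" for y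
  proof -
    have "- P0 y + G (P y) \<in> E" using P0E G_K0 that K0E E
      by (auto simp: U_def intro!: subspace_diff)
    then have "y + (- P0 y + G (P y)) \<in> E \<longleftrightarrow> y \<in> E" using E by (rule subspace_add_cancel_right[rotated])
    then show ?thesis unfolding \<Theta>_def L(3) by (simp add: algebra_simps)
  qed
  have im: "\<Theta> ` A = E \<inter> V"
  proof
    show "\<Theta> ` A \<subseteq> E \<inter> V" using \<Theta>E inv(2,6) by (auto simp: A_def homeomorphism_def)
    show "E \<inter> V \<subseteq> \<Theta> ` A"
    proof
      fix z assume z: "z \<in> E \<inter> V"
      then have "g z \<in> U'" "\<Theta> (g z) = z" using inv(6) by (auto simp: homeomorphism_def)
      moreover from this have "g z \<in> E" using \<Theta>E[of "g z"] z inv(2) by auto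
      ultimately show "z \<in> \<Theta> ` A" unfolding A_def by (metis IntI imageI)
    qed
  qed
  show ?thesis
  proof (rule that[of A \<Theta> g])
    show "rel_open E A" by (rule A)
    show "a0 \<in> A" using a0E inv by (simp add: A_def)
    show "A \<subseteq> \<Omega>" using AT T by blast
    show "smooth_on A \<Theta>" by (rule smooth_on_subset[OF sm\<Theta>]) (use inv in \<open>auto simp: A_def\<close>)
    show "rel_open E (\<Theta> ` A)" unfolding im rel_open_def using E inv(4) by (auto simp: openin_open)
    show "smooth_on (\<Theta> ` A) g" by (rule smooth_on_subset[OF inv(7)]) (simp add: im)
    show "g (\<Theta> y) = y" if "y \<in> A" for y using that inv(6) by (auto simp: A_def homeomorphism_def)
    show "\<Theta> y \<in> F \<longleftrightarrow> (\<forall>\<kappa>\<in>kern E (lf y). fderiv h \<Omega> y \<kappa> = 0)" if "y \<in> A" for y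
    proof -
      have yT: "y \<in> T" and yE: "y \<in> E" using that AT by (auto simp: A_def)
      have "\<Theta> y \<in> F \<longleftrightarrow> (y - P0 y) + G y \<in> F0" unfolding \<Theta>_def L(4) P(3)[OF yE] by simp
      also have "\<dots> \<longleftrightarrow> G y \<in> F0" using Q[OF yE] by (rule subspace_add_cancel_left[OF F0])
      also have "\<dots> \<longleftrightarrow> G y = 0" using orth(1)[OF G_K0[OF yT], of "G y"] subspace_0[OF F0] by auto
      finally show ?thesis using G_zero[OF yT] by simp
    qed
    show "v = 0" if v: "v \<in> kern E (lf a0)" "fderiv \<Theta> A a0 v \<in> F" for v
    proof -
      have vK: "v \<in> K0" and vE: "v \<in> E" using v by (auto simp: K0_def kern_def)
      have "fderiv \<Theta> A a0 v = fderiv \<Theta> U a0 v"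
        by (rule fderiv_eq[OF A _ has_derivative_subset[OF smooth_on_has_derivative[OF sm\<Theta> a0U]] vE])
          (use a0E inv in \<open>auto simp: A_def\<close>)
      \<comment> \<open>On \<open>K0\<close> the term \<open>v - P0 v\<close> vanishes, so only the
        derivative of \<open>G\<close> is left; it takes values in \<open>K0\<close>, which meets
        \<open>F0\<close> trivially.\<close>
      also have "\<dots> = L (D v)" using der[of v] P0(3)[OF vK] P(3)[OF vE] by simp
      finally have "D v \<in> F0" using v(2) L(4) by simp
      then have "D v = 0" using orth(1)[OF D_K0[OF vE], of "D v"] by simp
      then show "v = 0" using D_inj[OF vK] by simp
    qed
  qed
qed

section \<open>Charts and tangent maps\<close>

lemma smooth_manifold_subspace: "smooth_manifold M \<Longrightarrow> subspace (model M)"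
  unfolding smooth_manifold_def by blast

lemma chart_openin: "chart M (U, \<phi>) \<Longrightarrow> openin (mtop M) U"
  unfolding chart_def by simp

lemma chart_subset: "chart M (U, \<phi>) \<Longrightarrow> U \<subseteq> points M"
  unfolding points_def using chart_openin openin_subset by blast

lemma chart_rel_open: "chart M (U, \<phi>) \<Longrightarrow> subspace (model M) \<Longrightarrow> rel_open (model M) (\<phi> ` U)"
  unfolding chart_def rel_open_def by simp

lemma chart_homeo: "chart M (U, \<phi>) \<Longrightarrow> homeomorphic_map (subtopology (mtop M) U) (top_of_set (\<phi> ` U)) \<phi>"
  unfolding chart_def by simp

lemma chart_topspace: "chart M (U, \<phi>) \<Longrightarrow> topspace (subtopology (mtop M) U) = U"
  using chart_openin openin_subset topspace_subtopology_subset by metis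

lemma chart_inj: "chart M (U, \<phi>) \<Longrightarrow> inj_on \<phi> U"
  using chart_homeo chart_topspace homeomorphic_imp_injective_map by metis

lemma chart_inv: "chart M (U, \<phi>) \<Longrightarrow> x \<in> U \<Longrightarrow> inv_into U \<phi> (\<phi> x) = x"
  using chart_inj inv_into_f_f by metis

lemma chart_image_open:
  assumes "chart M (U, \<phi>)" "subspace (model M)" "openin (mtop M) V" "V \<subseteq> U"
  shows "rel_open (model M) (\<phi> ` V)"
proof -
  have "openin (subtopology (mtop M) U) V"
    using assms(3,4) by (metis inf.absorb1 openin_subtopology)
  then have "openin (top_of_set (\<phi> ` U)) (\<phi> ` V)"
    using homeomorphic_map_openness[OF chart_homeo[OF assms(1)], of V] chart_topspace[OF assms(1)] assms(4)
      openin_subset[OF assms(3)] by simp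
  then show ?thesis using chart_rel_open[OF assms(1,2)] openin_trans unfolding rel_open_def by blast
qed

lemma chart_inverse_continuous:
  assumes "chart M (U, \<phi>)"
  shows "continuous_map (top_of_set (\<phi> ` U)) (mtop M) (inv_into U \<phi>)"
proof -
  obtain g where g: "homeomorphic_maps (subtopology (mtop M) U) (top_of_set (\<phi> ` U)) \<phi> g"
    using chart_homeo[OF assms] homeomorphic_map_maps by blast
  then have "continuous_map (top_of_set (\<phi> ` U)) (subtopology (mtop M) U) g"
    and gx: "\<And>x. x \<in> U \<Longrightarrow> g (\<phi> x) = x"
    unfolding homeomorphic_maps_def chart_topspace[OF assms] by auto
  then have "continuous_map (top_of_set (\<phi> ` U)) (mtop M) g" by (simp add: continuous_map_in_subtopology)
  then show ?thesis
    by (rule continuous_map_eq) (auto simp: gx chart_inv[OF assms])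
qed

lemma chart_preimage_open:
  assumes "chart M (U, \<phi>)" "subspace (model M)" "rel_open (model M) A"
  shows "openin (mtop M) (U \<inter> \<phi> -` A)"
proof -
  have c: "continuous_map (subtopology (mtop M) U) (top_of_set (\<phi> ` U)) \<phi>"
    using chart_homeo[OF assms(1)] homeomorphic_imp_continuous_map by blast
  have sub: "\<phi> ` U \<subseteq> model M" using chart_rel_open[OF assms(1,2)] rel_open_subset by blast
  obtain T where T: "open T" "A = model M \<inter> T" using assms(3) unfolding rel_open_def openin_open by blast
  have "openin (top_of_set (\<phi> ` U)) (\<phi> ` U \<inter> T)" using T(1) by auto
  from openin_continuous_map_preimage[OF c this]
  have "openin (subtopology (mtop M) U) {x \<in> U. \<phi> x \<in> \<phi> ` U \<inter> T}"
    unfolding chart_topspace[OF assms(1)] .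
  moreover have "{x \<in> U. \<phi> x \<in> \<phi> ` U \<inter> T} = U \<inter> \<phi> -` A" using T sub by auto
  ultimately show ?thesis using chart_openin[OF assms(1)] openin_trans_full by metis
qed

lemma maximal_chart: "c \<in> maximal_atlas M \<Longrightarrow> chart M c"
  unfolding maximal_atlas_def by simp

lemma atlas_subset_maximal: "smooth_manifold M \<Longrightarrow> atlas M \<subseteq> maximal_atlas M"
  unfolding smooth_manifold_def maximal_atlas_def by blast

lemma atlas_cover:
  assumes "smooth_manifold M" "x \<in> points M"
  obtains U \<phi> where "(U, \<phi>) \<in> atlas M" "x \<in> U"
proof -
  have "x \<in> \<Union>(fst ` atlas M)" using assms unfolding smooth_manifold_def by blast
  then show ?thesis using that by fastforce
qed

lemma continuous_preimage_open:
  assumes "continuous_map (mtop M) (mtop N) f" "openin (mtop M) U" "openin (mtop N) V"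
  shows "openin (mtop M) (U \<inter> f -` V)"
proof -
  have "U \<inter> f -` V = U \<inter> {x \<in> topspace (mtop M). f x \<in> V}"
    using openin_subset[OF assms(2)] by auto
  then show ?thesis using openin_Int[OF assms(2) openin_continuous_map_preimage[OF assms(1,3)]] by simp
qed

section \<open>Smoothness in charts of the maximal atlas\<close>

text \<open>On the overlap the expression in the first pair of charts is the one in the second pair,
  preceded and followed by a transition map.\<close>

lemma smooth_on_change_charts:
  fixes M :: "('p, 'e::euclidean_space) manifold" and N :: "('q, 'f::euclidean_space) manifold"
  assumes "chart M (U, \<phi>)" "chart M (U0, \<phi>0)" "chart N (V, \<psi>)" "chart N (V0, \<psi>0)"
    "smooth_transition (U, \<phi>) (U0, \<phi>0)" "smooth_transition (V0, \<psi>0) (V, \<psi>)"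
    "smooth_on (\<phi>0 ` (U0 \<inter> f -` V0)) (\<lambda>a. \<psi>0 (f (inv_into U0 \<phi>0 a)))"
  shows "smooth_on (\<phi> ` (U \<inter> U0 \<inter> f -` (V \<inter> V0))) (\<lambda>a. \<psi> (f (inv_into U \<phi> a)))"
proof -
  let ?O = "U \<inter> U0 \<inter> f -` (V \<inter> V0)"
  have 1: "smooth_on (\<phi> ` ?O) (\<lambda>a. \<phi>0 (inv_into U \<phi> a))"
    using assms(5) unfolding smooth_transition_def by (auto simp: o_def elim: smooth_on_subset)
  have 2: "smooth_on (\<phi> ` ?O) (\<lambda>a. \<psi>0 (f (inv_into U0 \<phi>0 (\<phi>0 (inv_into U \<phi> a)))))"
    by (rule smooth_on_compose[OF assms(7) 1]) (auto simp: chart_inv[OF assms(1)])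
  have "smooth_on (\<psi>0 ` (V0 \<inter> V)) (\<lambda>b. \<psi> (inv_into V0 \<psi>0 b))"
    using assms(6) unfolding smooth_transition_def by (simp add: o_def)
  moreover have "(\<lambda>a. \<psi>0 (f (inv_into U0 \<phi>0 (\<phi>0 (inv_into U \<phi> a))))) ` \<phi> ` ?O \<subseteq> \<psi>0 ` (V0 \<inter> V)"
    by (auto simp: chart_inv[OF assms(1)] chart_inv[OF assms(2)])
  ultimately have "smooth_on (\<phi> ` ?O) (\<lambda>a. \<psi> (inv_into V0 \<psi>0 (\<psi>0 (f (inv_into U0 \<phi>0 (\<phi>0 (inv_into U \<phi> a)))))))"
    by (rule smooth_on_compose[OF _ 2])
  then show ?thesis
    by (rule smooth_on_cong) (auto simp: chart_inv[OF assms(1)] chart_inv[OF assms(2)] chart_inv[OF assms(4)])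
qed

lemma smooth_map_atlas:
  "smooth_map M N f \<Longrightarrow> (U, \<phi>) \<in> atlas M \<Longrightarrow> (V, \<psi>) \<in> atlas N \<Longrightarrow>
    smooth_on (\<phi> ` (U \<inter> f -` V)) (\<lambda>a. \<psi> (f (inv_into U \<phi> a)))"
  by (auto simp: smooth_map_def o_def)

text \<open>The common core of two passages: from atlas charts to maximal charts, and from one
  suitable pair of charts at each point to all atlas charts.\<close>

lemma smooth_in_chart_local:
  assumes M: "smooth_manifold M" and fc: "continuous_map (mtop M) (mtop N) f" and cc: "chart M (U, \<phi>)" and dc: "chart N (V, \<psi>)"
    and loc: "\<And>x. x \<in> U \<Longrightarrow> f x \<in> V \<Longrightarrow> \<exists>U0 \<phi>0 V0 \<psi>0. x \<in> U0 \<and> f x \<in> V0 \<and> chart M (U0, \<phi>0) \<and> chart N (V0, \<psi>0) \<and>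
      smooth_transition (U, \<phi>) (U0, \<phi>0) \<and> smooth_transition (V0, \<psi>0) (V, \<psi>) \<and>
      smooth_on (\<phi>0 ` (U0 \<inter> f -` V0)) (\<lambda>a. \<psi>0 (f (inv_into U0 \<phi>0 a)))"
  shows "rel_open (model M) (\<phi> ` (U \<inter> f -` V))" "smooth_on (\<phi> ` (U \<inter> f -` V)) (\<lambda>a. \<psi> (f (inv_into U \<phi> a)))"
proof -
  note E = smooth_manifold_subspace[OF M]
  show ro: "rel_open (model M) (\<phi> ` (U \<inter> f -` V))"
    by (rule chart_image_open[OF cc E continuous_preimage_open[OF fc chart_openin[OF cc] chart_openin[OF dc]]]) blast
  show "smooth_on (\<phi> ` (U \<inter> f -` V)) (\<lambda>a. \<psi> (f (inv_into U \<phi> a)))"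
  proof (rule smooth_on_local[OF ro])
    fix a assume "a \<in> \<phi> ` (U \<inter> f -` V)"
    then obtain x where x: "x \<in> U" "f x \<in> V" "a = \<phi> x" by auto
    obtain U0 \<phi>0 V0 \<psi>0 where x0: "x \<in> U0" "f x \<in> V0" and c0: "chart M (U0, \<phi>0)" and d0: "chart N (V0, \<psi>0)"
      and t: "smooth_transition (U, \<phi>) (U0, \<phi>0)" "smooth_transition (V0, \<psi>0) (V, \<psi>)"
      and sm: "smooth_on (\<phi>0 ` (U0 \<inter> f -` V0)) (\<lambda>a. \<psi>0 (f (inv_into U0 \<phi>0 a)))"
      using loc[OF x(1,2)] by (elim exE conjE)
    let ?O = "U \<inter> U0 \<inter> f -` (V \<inter> V0)"
    have "openin (mtop M) ?O"
      by (intro continuous_preimage_open[OF fc] openin_Int chart_openin[OF cc] chart_openin[OF c0]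
          chart_openin[OF dc] chart_openin[OF d0])
    then have "rel_open (model M) (\<phi> ` ?O)" by (rule chart_image_open[OF cc E]) blast
    then show "\<exists>T. rel_open (model M) T \<and> a \<in> T \<and> T \<subseteq> \<phi> ` (U \<inter> f -` V) \<and>
        smooth_on T (\<lambda>a. \<psi> (f (inv_into U \<phi> a)))"
      using smooth_on_change_charts[OF cc c0 dc d0 t sm] x x0 by (intro exI[of _ "\<phi> ` ?O"]) auto
  qed
qed

text \<open>Slice charts belong to the maximal atlas but in general not to the given one, so
  smoothness must be available there.\<close>

lemma smooth_map_maximal:
  assumes M: "smooth_manifold M" and N: "smooth_manifold N" and f: "smooth_map M N f"
    and c: "(U, \<phi>) \<in> maximal_atlas M" and d: "(V, \<psi>) \<in> maximal_atlas N"
  shows "rel_open (model M) (\<phi> ` (U \<inter> f -` V))" "smooth_on (\<phi> ` (U \<inter> f -` V)) (\<lambda>a. \<psi> (f (inv_into U \<phi> a)))"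
proof -
  have fc: "continuous_map (mtop M) (mtop N) f" using f unfolding smooth_map_def by blast
  note cc = maximal_chart[OF c] and dc = maximal_chart[OF d]
  have loc: "\<exists>U0 \<phi>0 V0 \<psi>0. x \<in> U0 \<and> f x \<in> V0 \<and> chart M (U0, \<phi>0) \<and> chart N (V0, \<psi>0) \<and>
      smooth_transition (U, \<phi>) (U0, \<phi>0) \<and> smooth_transition (V0, \<psi>0) (V, \<psi>) \<and>
      smooth_on (\<phi>0 ` (U0 \<inter> f -` V0)) (\<lambda>a. \<psi>0 (f (inv_into U0 \<phi>0 a)))" if x: "x \<in> U" "f x \<in> V" for x
  proof -
    obtain U0 \<phi>0 where c0: "(U0, \<phi>0) \<in> atlas M" "x \<in> U0" by (rule atlas_cover[OF M subsetD[OF chart_subset[OF cc] x(1)]])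
    obtain V0 \<psi>0 where d0: "(V0, \<psi>0) \<in> atlas N" "f x \<in> V0" by (rule atlas_cover[OF N subsetD[OF chart_subset[OF dc] x(2)]])
    show ?thesis
    proof (intro exI conjI)
      show "smooth_transition (U, \<phi>) (U0, \<phi>0)" "smooth_transition (V0, \<psi>0) (V, \<psi>)"
        using c d c0(1) d0(1) by (auto simp: maximal_atlas_def)
      show "chart M (U0, \<phi>0)" "chart N (V0, \<psi>0)"
        using M N c0(1) d0(1) by (auto simp: smooth_manifold_def)
    qed (rule c0 d0 smooth_map_atlas[OF f c0(1) d0(1)])+
  qed
  show "rel_open (model M) (\<phi> ` (U \<inter> f -` V))" "smooth_on (\<phi> ` (U \<inter> f -` V)) (\<lambda>a. \<psi> (f (inv_into U \<phi> a)))"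
    by (rule smooth_in_chart_local[OF M fc cc dc loc]; assumption)+
qed

lemma smooth_map_id: "smooth_manifold M \<Longrightarrow> smooth_map M M (\<lambda>x. x)"
  unfolding smooth_map_def smooth_manifold_def smooth_transition_def by (fastforce simp: o_def)

text \<open>A transition map is the identity of the manifold read in two charts.\<close>

lemma transition_smooth:
  assumes "smooth_manifold M" "(U, \<phi>) \<in> maximal_atlas M" "(V, \<psi>) \<in> maximal_atlas M"
  shows "rel_open (model M) (\<phi> ` (U \<inter> V))" "smooth_on (\<phi> ` (U \<inter> V)) (\<lambda>a. \<psi> (inv_into U \<phi> a))"
  using smooth_map_maximal[OF assms(1,1) smooth_map_id[OF assms(1)] assms(2,3)] by (auto simp: vimage_def)

lemma smooth_transition_maximal:
  assumes "smooth_manifold M" "c \<in> maximal_atlas M" "d \<in> maximal_atlas M"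
  shows "smooth_transition c d"
  using transition_smooth(2)[OF assms(1), of "fst c" "snd c" "fst d" "snd d"] assms(2,3)
  unfolding smooth_transition_def by (auto simp: o_def split: prod.splits)

lemma smooth_mapI:
  assumes M: "smooth_manifold M" and N: "smooth_manifold N" and fc: "continuous_map (mtop M) (mtop N) f"
    and loc: "\<And>x. x \<in> points M \<Longrightarrow> \<exists>U \<phi> V \<psi>. (U, \<phi>) \<in> maximal_atlas M \<and> (V, \<psi>) \<in> maximal_atlas N \<and> x \<in> U \<and> f x \<in> V \<and>
      smooth_on (\<phi> ` (U \<inter> f -` V)) (\<lambda>a. \<psi> (f (inv_into U \<phi> a)))"
  shows "smooth_map M N f"
  unfolding smooth_map_def
proof (intro conjI fc, safe)
  fix U \<phi> V \<psi> assume "(U, \<phi>) \<in> atlas M" "(V, \<psi>) \<in> atlas N"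
  then have cm: "(U, \<phi>) \<in> maximal_atlas M" and dm: "(V, \<psi>) \<in> maximal_atlas N"
    using atlas_subset_maximal[OF M] atlas_subset_maximal[OF N] by blast+
  note cc = maximal_chart[OF cm] and dc = maximal_chart[OF dm]
  have "smooth_on (\<phi> ` (U \<inter> f -` V)) (\<lambda>a. \<psi> (f (inv_into U \<phi> a)))"
  proof (rule smooth_in_chart_local(2)[OF M fc cc dc])
    fix x assume x: "x \<in> U"
    obtain U0 \<phi>0 V0 \<psi>0 where c0: "(U0, \<phi>0) \<in> maximal_atlas M" "x \<in> U0" and d0: "(V0, \<psi>0) \<in> maximal_atlas N" "f x \<in> V0"
      and sm: "smooth_on (\<phi>0 ` (U0 \<inter> f -` V0)) (\<lambda>a. \<psi>0 (f (inv_into U0 \<phi>0 a)))"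
      using loc[OF subsetD[OF chart_subset[OF cc] x]] by (elim exE conjE)
    show "\<exists>U0 \<phi>0 V0 \<psi>0. x \<in> U0 \<and> f x \<in> V0 \<and> chart M (U0, \<phi>0) \<and> chart N (V0, \<psi>0) \<and>
        smooth_transition (U, \<phi>) (U0, \<phi>0) \<and> smooth_transition (V0, \<psi>0) (V, \<psi>) \<and>
        smooth_on (\<phi>0 ` (U0 \<inter> f -` V0)) (\<lambda>a. \<psi>0 (f (inv_into U0 \<phi>0 a)))"
      by (intro exI conjI) (rule c0 d0 sm maximal_chart smooth_transition_maximal[OF M cm c0(1)]
          smooth_transition_maximal[OF N d0(1) dm])+
  qed
  then show "smooth_on (\<phi> ` (U \<inter> f -` V)) (\<psi> \<circ> f \<circ> inv_into U \<phi>)" by (simp add: o_def)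
qed

lemma chart_at_atlas:
  assumes "smooth_manifold M" "x \<in> points M" "chart_at M x = (U, \<phi>)"
  shows "(U, \<phi>) \<in> atlas M" "x \<in> U"
proof -
  obtain V \<psi> where "(V, \<psi>) \<in> atlas M" "x \<in> V" by (rule atlas_cover[OF assms(1,2)])
  then have "\<exists>c. c \<in> atlas M \<and> x \<in> fst c" by (intro exI[of _ "(V, \<psi>)"]) simp
  from someI_ex[OF this] show "(U, \<phi>) \<in> atlas M" "x \<in> U"
    using assms(3) unfolding chart_at_def by auto
qed

text \<open>
  The coordinates in an arbitrary chart of a tangent vector, which itself is stored by its
  coordinates in \<open>chart_at M x\<close>.
\<close>

definition coord :: "('p, 'e::euclidean_space) manifold \<Rightarrow> 'p set \<times> ('p \<Rightarrow> 'e) \<Rightarrow> 'p \<Rightarrow> 'e \<Rightarrow> 'e" where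
  "coord M = (\<lambda>(U, \<phi>) x v. let (U0, \<phi>0) = chart_at M x in
     fderiv (\<lambda>a. \<phi> (inv_into U0 \<phi>0 a)) (\<phi>0 ` (U0 \<inter> U)) (\<phi>0 x) v)"

text \<open>The chain rule for two factorizations of one coordinate expression, carried out on the
  common domain \<open>O'\<close> and then extended to the natural domains.\<close>

lemma fderiv_change_charts:
  fixes M :: "('p, 'e::euclidean_space) manifold" and N :: "('q, 'f::euclidean_space) manifold"
  assumes M: "smooth_manifold M" and N: "smooth_manifold N" and f: "smooth_map M N f"
    and c: "(U, \<phi>) \<in> maximal_atlas M" "(U0, \<phi>0) \<in> maximal_atlas M"
    and d: "(V, \<psi>) \<in> maximal_atlas N" "(V0, \<psi>0) \<in> maximal_atlas N"
    and x: "x \<in> U" "x \<in> U0" "f x \<in> V" "f x \<in> V0" and v: "v \<in> model M"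
  shows "fderiv (\<lambda>b. \<psi> (inv_into V0 \<psi>0 b)) (\<psi>0 ` (V0 \<inter> V)) (\<psi>0 (f x))
           (fderiv (\<lambda>a. \<psi>0 (f (inv_into U0 \<phi>0 a))) (\<phi>0 ` (U0 \<inter> f -` V0)) (\<phi>0 x) v) =
         fderiv (\<lambda>a. \<psi> (f (inv_into U \<phi> a))) (\<phi> ` (U \<inter> f -` V)) (\<phi> x)
           (fderiv (\<lambda>a. \<phi> (inv_into U0 \<phi>0 a)) (\<phi>0 ` (U0 \<inter> U)) (\<phi>0 x) v)"
proof -
  note E = smooth_manifold_subspace[OF M]
  have fc: "continuous_map (mtop M) (mtop N) f" using f unfolding smooth_map_def by blast
  note ch = maximal_chart[OF c(1)] maximal_chart[OF c(2)] maximal_chart[OF d(1)] maximal_chart[OF d(2)]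
  note ci = chart_inv[OF ch(1)] chart_inv[OF ch(2)] chart_inv[OF ch(3)] chart_inv[OF ch(4)]
  define O' where "O' = \<phi>0 ` (U0 \<inter> U \<inter> f -` (V0 \<inter> V))"
  have "openin (mtop M) (U0 \<inter> U \<inter> f -` (V0 \<inter> V))"
    by (intro continuous_preimage_open[OF fc] openin_Int ch[THEN chart_openin])
  then have O': "rel_open (model M) O'" unfolding O'_def by (rule chart_image_open[OF ch(2) E]) blast
  have xO: "\<phi>0 x \<in> O'" using x by (auto simp: O'_def)
  note t1 = transition_smooth[OF M c(2,1)] and t2 = transition_smooth[OF N d(2,1)]
  note f0 = smooth_map_maximal[OF M N f c(2) d(2)] and f1 = smooth_map_maximal[OF M N f c(1) d(1)]
  have s0: "smooth_on O' (\<lambda>a. \<psi>0 (f (inv_into U0 \<phi>0 a)))"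
    by (rule smooth_on_subset[OF f0(2)]) (auto simp: O'_def)
  have s1: "smooth_on O' (\<lambda>a. \<phi> (inv_into U0 \<phi>0 a))"
    by (rule smooth_on_subset[OF t1(2)]) (auto simp: O'_def)
  have im0: "(\<lambda>a. \<psi>0 (f (inv_into U0 \<phi>0 a))) ` O' \<subseteq> \<psi>0 ` (V0 \<inter> V)"
    and im1: "(\<lambda>a. \<phi> (inv_into U0 \<phi>0 a)) ` O' \<subseteq> \<phi> ` (U \<inter> f -` V)"
    by (auto simp: O'_def ci)
  have e0: "fderiv (\<lambda>a. \<psi>0 (f (inv_into U0 \<phi>0 a))) (\<phi>0 ` (U0 \<inter> f -` V0)) (\<phi>0 x) = fderiv (\<lambda>a. \<psi>0 (f (inv_into U0 \<phi>0 a))) O' (\<phi>0 x)"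
    by (rule fderiv_rel_cong[OF f0(1) O' O' _ _ xO]) (auto simp: O'_def)
  have e1: "fderiv (\<lambda>a. \<phi> (inv_into U0 \<phi>0 a)) (\<phi>0 ` (U0 \<inter> U)) (\<phi>0 x) = fderiv (\<lambda>a. \<phi> (inv_into U0 \<phi>0 a)) O' (\<phi>0 x)"
    by (rule fderiv_rel_cong[OF t1(1) O' O' _ _ xO]) (auto simp: O'_def)
  have "fderiv (\<lambda>b. \<psi> (inv_into V0 \<psi>0 b)) (\<psi>0 ` (V0 \<inter> V)) (\<psi>0 (f x))
           (fderiv (\<lambda>a. \<psi>0 (f (inv_into U0 \<phi>0 a))) O' (\<phi>0 x) v)
     = fderiv (\<lambda>a. \<psi> (inv_into V0 \<psi>0 (\<psi>0 (f (inv_into U0 \<phi>0 a))))) O' (\<phi>0 x) v"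
    using fderiv_compose[OF O' s0 t2(2) im0 xO v] ci(2)[OF x(2)] by simp
  also have "\<dots> = fderiv (\<lambda>a. \<psi> (f (inv_into U \<phi> (\<phi> (inv_into U0 \<phi>0 a))))) O' (\<phi>0 x) v"
    by (rule arg_cong[of _ _ "\<lambda>F. F v"], rule fderiv_rel_cong[OF O' O' O' _ _ xO]) (auto simp: O'_def ci)
  also have "\<dots> = fderiv (\<lambda>a. \<psi> (f (inv_into U \<phi> a))) (\<phi> ` (U \<inter> f -` V)) (\<phi> x) (fderiv (\<lambda>a. \<phi> (inv_into U0 \<phi>0 a)) O' (\<phi>0 x) v)"
    using fderiv_compose[OF O' s1 f1(2) im1 xO v] ci(2)[OF x(2)] by simp
  finally show ?thesis unfolding e0 e1 .
qed

lemma chart_self_transition: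
  assumes "chart M (U, \<phi>)" "subspace (model M)" "x \<in> U" "v \<in> model M"
  shows "fderiv (\<lambda>a. \<phi> (inv_into U \<phi> a)) (\<phi> ` U) (\<phi> x) v = v"
proof -
  note ro = chart_rel_open[OF assms(1,2)]
  have x: "\<phi> x \<in> \<phi> ` U" using assms(3) by blast
  have "fderiv (\<lambda>a. \<phi> (inv_into U \<phi> a)) (\<phi> ` U) (\<phi> x) = fderiv (\<lambda>a. a) (\<phi> ` U) (\<phi> x)"
    by (rule fderiv_rel_cong[OF ro ro ro order_refl order_refl x]) (auto simp: chart_inv[OF assms(1)])
  then show ?thesis using fderiv_id[OF ro x assms(4)] by simp
qed

text \<open>\<open>tmap\<close> differentiates within the whole chart image, although the expression
  is meaningful only where \<open>f\<close> stays in the target chart; near the point both domains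
  are the same.\<close>

lemma tmap_chart_at:
  assumes M: "smooth_manifold M" and N: "smooth_manifold N" and f: "smooth_map M N f" and x: "x \<in> points M"
    and ca: "chart_at M x = (U0, \<phi>0)" "chart_at N (f x) = (V0, \<psi>0)"
  shows "tmap M N f x v = fderiv (\<lambda>a. \<psi>0 (f (inv_into U0 \<phi>0 a))) (\<phi>0 ` (U0 \<inter> f -` V0)) (\<phi>0 x) v"
    and "v \<in> model M \<Longrightarrow> tmap M N f x v \<in> model N"
proof -
  have fx: "f x \<in> points N" using f x unfolding smooth_map_def points_def continuous_map_def by blast
  have c0: "(U0, \<phi>0) \<in> maximal_atlas M" "x \<in> U0" and d0: "(V0, \<psi>0) \<in> maximal_atlas N" "f x \<in> V0"
    using chart_at_atlas[OF M x ca(1)] chart_at_atlas[OF N fx ca(2)] atlas_subset_maximal[OF M] atlas_subset_maximal[OF N] by blast+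
  note f0 = smooth_map_maximal[OF M N f c0(1) d0(1)]
  have x0: "\<phi>0 x \<in> \<phi>0 ` (U0 \<inter> f -` V0)" using c0 d0 by blast
  have "tmap M N f x v = fderiv (\<lambda>a. \<psi>0 (f (inv_into U0 \<phi>0 a))) (\<phi>0 ` U0) (\<phi>0 x) v"
    unfolding tmap_def ca by (simp add: o_def)
  also have "\<dots> = fderiv (\<lambda>a. \<psi>0 (f (inv_into U0 \<phi>0 a))) (\<phi>0 ` (U0 \<inter> f -` V0)) (\<phi>0 x) v"
    by (rule arg_cong[of _ _ "\<lambda>F. F v"],
        rule fderiv_rel_cong[OF chart_rel_open[OF maximal_chart[OF c0(1)] smooth_manifold_subspace[OF M]] f0(1) f0(1) _ _ x0]) auto
  finally show t: "tmap M N f x v = fderiv (\<lambda>a. \<psi>0 (f (inv_into U0 \<phi>0 a))) (\<phi>0 ` (U0 \<inter> f -` V0)) (\<phi>0 x) v" .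
  assume v: "v \<in> model M"
  have sub: "\<psi>0 ` V0 \<subseteq> model N"
    using chart_rel_open[OF maximal_chart[OF d0(1)] smooth_manifold_subspace[OF N]] rel_open_subset by blast
  show "tmap M N f x v \<in> model N" unfolding t
  proof (rule fderiv_in[OF f0 x0 v smooth_manifold_subspace[OF N]])
    show "(\<lambda>a. \<psi>0 (f (inv_into U0 \<phi>0 a))) ` \<phi>0 ` (U0 \<inter> f -` V0) \<subseteq> model N"
      using sub by (auto simp: chart_inv[OF maximal_chart[OF c0(1)]])
  qed
qed

text \<open>Frees the tangent map from the selected charts: in any two maximal charts it is the
  derivative of the coordinate expression.\<close>

lemma coord_tmap:
  assumes M: "smooth_manifold M" and N: "smooth_manifold N" and f: "smooth_map M N f"
    and c: "(U, \<phi>) \<in> maximal_atlas M" "x \<in> U" and d: "(V, \<psi>) \<in> maximal_atlas N" "f x \<in> V" and v: "v \<in> model M"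
  shows "coord N (V, \<psi>) (f x) (tmap M N f x v) =
    fderiv (\<lambda>a. \<psi> (f (inv_into U \<phi> a))) (\<phi> ` (U \<inter> f -` V)) (\<phi> x) (coord M (U, \<phi>) x v)"
proof -
  obtain U0 \<phi>0 V0 \<psi>0 where ca: "chart_at M x = (U0, \<phi>0)" "chart_at N (f x) = (V0, \<psi>0)" by (metis surj_pair)
  have x: "x \<in> points M" using c chart_subset[OF maximal_chart] by blast
  have fx: "f x \<in> points N" using d chart_subset[OF maximal_chart] by blast
  have c0: "(U0, \<phi>0) \<in> maximal_atlas M" "x \<in> U0" and d0: "(V0, \<psi>0) \<in> maximal_atlas N" "f x \<in> V0"
    using chart_at_atlas[OF M x ca(1)] chart_at_atlas[OF N fx ca(2)] atlas_subset_maximal[OF M] atlas_subset_maximal[OF N] by blast+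
  show ?thesis
    unfolding tmap_chart_at(1)[OF M N f x ca] coord_def prod.case ca Let_def
    by (rule fderiv_change_charts[OF M N f c(1) c0(1) d(1) d0(1) c(2) c0(2) d(2) d0(2) v])
qed

lemma coord_apply:
  "coord M (V, \<psi>) x = fderiv (\<lambda>a. \<psi> (inv_into (fst (chart_at M x)) (snd (chart_at M x)) a))
    (snd (chart_at M x) ` (fst (chart_at M x) \<inter> V)) (snd (chart_at M x) x)"
  by (auto simp: coord_def Let_def split: prod.splits)

lemma chart_at_maximal:
  assumes M: "smooth_manifold M" and c: "(U, \<phi>) \<in> maximal_atlas M" "x \<in> U"
  shows "(fst (chart_at M x), snd (chart_at M x)) \<in> maximal_atlas M" "x \<in> fst (chart_at M x)"
  using chart_at_atlas[OF M subsetD[OF chart_subset[OF maximal_chart[OF c(1)]] c(2)], of "fst (chart_at M x)" "snd (chart_at M x)"]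
    atlas_subset_maximal[OF M] by auto

text \<open>The identity map in \<open>fderiv_change_charts\<close>, starting from the selected
  chart, whose transition to itself has the identity as derivative.\<close>

lemma coord_transition:
  fixes M :: "('p, 'e::euclidean_space) manifold"
  assumes M: "smooth_manifold M" and c: "(U, \<phi>) \<in> maximal_atlas M" "x \<in> U"
    and d: "(V, \<psi>) \<in> maximal_atlas M" "x \<in> V" and v: "v \<in> model M"
  shows "coord M (V, \<psi>) x v = fderiv (\<lambda>a. \<psi> (inv_into U \<phi> a)) (\<phi> ` (U \<inter> V)) (\<phi> x) (coord M (U, \<phi>) x v)"
proof -
  note c0 = chart_at_maximal[OF M c]
  have "X \<inter> (\<lambda>x. x) -` Y = X \<inter> Y" for X Y :: "'p set" by auto
  then show ?thesis
    using fderiv_change_charts[OF M M smooth_map_id[OF M] c(1) c0(1) d(1) c0(1) c(2) c0(2) d(2) c0(2) v]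
      chart_self_transition[OF maximal_chart[OF c0(1)] smooth_manifold_subspace[OF M] c0(2) v]
    unfolding coord_apply by simp
qed

lemma coord_in:
  assumes M: "smooth_manifold M" and c: "(U, \<phi>) \<in> maximal_atlas M" "x \<in> U" and v: "v \<in> model M"
  shows "coord M (U, \<phi>) x v \<in> model M"
proof -
  note c0 = chart_at_maximal[OF M c]
  have sub: "\<phi> ` U \<subseteq> model M"
    using chart_rel_open[OF maximal_chart[OF c(1)] smooth_manifold_subspace[OF M]] rel_open_subset by blast
  show ?thesis unfolding coord_apply
    by (rule fderiv_in[OF transition_smooth[OF M c0(1) c(1)] _ v smooth_manifold_subspace[OF M]])
      (use c c0 sub in \<open>auto simp: chart_inv[OF maximal_chart[OF c0(1)]]\<close>)
qed

lemma linear_coord: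
  assumes M: "smooth_manifold M" and c: "(U, \<phi>) \<in> maximal_atlas M" "x \<in> U"
  shows "linear (coord M (U, \<phi>) x)"
proof -
  note c0 = chart_at_maximal[OF M c]
  show ?thesis unfolding coord_apply by (rule linear_fderiv[OF transition_smooth(2)[OF M c0(1) c(1)]]) (use c c0 in auto)
qed

text \<open>Passing back to the selected chart recovers the vector, hence injectivity; surjectivity
  follows by dimension.\<close>

lemma coord_bij:
  assumes M: "smooth_manifold M" and c: "(U, \<phi>) \<in> maximal_atlas M" "x \<in> U"
  shows "bij_betw (coord M (U, \<phi>) x) (model M) (model M)"
proof -
  note E = smooth_manifold_subspace[OF M]
  note c0 = chart_at_maximal[OF M c]
  have id: "coord M (fst (chart_at M x), snd (chart_at M x)) x v = v" if v: "v \<in> model M" for v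
    using chart_self_transition[OF maximal_chart[OF c0(1)] E c0(2) v] unfolding coord_apply by simp
  have inj: "inj_on (coord M (U, \<phi>) x) (model M)"
  proof (rule inj_onI)
    fix v w assume vw: "v \<in> model M" "w \<in> model M" "coord M (U, \<phi>) x v = coord M (U, \<phi>) x w"
    then have "coord M (fst (chart_at M x), snd (chart_at M x)) x v = coord M (fst (chart_at M x), snd (chart_at M x)) x w"
      using coord_transition[OF M c c0] by metis
    then show "v = w" using id vw by metis
  qed
  moreover have "coord M (U, \<phi>) x ` model M \<subseteq> model M" using coord_in[OF M c] by blast
  moreover have "dim (coord M (U, \<phi>) x ` model M) = dim (model M)"
    by (rule dim_image_eq[OF linear_coord[OF M c]]) (simp add: span_eq_iff[THEN iffD2, OF E] inj)
  ultimately have "coord M (U, \<phi>) x ` model M = model M"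
    using subspace_dim_equal[OF linear_subspace_image[OF linear_coord[OF M c] E] E] by simp
  then show ?thesis using inj by (simp add: bij_betw_def)
qed

lemma coord_eqD:
  assumes "smooth_manifold M" "(U, \<phi>) \<in> maximal_atlas M" "x \<in> U" "v \<in> model M" "w \<in> model M"
    "coord M (U, \<phi>) x v = coord M (U, \<phi>) x w"
  shows "v = w"
  using coord_bij[OF assms(1-3)] assms(4-6) by (auto simp: bij_betw_def dest: inj_onD)

lemma coord_surj:
  assumes "smooth_manifold M" "(U, \<phi>) \<in> maximal_atlas M" "x \<in> U" "w \<in> model M"
  obtains v where "v \<in> model M" "coord M (U, \<phi>) x v = w"
  using coord_bij[OF assms(1-3)] assms(4) that by (metis bij_betw_imp_surj_on imageE)

lemma tmap_in:
  assumes "smooth_manifold M" "smooth_manifold N" "smooth_map M N f" "x \<in> points M" "v \<in> model M"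
  shows "tmap M N f x v \<in> model N"
  using tmap_chart_at(2)[OF assms(1-4) surjective_pairing surjective_pairing assms(5)] .

section \<open>Open pieces of a subspace as manifolds\<close>

lemma flat_simps [simp]: "mtop (flat F W) = top_of_set W" "model (flat F W) = F" "atlas (flat F W) = {(W, id)}"
  "points (flat F W) = W"
  by (simp_all add: flat_def points_def)

lemma flat_smooth_manifold:
  assumes "rel_open F W"
  shows "smooth_manifold (flat F W)"
proof -
  have "chart (flat F W) (W, id)"
    using assms unfolding chart_def rel_open_def by (auto simp: subtopology_subtopology)
  moreover have "smooth_transition (W, id :: 'a \<Rightarrow> 'a) (W, id)"
  proof -
    have "smooth_on W (id \<circ> inv_into W (id :: 'a \<Rightarrow> 'a))"
      by (rule smooth_on_cong[OF smooth_on_id]) (metis comp_apply id_apply image_id inv_into_f_f inj_on_id)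
    then show ?thesis by (simp add: smooth_transition_def)
  qed
  moreover have "second_countable (euclidean :: 'a topology)"
  proof -
    obtain B :: "'a set set" where "countable B" "topological_basis B" using ex_countable_basis by blast
    then show ?thesis
      unfolding second_countable_def
      using topological_basis_open topological_basisE by (metis open_openin)
  qed
  ultimately show ?thesis
    using assms unfolding smooth_manifold_def rel_open_def by (auto simp: Hausdorff_space_subtopology second_countable_subtopology)
qed

lemma flat_chart:
  assumes "rel_open F W"
  shows "(W, id) \<in> maximal_atlas (flat F W)"
  using atlas_subset_maximal[OF flat_smooth_manifold[OF assms]] by auto

lemma coord_flat:
  assumes "rel_open F W" "x \<in> W" "v \<in> F"
  shows "coord (flat F W) (W, id) x v = v"
proof -
  have "chart_at (flat F W) x = (W, id)" unfolding chart_at_def using assms(2) by (auto intro: some_equality)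
  then have "coord (flat F W) (W, id) x v = fderiv (\<lambda>a. id (inv_into W id a)) W x v"
    by (simp add: coord_def)
  also have "\<dots> = fderiv (\<lambda>a. a) W x v"
    by (rule arg_cong[of _ _ "\<lambda>F. F v"], rule fderiv_rel_cong[OF assms(1,1,1) _ _ assms(2)])
      (auto simp: inv_into_f_f[OF inj_on_id, simplified])
  finally show ?thesis using fderiv_id[OF assms] by simp
qed

section \<open>Two-forms and Hamiltonian curves in charts\<close>

lemma rel_open_UNIV_UNIV: "rel_open UNIV UNIV"
  by (simp add: rel_open_UNIV)

lemma inv_into_id: "a \<in> W \<Longrightarrow> inv_into W id a = a"
  by (metis id_apply inj_on_id inv_into_f_f)

lemma smooth_function_chart:
  assumes M: "smooth_manifold M" and H: "smooth_map M real_line H" and c: "(U, \<phi>) \<in> maximal_atlas M"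
  shows "smooth_on (\<phi> ` U) (\<lambda>a. H (inv_into U \<phi> a))"
  using smooth_map_maximal(2)[OF M flat_smooth_manifold[OF rel_open_UNIV_UNIV] H c flat_chart[OF rel_open_UNIV_UNIV]]
  by simp

lemma differential_chart:
  assumes M: "smooth_manifold M" and H: "smooth_map M real_line H" and c: "(U, \<phi>) \<in> maximal_atlas M" "x \<in> U"
    and v: "v \<in> model M"
  shows "differential M H x v = fderiv (\<lambda>a. H (inv_into U \<phi> a)) (\<phi> ` U) (\<phi> x) (coord M (U, \<phi>) x v)"
  using coord_tmap[OF M flat_smooth_manifold[OF rel_open_UNIV_UNIV] H c flat_chart[OF rel_open_UNIV_UNIV] UNIV_I v]
    coord_flat[OF rel_open_UNIV_UNIV, of "H x" "differential M H x v"] by simp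

text \<open>Serves both integral parametrizations of leaves and curves: on a flat domain
  \<open>coord\<close> is the identity, so only the target chart is visible.\<close>

lemma param_chart:
  assumes M: "smooth_manifold M" and W: "rel_open F W" and \<sigma>: "smooth_map (flat F W) M \<sigma>" and c: "(U, \<phi>) \<in> maximal_atlas M"
  shows "rel_open F (W \<inter> \<sigma> -` U)" "smooth_on (W \<inter> \<sigma> -` U) (\<lambda>u. \<phi> (\<sigma> u))"
    and "u \<in> W \<Longrightarrow> \<sigma> u \<in> U \<Longrightarrow> v \<in> F \<Longrightarrow>
      coord M (U, \<phi>) (\<sigma> u) (tmap (flat F W) M \<sigma> u v) = fderiv (\<lambda>u. \<phi> (\<sigma> u)) (W \<inter> \<sigma> -` U) u v"
proof -
  note fl = flat_smooth_manifold[OF W] and fc = flat_chart[OF W]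
  note sm = smooth_map_maximal[OF fl M \<sigma> fc c]
  show ro: "rel_open F (W \<inter> \<sigma> -` U)" using sm(1) by simp
  have "smooth_on (W \<inter> \<sigma> -` U) (\<lambda>a. \<phi> (\<sigma> (inv_into W id a)))" using sm(2) by simp
  then show "smooth_on (W \<inter> \<sigma> -` U) (\<lambda>u. \<phi> (\<sigma> u))" by (rule smooth_on_cong) (simp add: inv_into_id)
  assume u: "u \<in> W" "\<sigma> u \<in> U" and v: "v \<in> F"
  have uW: "u \<in> W \<inter> \<sigma> -` U" using u by simp
  have "coord M (U, \<phi>) (\<sigma> u) (tmap (flat F W) M \<sigma> u v) = fderiv (\<lambda>a. \<phi> (\<sigma> (inv_into W id a))) (W \<inter> \<sigma> -` U) u v"
    using coord_tmap[OF fl M \<sigma> fc u(1) c u(2), of v] coord_flat[OF W u(1) v] v by simp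
  also have "\<dots> = fderiv (\<lambda>u. \<phi> (\<sigma> u)) (W \<inter> \<sigma> -` U) u v"
    by (rule arg_cong[of _ _ "\<lambda>F. F v"], rule fderiv_rel_cong[OF ro ro ro order_refl order_refl uW]) (simp add: inv_into_id)
  finally show "coord M (U, \<phi>) (\<sigma> u) (tmap (flat F W) M \<sigma> u v) = fderiv (\<lambda>u. \<phi> (\<sigma> u)) (W \<inter> \<sigma> -` U) u v" .
qed

lemma curve_chart:
  assumes M: "smooth_manifold M" and I: "open I" and \<gamma>: "smooth_map (interval_manifold I) M \<gamma>" and c: "(U, \<phi>) \<in> maximal_atlas M"
    and t: "t \<in> I" "\<gamma> t \<in> U"
  shows "velocity M I \<gamma> t \<in> model M"
    and "((\<lambda>s. \<phi> (\<gamma> s)) has_vector_derivative coord M (U, \<phi>) (\<gamma> t) (velocity M I \<gamma> t)) (at t)"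
proof -
  have ro: "rel_open UNIV I" using I by (simp add: rel_open_UNIV)
  note pc = param_chart[OF M ro \<gamma> c]
  have op: "open (I \<inter> \<gamma> -` U)" using pc(1) by (simp add: rel_open_UNIV)
  show "velocity M I \<gamma> t \<in> model M"
    unfolding velocity_def using tmap_in[OF flat_smooth_manifold[OF ro] M \<gamma>] t by simp
  have tI: "t \<in> I \<inter> \<gamma> -` U" using t by simp
  have e: "coord M (U, \<phi>) (\<gamma> t) (velocity M I \<gamma> t) = fderiv (\<lambda>s. \<phi> (\<gamma> s)) (I \<inter> \<gamma> -` U) t 1"
    unfolding velocity_def using pc(3)[OF t, of 1] by simp
  have d: "((\<lambda>s. \<phi> (\<gamma> s)) has_derivative fderiv (\<lambda>s. \<phi> (\<gamma> s)) (I \<inter> \<gamma> -` U) t) (at t)"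
    using smooth_on_has_derivative[OF pc(2) tI] at_within_open[OF tI op] by simp
  have "fderiv (\<lambda>s. \<phi> (\<gamma> s)) (I \<inter> \<gamma> -` U) t = (\<lambda>h. h *\<^sub>R fderiv (\<lambda>s. \<phi> (\<gamma> s)) (I \<inter> \<gamma> -` U) t 1)"
  proof
    fix h :: real
    show "fderiv (\<lambda>s. \<phi> (\<gamma> s)) (I \<inter> \<gamma> -` U) t h = h *\<^sub>R fderiv (\<lambda>s. \<phi> (\<gamma> s)) (I \<inter> \<gamma> -` U) t 1"
      using linear_scale[OF linear_fderiv[OF pc(2) tI], of h 1] by simp
  qed
  with d show "((\<lambda>s. \<phi> (\<gamma> s)) has_vector_derivative coord M (U, \<phi>) (\<gamma> t) (velocity M I \<gamma> t)) (at t)"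
    unfolding has_vector_derivative_def e by simp
qed

lemma smooth_map_chart_inverse:
  assumes M: "smooth_manifold M" and c: "(U, \<phi>) \<in> maximal_atlas M"
  shows "smooth_map (flat (model M) (\<phi> ` U)) M (inv_into U \<phi>)"
proof (rule smooth_mapI)
  note ch = maximal_chart[OF c]
  note ro = chart_rel_open[OF ch smooth_manifold_subspace[OF M]]
  show "smooth_manifold (flat (model M) (\<phi> ` U))" by (rule flat_smooth_manifold[OF ro])
  show "continuous_map (mtop (flat (model M) (\<phi> ` U))) (mtop M) (inv_into U \<phi>)"
    using chart_inverse_continuous[OF ch] by simp
  fix a assume "a \<in> points (flat (model M) (\<phi> ` U))"
  then have "inv_into U \<phi> a \<in> U" and a: "a \<in> \<phi> ` U" by (auto simp: chart_inv[OF ch])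
  moreover have "smooth_on (id ` (\<phi> ` U \<inter> inv_into U \<phi> -` U)) (\<lambda>a. \<phi> (inv_into U \<phi> (inv_into (\<phi> ` U) id a)))"
    by (rule smooth_on_cong[OF smooth_on_id]) (auto simp: inv_into_id chart_inv[OF ch])
  ultimately show "\<exists>V \<psi> V' \<psi>'. (V, \<psi>) \<in> maximal_atlas (flat (model M) (\<phi> ` U)) \<and> (V', \<psi>') \<in> maximal_atlas M \<and> a \<in> V \<and>
      inv_into U \<phi> a \<in> V' \<and> smooth_on (\<psi> ` (V \<inter> inv_into U \<phi> -` V')) (\<lambda>a. \<psi>' (inv_into U \<phi> (inv_into V \<psi> a)))"
    using flat_chart[OF ro] c by blast
qed (rule M)

lemma coord_chart_inverse:
  assumes M: "smooth_manifold M" and c: "(U, \<phi>) \<in> maximal_atlas M" "x \<in> U" and v: "v \<in> model M"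
  shows "coord M (U, \<phi>) x (tmap (flat (model M) (\<phi> ` U)) M (inv_into U \<phi>) (\<phi> x) v) = v"
    and "tmap (flat (model M) (\<phi> ` U)) M (inv_into U \<phi>) (\<phi> x) v \<in> model M"
proof -
  note ch = maximal_chart[OF c(1)]
  note ro = chart_rel_open[OF ch smooth_manifold_subspace[OF M]]
  have a: "\<phi> x \<in> \<phi> ` U" using c by blast
  note sm = smooth_map_chart_inverse[OF M c(1)]
  show "tmap (flat (model M) (\<phi> ` U)) M (inv_into U \<phi>) (\<phi> x) v \<in> model M"
    using tmap_in[OF flat_smooth_manifold[OF ro] M sm] a v by simp
  have s: "id ` (\<phi> ` U \<inter> inv_into U \<phi> -` U) = \<phi> ` U" by (auto simp: chart_inv[OF ch])
  have "coord M (U, \<phi>) (inv_into U \<phi> (\<phi> x)) (tmap (flat (model M) (\<phi> ` U)) M (inv_into U \<phi>) (\<phi> x) v)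
    = fderiv (\<lambda>a. \<phi> (inv_into U \<phi> (inv_into (\<phi> ` U) id a))) (\<phi> ` U) (\<phi> x) v"
    using coord_tmap[OF flat_smooth_manifold[OF ro] M sm flat_chart[OF ro] a c(1), of v] coord_flat[OF ro a v]
      chart_inv[OF ch c(2)] c(2) v s by simp
  also have "\<dots> = fderiv (\<lambda>a. a) (\<phi> ` U) (\<phi> x) v"
    by (rule arg_cong[of _ _ "\<lambda>F. F v"], rule fderiv_rel_cong[OF ro ro ro order_refl order_refl a])
      (auto simp: inv_into_id chart_inv[OF ch])
  also have "\<dots> = v" by (rule fderiv_id[OF ro a v])
  finally show "coord M (U, \<phi>) x (tmap (flat (model M) (\<phi> ` U)) M (inv_into U \<phi>) (\<phi> x) v) = v"
    using chart_inv[OF ch c(2)] by simp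
qed

section \<open>Two-forms in arbitrary charts\<close>

text \<open>The tangent map of the inverse chart inverts \<open>coord\<close>. Later arguments pass
  between a form and its coordinate expression through this identity.\<close>

lemma local_form_coord:
  assumes M: "smooth_manifold M" and c: "(U, \<phi>) \<in> maximal_atlas M" "x \<in> U" and uw: "u \<in> model M" "w \<in> model M"
  shows "local_form M (U, \<phi>) \<nu> (\<phi> x) (coord M (U, \<phi>) x u) (coord M (U, \<phi>) x w) = \<nu> x u w"
proof -
  have "tmap (flat (model M) (\<phi> ` U)) M (inv_into U \<phi>) (\<phi> x) (coord M (U, \<phi>) x v) = v" if "v \<in> model M" for v
    by (rule coord_eqD[OF M c _ that]) (use coord_chart_inverse[OF M c coord_in[OF M c that]] in auto)
  then show ?thesis
    using uw chart_inv[OF maximal_chart[OF c(1)] c(2)] by (simp add: local_form_def pullback_def)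
qed

lemma form_ker_eq_kern: "form_ker M \<nu> x = kern (model M) (\<nu> x)"
  by (simp add: form_ker_def kern_def tangent_space_def)

lemma smooth_two_form_skew: "smooth_two_form M \<nu> \<Longrightarrow> x \<in> points M \<Longrightarrow> skew_form (model M) (\<nu> x)"
  unfolding smooth_two_form_def skew_form_def tangent_space_def by blast

lemma local_form_skew:
  assumes M: "smooth_manifold M" and \<nu>: "smooth_two_form M \<nu>" and c: "(U, \<phi>) \<in> maximal_atlas M" "a \<in> \<phi> ` U"
  shows "skew_form (model M) (local_form M (U, \<phi>) \<nu> a)"
proof -
  obtain x where x: "x \<in> U" "a = \<phi> x" using c(2) by blast
  have sk: "skew_form (model M) (\<nu> x)"
    by (rule smooth_two_form_skew[OF \<nu>]) (use chart_subset[OF maximal_chart[OF c(1)]] x in blast)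
  note E = smooth_manifold_subspace[OF M]
  note lin = linear_coord[OF M c(1) x(1)]
  note lf = local_form_coord[OF M c(1) x(1)]
  show ?thesis unfolding skew_form_def x(2)
  proof (intro ballI conjI allI)
    fix u v assume "u \<in> model M" "v \<in> model M"
    then obtain u' v' where uv: "u' \<in> model M" "u = coord M (U, \<phi>) x u'" "v' \<in> model M" "v = coord M (U, \<phi>) x v'"
      using coord_surj[OF M c(1) x(1)] by metis
    show "local_form M (U, \<phi>) \<nu> (\<phi> x) u v = - local_form M (U, \<phi>) \<nu> (\<phi> x) v u"
      using skew_form_skew[OF sk uv(1,3)] uv lf by simp
    fix w r s assume "w \<in> model M"
    then obtain w' where w: "w' \<in> model M" "w = coord M (U, \<phi>) x w'"
      using coord_surj[OF M c(1) x(1)] by metis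
    have "r *\<^sub>R u + s *\<^sub>R v = coord M (U, \<phi>) x (r *\<^sub>R u' + s *\<^sub>R v')"
      using uv by (simp add: linear_add[OF lin] linear_scale[OF lin])
    moreover have "r *\<^sub>R u' + s *\<^sub>R v' \<in> model M" using uv E by (simp add: subspace_add subspace_scale)
    moreover have "\<nu> x (r *\<^sub>R u' + s *\<^sub>R v') w' = r * \<nu> x u' w' + s * \<nu> x v' w'"
      using sk uv w unfolding skew_form_def by blast
    ultimately show "local_form M (U, \<phi>) \<nu> (\<phi> x) (r *\<^sub>R u + s *\<^sub>R v) w =
        r * local_form M (U, \<phi>) \<nu> (\<phi> x) u w + s * local_form M (U, \<phi>) \<nu> (\<phi> x) v w"
      using uv w lf by simp
  qed
qed

lemma kern_local_form:
  assumes M: "smooth_manifold M" and c: "(U, \<phi>) \<in> maximal_atlas M" "x \<in> U"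
  shows "kern (model M) (local_form M (U, \<phi>) \<nu> (\<phi> x)) = coord M (U, \<phi>) x ` form_ker M \<nu> x"
proof (intro set_eqI iffI)
  fix w assume w: "w \<in> kern (model M) (local_form M (U, \<phi>) \<nu> (\<phi> x))"
  then obtain u where u: "u \<in> model M" "coord M (U, \<phi>) x u = w"
    using coord_surj[OF M c] by (auto simp: kern_def)
  have "\<nu> x u v = 0" if "v \<in> model M" for v
    using local_form_coord[OF M c u(1) that, of \<nu>] w coord_in[OF M c that] u(2) by (simp add: kern_def)
  then show "w \<in> coord M (U, \<phi>) x ` form_ker M \<nu> x" using u by (auto simp: form_ker_eq_kern kern_def)
next
  fix w assume "w \<in> coord M (U, \<phi>) x ` form_ker M \<nu> x"
  then obtain u where u: "u \<in> model M" "\<And>v. v \<in> model M \<Longrightarrow> \<nu> x u v = 0" "w = coord M (U, \<phi>) x u"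
    by (auto simp: form_ker_eq_kern kern_def)
  have "local_form M (U, \<phi>) \<nu> (\<phi> x) w v = 0" if v: "v \<in> model M" for v
  proof -
    obtain v' where "v' \<in> model M" "coord M (U, \<phi>) x v' = v" using coord_surj[OF M c v] .
    then show ?thesis using local_form_coord[OF M c u(1), of v' \<nu>] u by auto
  qed
  then show "w \<in> kern (model M) (local_form M (U, \<phi>) \<nu> (\<phi> x))" using coord_in[OF M c u(1)] u by (auto simp: kern_def)
qed

text \<open>Both sides evaluate \<open>\<nu>\<close> at \<open>x\<close> on the same pair of tangent
  vectors.\<close>

lemma local_form_transition:
  assumes M: "smooth_manifold M" and c: "(U, \<phi>) \<in> maximal_atlas M" "x \<in> U"
    and d: "(V, \<psi>) \<in> maximal_atlas M" "x \<in> V" and vw: "v \<in> model M" "w \<in> model M"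
  shows "local_form M (U, \<phi>) \<nu> (\<phi> x) v w =
    local_form M (V, \<psi>) \<nu> (\<psi> x) (fderiv (\<lambda>a. \<psi> (inv_into U \<phi> a)) (\<phi> ` (U \<inter> V)) (\<phi> x) v)
      (fderiv (\<lambda>a. \<psi> (inv_into U \<phi> a)) (\<phi> ` (U \<inter> V)) (\<phi> x) w)"
proof -
  obtain v' where v: "v' \<in> model M" "coord M (U, \<phi>) x v' = v" using coord_surj[OF M c vw(1)] .
  obtain w' where w: "w' \<in> model M" "coord M (U, \<phi>) x w' = w" using coord_surj[OF M c vw(2)] .
  show ?thesis
    using local_form_coord[OF M c v(1) w(1), of \<nu>] local_form_coord[OF M d v(1) w(1), of \<nu>]
      coord_transition[OF M c d v(1)] coord_transition[OF M c d w(1)] v w by simp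
qed

lemma transition_image: "chart M (U, \<phi>) \<Longrightarrow> (\<lambda>a. \<psi> (inv_into U \<phi> a)) ` \<phi> ` (U \<inter> V) = \<psi> ` (U \<inter> V)"
  by (auto simp: chart_inv image_iff)

lemma transition_fderiv_in:
  assumes M: "smooth_manifold M" and c: "(U, \<phi>) \<in> maximal_atlas M" and d: "(V, \<psi>) \<in> maximal_atlas M"
    and a: "a \<in> \<phi> ` (U \<inter> V)" and v: "v \<in> model M"
  shows "fderiv (\<lambda>a. \<psi> (inv_into U \<phi> a)) (\<phi> ` (U \<inter> V)) a v \<in> model M"
proof (rule fderiv_in[OF transition_smooth[OF M c d] a v smooth_manifold_subspace[OF M]])
  show "(\<lambda>a. \<psi> (inv_into U \<phi> a)) ` \<phi> ` (U \<inter> V) \<subseteq> model M"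
    unfolding transition_image[OF maximal_chart[OF c]]
    using rel_open_subset[OF chart_rel_open[OF maximal_chart[OF d] smooth_manifold_subspace[OF M]]] by blast
qed

lemma smooth_two_form_smooth:
  "smooth_two_form M \<nu> \<Longrightarrow> (U, \<phi>) \<in> atlas M \<Longrightarrow> v \<in> model M \<Longrightarrow> w \<in> model M \<Longrightarrow>
    smooth_on (\<phi> ` U) (\<lambda>a. local_form M (U, \<phi>) \<nu> a v w)"
  by (auto simp: smooth_two_form_def)

text \<open>Smoothness is assumed in atlas charts; the transformation law carries it to maximal
  charts, because the transition map and its derivative are smooth.\<close>

lemma local_form_smooth:
  assumes M: "smooth_manifold M" and \<nu>: "smooth_two_form M \<nu>" and c: "(U, \<phi>) \<in> maximal_atlas M"
    and vw: "v \<in> model M" "w \<in> model M"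
  shows "smooth_on (\<phi> ` U) (\<lambda>a. local_form M (U, \<phi>) \<nu> a v w)"
proof (rule smooth_on_local)
  note E = smooth_manifold_subspace[OF M]
  note ch = maximal_chart[OF c]
  show "rel_open (model M) (\<phi> ` U)" by (rule chart_rel_open[OF ch E])
  fix a assume "a \<in> \<phi> ` U"
  then obtain x where x: "x \<in> U" "a = \<phi> x" by blast
  obtain V \<psi> where d: "(V, \<psi>) \<in> atlas M" "x \<in> V" by (rule atlas_cover[OF M subsetD[OF chart_subset[OF ch] x(1)]])
  note dm = subsetD[OF atlas_subset_maximal[OF M] d(1)]
  let ?T = "\<phi> ` (U \<inter> V)" and ?\<theta> = "\<lambda>a. \<psi> (inv_into U \<phi> a)"
  note t = transition_smooth[OF M c dm]
  have im: "?\<theta> ` ?T \<subseteq> \<psi> ` V" unfolding transition_image[OF ch] by blast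
  have lf: "smooth_on (\<psi> ` V) (\<lambda>b. local_form M (V, \<psi>) \<nu> b p q)" if "p \<in> model M" "q \<in> model M" for p q
    by (rule smooth_two_form_smooth[OF \<nu> d(1) that])
  have "smooth_on ?T (\<lambda>a. local_form M (V, \<psi>) \<nu> (?\<theta> a) (fderiv ?\<theta> ?T a v) (fderiv ?\<theta> ?T a w))"
  proof (rule smooth_on_form_apply[where F = "model M" and u = "\<lambda>a. fderiv ?\<theta> ?T a v" and w = "\<lambda>a. fderiv ?\<theta> ?T a w"])
    show "skew_form (model M) (local_form M (V, \<psi>) \<nu> (?\<theta> a))" if "a \<in> ?T" for a
      by (rule local_form_skew[OF M \<nu> dm]) (use im that in blast)
    show "smooth_on ?T (\<lambda>a. local_form M (V, \<psi>) \<nu> (?\<theta> a) p q)" if "p \<in> model M" "q \<in> model M" for p q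
      by (rule smooth_on_compose[OF lf[OF that] t(2) im])
    show "smooth_on ?T (\<lambda>a. fderiv ?\<theta> ?T a v)" "smooth_on ?T (\<lambda>a. fderiv ?\<theta> ?T a w)"
      by (rule smooth_on_fderiv[OF t vw(1)], rule smooth_on_fderiv[OF t vw(2)])
    show "(\<lambda>a. fderiv ?\<theta> ?T a v) ` ?T \<subseteq> model M" "(\<lambda>a. fderiv ?\<theta> ?T a w) ` ?T \<subseteq> model M"
      using transition_fderiv_in[OF M c dm] vw by blast+
  qed (rule E)
  then have "smooth_on ?T (\<lambda>a. local_form M (U, \<phi>) \<nu> a v w)"
  proof (rule smooth_on_cong)
    fix a assume "a \<in> ?T"
    then obtain y where y: "y \<in> U" "y \<in> V" "a = \<phi> y" by blast
    show "local_form M (V, \<psi>) \<nu> (?\<theta> a) (fderiv ?\<theta> ?T a v) (fderiv ?\<theta> ?T a w) = local_form M (U, \<phi>) \<nu> a v w"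
      using local_form_transition[OF M c y(1) dm y(2) vw, of \<nu>] y(3) chart_inv[OF ch y(1)] by simp
  qed
  then show "\<exists>T. rel_open (model M) T \<and> a \<in> T \<and> T \<subseteq> \<phi> ` U \<and> smooth_on T (\<lambda>a. local_form M (U, \<phi>) \<nu> a v w)"
    using t(1) x d(2) by blast
qed

section \<open>Exterior derivative and pullback\<close>

text \<open>The exterior derivative on constant vector fields, isolated so that its behaviour under
  a change of coordinates can be stated.\<close>

definition dform :: "'e::euclidean_space set \<Rightarrow> ('e \<Rightarrow> 'e \<Rightarrow> 'e \<Rightarrow> real) \<Rightarrow> 'e \<Rightarrow> 'e \<Rightarrow> 'e \<Rightarrow> 'e \<Rightarrow> real" where
  "dform S B u a b c = fderiv (\<lambda>y. B y b c) S u a + fderiv (\<lambda>y. B y c a) S u b + fderiv (\<lambda>y. B y a b) S u c"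

text \<open>A product rule for three moving quantities. The form is expanded on projected basis
  vectors, which reduces it to products of real functions.\<close>

lemma fderiv_form_apply:
  fixes B :: "'e::euclidean_space \<Rightarrow> 'e \<Rightarrow> 'e \<Rightarrow> real"
  assumes E: "subspace E" and T: "rel_open E T" "y \<in> T" and B: "\<And>a. a \<in> T \<Longrightarrow> skew_form E (B a)"
    "\<And>v w. v \<in> E \<Longrightarrow> w \<in> E \<Longrightarrow> smooth_on T (\<lambda>a. B a v w)"
    and u: "smooth_on T u" "u ` T \<subseteq> E" and w: "smooth_on T w" "w ` T \<subseteq> E" and h: "h \<in> E"
  shows "fderiv (\<lambda>a. B a (u a) (w a)) T y h =
    fderiv (\<lambda>a. B a (u y) (w y)) T y h + B y (fderiv u T y h) (w y) + B y (u y) (fderiv w T y h)"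
proof -
  define Q where "Q = orth_proj E"
  note Q = linear_orth_proj[OF E, folded Q_def] orth_proj_in[OF E, folded Q_def] orth_proj_id[OF E, folded Q_def]
  have ll: "linear (\<lambda>v. B a (Q v) q)" if "a \<in> T" "q \<in> E" for a q
    using skew_form_linear_left[OF B(1)[OF that(1)] that(2) Q(1,2)] .
  have lr: "linear (\<lambda>v. B a q (Q v))" if "a \<in> T" "q \<in> E" for a q
    using skew_form_linear_right[OF B(1)[OF that(1)] that(2) Q(1,2)] .
  have exp: "B a p q = (\<Sum>i\<in>Basis. \<Sum>j\<in>Basis. (p \<bullet> i) * ((q \<bullet> j) * B a (Q i) (Q j)))" if "a \<in> T" "p \<in> E" "q \<in> E" for a p q
  proof -
    have "B a p q = (\<Sum>i\<in>Basis. (p \<bullet> i) * B a (Q i) q)"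
      using linear_euclidean_expand[OF ll[OF that(1,3)], of p] Q(3)[OF that(2)] by simp
    also have "\<dots> = (\<Sum>i\<in>Basis. \<Sum>j\<in>Basis. (p \<bullet> i) * ((q \<bullet> j) * B a (Q i) (Q j)))"
      using linear_euclidean_expand[OF lr[OF that(1) Q(2)], of _ q] Q(3)[OF that(3)] by (simp add: sum_distrib_left)
    finally show ?thesis .
  qed
  have dB: "((\<lambda>a. B a p q) has_derivative fderiv (\<lambda>a. B a p q) T y) (at y within T)" if "p \<in> E" "q \<in> E" for p q
    using smooth_on_has_derivative[OF B(2)[OF that] T(2)] .
  note du = smooth_on_has_derivative[OF u(1) T(2)] and dw = smooth_on_has_derivative[OF w(1) T(2)]
  have uE: "u y \<in> E" and wE: "w y \<in> E" and u'E: "fderiv u T y h \<in> E" and w'E: "fderiv w T y h \<in> E"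
    using u w T(2) fderiv_in[OF T(1) _ T(2) h E] by auto
  let ?D = "\<lambda>h. \<Sum>i\<in>Basis. \<Sum>j\<in>Basis. (u y \<bullet> i) * ((w y \<bullet> j) * fderiv (\<lambda>a. B a (Q i) (Q j)) T y h + (fderiv w T y h \<bullet> j) * B y (Q i) (Q j))
        + (fderiv u T y h \<bullet> i) * ((w y \<bullet> j) * B y (Q i) (Q j))"
  have "((\<lambda>a. \<Sum>i\<in>Basis. \<Sum>j\<in>Basis. (u a \<bullet> i) * ((w a \<bullet> j) * B a (Q i) (Q j))) has_derivative ?D) (at y within T)"
    by (intro has_derivative_sum has_derivative_mult has_derivative_inner_left du dw dB Q)
  then have "((\<lambda>a. B a (u a) (w a)) has_derivative ?D) (at y within T)"
    by (rule has_derivative_transform[OF T(2), rotated]) (use exp u w in blast)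
  then have 1: "fderiv (\<lambda>a. B a (u a) (w a)) T y h = ?D h" by (rule fderiv_eq[OF T _ h])
  have "((\<lambda>a. \<Sum>i\<in>Basis. \<Sum>j\<in>Basis. (u y \<bullet> i) * ((w y \<bullet> j) * B a (Q i) (Q j))) has_derivative
      (\<lambda>h. \<Sum>i\<in>Basis. \<Sum>j\<in>Basis. (u y \<bullet> i) * ((w y \<bullet> j) * fderiv (\<lambda>a. B a (Q i) (Q j)) T y h))) (at y within T)"
    by (intro has_derivative_sum has_derivative_mult_right dB Q)
  then have "((\<lambda>a. B a (u y) (w y)) has_derivative
      (\<lambda>h. \<Sum>i\<in>Basis. \<Sum>j\<in>Basis. (u y \<bullet> i) * ((w y \<bullet> j) * fderiv (\<lambda>a. B a (Q i) (Q j)) T y h))) (at y within T)"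
    by (rule has_derivative_transform[OF T(2), rotated]) (use exp uE wE in blast)
  then have 2: "fderiv (\<lambda>a. B a (u y) (w y)) T y h = (\<Sum>i\<in>Basis. \<Sum>j\<in>Basis. (u y \<bullet> i) * ((w y \<bullet> j) * fderiv (\<lambda>a. B a (Q i) (Q j)) T y h))"
    by (rule fderiv_eq[OF T _ h])
  show ?thesis unfolding 1 2 exp[OF T(2) u'E wE] exp[OF T(2) uE w'E]
    by (simp add: sum.distrib algebra_simps)
qed

text \<open>The terms with second derivatives of \<open>\<theta>\<close> cancel by their symmetry
  and the skewness of the form.\<close>

lemma dform_pullback:
  fixes B :: "'e::euclidean_space \<Rightarrow> 'e \<Rightarrow> 'e \<Rightarrow> real"
  assumes E: "subspace E" and T: "rel_open E T" "y \<in> T" and V: "rel_open E V" and \<theta>: "smooth_on T \<theta>" "\<theta> ` T \<subseteq> V"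
    and B: "\<And>a. a \<in> V \<Longrightarrow> skew_form E (B a)" "\<And>v w. v \<in> E \<Longrightarrow> w \<in> E \<Longrightarrow> smooth_on V (\<lambda>a. B a v w)"
    and abc: "a \<in> E" "b \<in> E" "c \<in> E"
  shows "dform T (\<lambda>y v w. B (\<theta> y) (fderiv \<theta> T y v) (fderiv \<theta> T y w)) y a b c =
    dform V B (\<theta> y) (fderiv \<theta> T y a) (fderiv \<theta> T y b) (fderiv \<theta> T y c)"
proof -
  let ?d = "\<lambda>v. fderiv \<theta> T y v" and ?dd = "\<lambda>v h. fderiv (\<lambda>z. fderiv \<theta> T z v) T y h"
  have \<theta>E: "\<theta> ` T \<subseteq> E" using \<theta>(2) rel_open_subset[OF V] by blast
  have dE: "fderiv \<theta> T z v \<in> E" if "z \<in> T" "v \<in> E" for z v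
    by (rule fderiv_in[OF T(1) \<theta>(1) that E \<theta>E])
  have ddE: "?dd v h \<in> E" if "v \<in> E" "h \<in> E" for v h
    by (rule fderiv_in[OF T(1) smooth_on_fderiv[OF T(1) \<theta>(1) that(1)] T(2) that(2) E]) (use dE that in blast)
  have sym: "?dd v h = ?dd h v" if "v \<in> E" "h \<in> E" for v h
    by (rule second_derivative_symmetric[OF T(1) \<theta>(1) T(2) that])
  have sk: "skew_form E (B (\<theta> y))" using B(1) \<theta>(2) T(2) by blast
  have main: "fderiv (\<lambda>z. B (\<theta> z) (fderiv \<theta> T z v) (fderiv \<theta> T z w)) T y h =
      fderiv (\<lambda>x. B x (?d v) (?d w)) V (\<theta> y) (?d h) + B (\<theta> y) (?dd v h) (?d w) + B (\<theta> y) (?d v) (?dd w h)"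
    if "v \<in> E" "w \<in> E" "h \<in> E" for v w h
  proof -
    have "fderiv (\<lambda>z. B (\<theta> z) (fderiv \<theta> T z v) (fderiv \<theta> T z w)) T y h =
        fderiv (\<lambda>z. B (\<theta> z) (?d v) (?d w)) T y h + B (\<theta> y) (?dd v h) (?d w) + B (\<theta> y) (?d v) (?dd w h)"
    proof (rule fderiv_form_apply[where B = "\<lambda>z. B (\<theta> z)", OF E T])
      show "smooth_on T (\<lambda>a. B (\<theta> a) p q)" if "p \<in> E" "q \<in> E" for p q
        by (rule smooth_on_compose[OF B(2)[OF that] \<theta>])
      show "skew_form E (B (\<theta> a))" if "a \<in> T" for a using B(1) \<theta>(2) that by blast
      show "smooth_on T (\<lambda>z. fderiv \<theta> T z v)" "smooth_on T (\<lambda>z. fderiv \<theta> T z w)"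
        by (rule smooth_on_fderiv[OF T(1) \<theta>(1) that(1)], rule smooth_on_fderiv[OF T(1) \<theta>(1) that(2)])
      show "(\<lambda>z. fderiv \<theta> T z v) ` T \<subseteq> E" "(\<lambda>z. fderiv \<theta> T z w) ` T \<subseteq> E" using dE that by blast+
    qed (rule that)
    moreover have "fderiv (\<lambda>z. B (\<theta> z) (?d v) (?d w)) T y h = fderiv (\<lambda>x. B x (?d v) (?d w)) V (\<theta> y) (?d h)"
      by (rule fderiv_compose[OF T(1) \<theta>(1) B(2) \<theta>(2) T(2)]) (use dE T that in auto)
    ultimately show ?thesis by simp
  qed
  \<comment> \<open>The three differentiated terms contribute six second derivatives; each of these
    identities cancels a pair of them.\<close>
  have s1: "B (\<theta> y) (?dd b a) (?d c) = - B (\<theta> y) (?d c) (?dd a b)"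
    using skew_form_skew[OF sk ddE dE] sym abc T(2) by simp
  have s2: "B (\<theta> y) (?dd c b) (?d a) = - B (\<theta> y) (?d a) (?dd b c)"
    using skew_form_skew[OF sk ddE dE] sym abc T(2) by simp
  have s3: "B (\<theta> y) (?dd a c) (?d b) = - B (\<theta> y) (?d b) (?dd c a)"
    using skew_form_skew[OF sk ddE dE] sym abc T(2) by simp
  show ?thesis unfolding dform_def main[OF abc(2,3,1)] main[OF abc(3,1,2)] main[OF abc(1,2,3)]
    using s1 s2 s3 by simp
qed

text \<open>In an atlas chart this is the assumption; near a point of a maximal chart the form is
  the pullback of such an expression under the transition map.\<close>

lemma local_form_closed:
  assumes M: "smooth_manifold M" and \<nu>: "smooth_two_form M \<nu>" "closed_two_form M \<nu>" and c: "(U, \<phi>) \<in> maximal_atlas M"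
    and u: "u \<in> \<phi> ` U" and pqr: "p \<in> model M" "q \<in> model M" "r \<in> model M"
  shows "dform (\<phi> ` U) (local_form M (U, \<phi>) \<nu>) u p q r = 0"
proof -
  note E = smooth_manifold_subspace[OF M]
  note ch = maximal_chart[OF c]
  obtain x where x: "x \<in> U" "u = \<phi> x" using u by blast
  obtain V \<psi> where d: "(V, \<psi>) \<in> atlas M" "x \<in> V" by (rule atlas_cover[OF M subsetD[OF chart_subset[OF ch] x(1)]])
  note dm = subsetD[OF atlas_subset_maximal[OF M] d(1)]
  let ?T = "\<phi> ` (U \<inter> V)" and ?\<theta> = "\<lambda>a. \<psi> (inv_into U \<phi> a)"
  note t = transition_smooth[OF M c dm]
  have im: "?\<theta> ` ?T \<subseteq> \<psi> ` V" unfolding transition_image[OF ch] by blast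
  have uT: "u \<in> ?T" using x d by blast
  have tr: "fderiv (\<lambda>y. local_form M (U, \<phi>) \<nu> y v w) (\<phi> ` U) u =
      fderiv (\<lambda>y. local_form M (V, \<psi>) \<nu> (?\<theta> y) (fderiv ?\<theta> ?T y v) (fderiv ?\<theta> ?T y w)) ?T u"
    if "v \<in> model M" "w \<in> model M" for v w
  proof (rule fderiv_rel_cong[OF chart_rel_open[OF ch E] t(1) t(1) _ order_refl uT])
    fix a assume "a \<in> ?T"
    then obtain y where y: "y \<in> U" "y \<in> V" "a = \<phi> y" by blast
    show "local_form M (U, \<phi>) \<nu> a v w = local_form M (V, \<psi>) \<nu> (?\<theta> a) (fderiv ?\<theta> ?T a v) (fderiv ?\<theta> ?T a w)"
      using local_form_transition[OF M c y(1) dm y(2) that, of \<nu>] y(3) chart_inv[OF ch y(1)] by simp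
  qed blast
  have "dform (\<phi> ` U) (local_form M (U, \<phi>) \<nu>) u p q r =
      dform ?T (\<lambda>y v w. local_form M (V, \<psi>) \<nu> (?\<theta> y) (fderiv ?\<theta> ?T y v) (fderiv ?\<theta> ?T y w)) u p q r"
    unfolding dform_def tr[OF pqr(2,3)] tr[OF pqr(3,1)] tr[OF pqr(1,2)] ..
  also have "\<dots> = dform (\<psi> ` V) (local_form M (V, \<psi>) \<nu>) (?\<theta> u) (fderiv ?\<theta> ?T u p) (fderiv ?\<theta> ?T u q) (fderiv ?\<theta> ?T u r)"
    by (rule dform_pullback[OF E t(1) uT chart_rel_open[OF maximal_chart[OF dm] E] t(2) im
          local_form_skew[OF M \<nu>(1) dm] local_form_smooth[OF M \<nu>(1) dm] pqr])
  also have "\<dots> = 0"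
  proof -
    have "?\<theta> u \<in> \<psi> ` V" using im uT by blast
    moreover have "\<forall>u\<in>\<psi> ` V. \<forall>a\<in>model M. \<forall>b\<in>model M. \<forall>c\<in>model M. dform (\<psi> ` V) (local_form M (V, \<psi>) \<nu>) u a b c = 0"
      using \<nu>(2) d(1) unfolding closed_two_form_def dform_def by blast
    ultimately show ?thesis using transition_fderiv_in[OF M c dm uT] pqr by blast
  qed
  finally show ?thesis .
qed


section \<open>Hamiltonian vector fields and their integral curves\<close>

lemma hamilton_equation_chart:
  assumes M: "smooth_manifold M" and H: "smooth_map M real_line H" and c: "(U, \<phi>) \<in> maximal_atlas M" "x \<in> U"
    and v: "v \<in> model M"
  shows "(\<forall>w\<in>model M. \<nu> x v w - differential M H x w = 0) \<longleftrightarrow>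
    (\<forall>w\<in>model M. local_form M (U, \<phi>) \<nu> (\<phi> x) (coord M (U, \<phi>) x v) w = fderiv (\<lambda>a. H (inv_into U \<phi> a)) (\<phi> ` U) (\<phi> x) w)"
proof -
  have e: "\<nu> x v w - differential M H x w =
      local_form M (U, \<phi>) \<nu> (\<phi> x) (coord M (U, \<phi>) x v) (coord M (U, \<phi>) x w) -
      fderiv (\<lambda>a. H (inv_into U \<phi> a)) (\<phi> ` U) (\<phi> x) (coord M (U, \<phi>) x w)" if "w \<in> model M" for w
    using local_form_coord[OF M c v that, of \<nu>] differential_chart[OF M H c that] by simp
  show ?thesis
  proof
    assume L: "\<forall>w\<in>model M. \<nu> x v w - differential M H x w = 0"
    show "\<forall>w\<in>model M. local_form M (U, \<phi>) \<nu> (\<phi> x) (coord M (U, \<phi>) x v) w = fderiv (\<lambda>a. H (inv_into U \<phi> a)) (\<phi> ` U) (\<phi> x) w"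
    proof
      fix w assume "w \<in> model M"
      then obtain w' where "w' \<in> model M" "coord M (U, \<phi>) x w' = w" by (rule coord_surj[OF M c])
      then show "local_form M (U, \<phi>) \<nu> (\<phi> x) (coord M (U, \<phi>) x v) w = fderiv (\<lambda>a. H (inv_into U \<phi> a)) (\<phi> ` U) (\<phi> x) w"
        using L e[of w'] by auto
    qed
  next
    assume "\<forall>w\<in>model M. local_form M (U, \<phi>) \<nu> (\<phi> x) (coord M (U, \<phi>) x v) w = fderiv (\<lambda>a. H (inv_into U \<phi> a)) (\<phi> ` U) (\<phi> x) w"
    then show "\<forall>w\<in>model M. \<nu> x v w - differential M H x w = 0" using e coord_in[OF M c] by simp
  qed
qed

text \<open>\<open>nondegenerate_form_solve\<close> with \<open>F\<close> the whole model. The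
  equivalence serves existence, where \<open>X\<close> has to solve the equation, and uniqueness,
  where every velocity has to be \<open>X\<close>.\<close>

lemma hamiltonian_field_local:
  assumes sp: "symplectic_manifold N \<omega>" and H: "smooth_map N real_line H" and c: "(U, \<phi>) \<in> maximal_atlas N" "x \<in> U"
  obtains T X where "rel_open (model N) T" "\<phi> x \<in> T" "T \<subseteq> \<phi> ` U" "smooth_on T X" "\<And>a. a \<in> T \<Longrightarrow> X a \<in> model N"
    "\<And>a \<xi>. a \<in> T \<Longrightarrow> \<xi> \<in> model N \<Longrightarrow>
      (\<forall>w\<in>model N. local_form N (U, \<phi>) \<omega> a \<xi> w = fderiv (\<lambda>a. H (inv_into U \<phi> a)) (\<phi> ` U) a w) \<longleftrightarrow> \<xi> = X a"
proof -
  have N: "smooth_manifold N" and \<omega>: "smooth_two_form N \<omega>" and nd: "\<And>x. x \<in> points N \<Longrightarrow> form_ker N \<omega> x = {0}"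
    using sp unfolding symplectic_manifold_def presymplectic_manifold_def by auto
  note E = smooth_manifold_subspace[OF N]
  note ch = maximal_chart[OF c(1)]
  note ro = chart_rel_open[OF ch E]
  have a0: "\<phi> x \<in> \<phi> ` U" using c by blast
  note sk = local_form_skew[OF N \<omega> c(1)]
  note h = smooth_function_chart[OF N H c(1)]
  have k0: "kern (model N) (local_form N (U, \<phi>) \<omega> (\<phi> x)) = {0}"
    unfolding kern_local_form[OF N c] using nd chart_subset[OF ch] c(2) linear_0[OF linear_coord[OF N c]] by auto
  obtain T X where T: "rel_open (model N) T" "\<phi> x \<in> T" "T \<subseteq> \<phi> ` U" "smooth_on T X" "\<And>a. a \<in> T \<Longrightarrow> X a \<in> model N"
    and X: "\<And>a w. a \<in> T \<Longrightarrow> w \<in> model N \<Longrightarrow> local_form N (U, \<phi>) \<omega> a (X a) w = fderiv (\<lambda>a. H (inv_into U \<phi> a)) (\<phi> ` U) a w"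
    and k: "\<And>a. a \<in> T \<Longrightarrow> kern (model N) (local_form N (U, \<phi>) \<omega> a) = {0}"
    by (rule nondegenerate_form_solve[OF ro a0 E sk local_form_smooth[OF N \<omega> c(1)] k0 linear_fderiv[OF h] smooth_on_fderiv[OF ro h]], (assumption | rule that)+)
  show ?thesis
  proof (rule that[OF T])
    fix a \<xi> assume a: "a \<in> T" and \<xi>: "\<xi> \<in> model N"
    have sa: "skew_form (model N) (local_form N (U, \<phi>) \<omega> a)" using sk a T(3) by blast
    show "(\<forall>w\<in>model N. local_form N (U, \<phi>) \<omega> a \<xi> w = fderiv (\<lambda>a. H (inv_into U \<phi> a)) (\<phi> ` U) a w) \<longleftrightarrow> \<xi> = X a"
    proof
      assume "\<forall>w\<in>model N. local_form N (U, \<phi>) \<omega> a \<xi> w = fderiv (\<lambda>a. H (inv_into U \<phi> a)) (\<phi> ` U) a w"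
      then have "\<xi> - X a \<in> kern (model N) (local_form N (U, \<phi>) \<omega> a)"
        using X[OF a] skew_form_diff_left[OF sa \<xi> T(5)[OF a]] subspace_diff[OF E \<xi> T(5)[OF a]] by (simp add: kern_def)
      then show "\<xi> = X a" using k[OF a] by simp
    qed (use X[OF a] in simp)
  qed
qed

lemma smooth_on_orth_proj_extend:
  assumes "rel_open E T" "smooth_on T X"
  shows "smooth_on (orth_proj E -` T) (\<lambda>a. X (orth_proj E a))"
proof (rule smooth_on_compose[OF assms(2)])
  have "bounded_linear (orth_proj E)"
    using linear_orth_proj[OF rel_open_subspace[OF assms(1)]] linear_conv_bounded_linear by blast
  then show "smooth_on (orth_proj E -` T) (orth_proj E)" by (rule smooth_on_bounded_linear) (rule smooth_on_id)
qed blast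

text \<open>The model may be a proper subspace, so the differential equation is solved in the
  ambient space for the field extended by the projection, and the solution is shown to stay in the
  model.\<close>

lemma hamiltonian_curve_exists:
  fixes N :: "('p, 'e::euclidean_space) manifold"
  assumes sp: "symplectic_manifold N \<omega>" and H: "smooth_map N real_line H" and x: "x \<in> points N"
  obtains I \<gamma> where "open_interval I" "t0 \<in> I" "hamiltonian_curve N \<omega> H I \<gamma>" "\<gamma> t0 = x"
proof -
  have N: "smooth_manifold N"
    using sp unfolding symplectic_manifold_def presymplectic_manifold_def by auto
  note E = smooth_manifold_subspace[OF N]
  obtain U \<phi> where ca: "(U, \<phi>) \<in> atlas N" "x \<in> U" by (rule atlas_cover[OF N x])
  then have c: "(U, \<phi>) \<in> maximal_atlas N" "x \<in> U" using atlas_subset_maximal[OF N] by auto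
  note ch = maximal_chart[OF c(1)]
  obtain T X where T: "rel_open (model N) T" "\<phi> x \<in> T" "T \<subseteq> \<phi> ` U" "smooth_on T X" "\<And>a. a \<in> T \<Longrightarrow> X a \<in> model N"
    and X: "\<And>a \<xi>. a \<in> T \<Longrightarrow> \<xi> \<in> model N \<Longrightarrow>
      (\<forall>w\<in>model N. local_form N (U, \<phi>) \<omega> a \<xi> w = fderiv (\<lambda>a. H (inv_into U \<phi> a)) (\<phi> ` U) a w) \<longleftrightarrow> \<xi> = X a"
    by (rule hamiltonian_field_local[OF sp H c]) (rule that)
  define Q where "Q = orth_proj (model N)"
  note Q = linear_orth_proj[OF E, folded Q_def] orth_proj_in[OF E, folded Q_def] orth_proj_id[OF E, folded Q_def]
  have TE: "T \<subseteq> model N" using rel_open_subset[OF T(1)] .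
  have op: "open (Q -` T)" unfolding Q_def by (rule open_vimage_orth_proj[OF T(1)])
  have smX: "smooth_on (Q -` T) (\<lambda>a. X (Q a))" unfolding Q_def by (rule smooth_on_orth_proj_extend[OF T(1,4)])
  have a0: "\<phi> x \<in> Q -` T" using T(2) TE Q(3) by auto
  obtain e y where y: "e > 0" "y t0 = \<phi> x" "\<And>t. t \<in> {t0-e<..<t0+e} \<Longrightarrow> y t \<in> Q -` T"
    "\<And>t. t \<in> {t0-e<..<t0+e} \<Longrightarrow> (y has_vector_derivative X (Q (y t))) (at t)"
    using ode_existence[OF op smX a0, of t0] by metis
  define I where "I = {t0-e<..<t0+e}"
  have I: "open_interval I" "open I" "t0 \<in> I" using y(1) by (auto simp: I_def open_interval_def)
  have blQ: "bounded_linear Q" using Q(1) linear_conv_bounded_linear by blast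
  \<comment> \<open>The extended field takes values in the model, so the part of \<open>y\<close>
    orthogonal to it is constant; it is zero at \<open>t0\<close>.\<close>
  have yQ: "y t = Q (y t)" if t: "t \<in> I" for t
  proof -
    have "((\<lambda>t. y t - Q (y t)) has_derivative (\<lambda>h. 0)) (at t within I)" if "t \<in> I" for t
    proof -
      have d: "(y has_vector_derivative X (Q (y t))) (at t)" using y(4) that by (simp add: I_def)
      have "Q (X (Q (y t))) = X (Q (y t))" using Q(3) T(5) y(3) that by (simp add: I_def)
      then have "((\<lambda>t. y t - Q (y t)) has_vector_derivative 0) (at t)"
        using has_vector_derivative_diff[OF d bounded_linear.has_vector_derivative[OF blQ d]] by simp
      then show ?thesis by (simp add: has_vector_derivative_def has_derivative_at_withinI)
    qed
    then have "y t - Q (y t) = y t0 - Q (y t0)"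
      using has_derivative_zero_unique[of I "\<lambda>t. y t - Q (y t)"] t I(3) by (metis I_def convex_real_interval(8))
    also have "\<dots> = 0" using y(2) a0 Q(3) TE T(2) by auto
    finally show ?thesis by simp
  qed
  have yT: "y t \<in> T" if "t \<in> I" for t
    using y(3)[of t] yQ[OF that] that unfolding I_def by (metis vimageE)
  have yd: "(y has_vector_derivative X (y t)) (at t)" if "t \<in> I" for t
    using y(4)[of t] yQ[OF that] that by (simp add: I_def)
  define \<gamma> where "\<gamma> = (\<lambda>t. inv_into U \<phi> (y t))"
  have \<phi>y: "\<phi> (\<gamma> t) = y t" "\<gamma> t \<in> U" if "t \<in> I" for t
    using yT[OF that] T(3) unfolding \<gamma>_def by (auto simp: f_inv_into_f intro: inv_into_into)
  have roI: "rel_open UNIV I" using I by (simp add: rel_open_UNIV)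
  have smy: "smooth_on I y"
    by (rule ode_solution_smooth[OF T(4) yT]) (use yd has_vector_derivative_at_within in blast)+
  have sm: "smooth_map (interval_manifold I) N \<gamma>"
  proof (rule smooth_mapI[OF flat_smooth_manifold[OF roI] N])
    have "continuous_map (top_of_set I) (top_of_set (\<phi> ` U)) y"
      using smooth_on_continuous_on[OF smy] yT T(3) by auto
    from continuous_map_compose[OF this chart_inverse_continuous[OF ch]]
    show "continuous_map (mtop (interval_manifold I)) (mtop N) \<gamma>" by (simp add: \<gamma>_def o_def)
    fix t assume "t \<in> points (interval_manifold I)"
    then have t: "t \<in> I" by simp
    have s: "id ` (I \<inter> \<gamma> -` U) = I" using \<phi>y(2) by auto
    have "smooth_on (id ` (I \<inter> \<gamma> -` U)) (\<lambda>a. \<phi> (\<gamma> (inv_into I id a)))"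
      unfolding s by (rule smooth_on_cong[OF smy]) (simp add: inv_into_id \<phi>y(1))
    then show "\<exists>V \<psi> V' \<psi>'. (V, \<psi>) \<in> maximal_atlas (interval_manifold I) \<and> (V', \<psi>') \<in> maximal_atlas N \<and> t \<in> V \<and>
        \<gamma> t \<in> V' \<and> smooth_on (\<psi> ` (V \<inter> \<gamma> -` V')) (\<lambda>a. \<psi>' (\<gamma> (inv_into V \<psi> a)))"
      using flat_chart[OF roI] c(1) t \<phi>y(2)[OF t] by blast
  qed
  have "hamiltonian_curve N \<omega> H I \<gamma>"
    unfolding hamiltonian_curve_def tangent_space_def
  proof (intro conjI ballI sm)
    fix t v assume t: "t \<in> I" and v: "v \<in> model N"
    note cc = curve_chart[OF N I(2) sm c(1) t \<phi>y(2)[OF t]]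
    have "((\<lambda>s. \<phi> (\<gamma> s)) has_vector_derivative X (y t)) (at t)"
      by (rule has_vector_derivative_transform_within_open[OF yd[OF t] I(2) t]) (simp add: \<phi>y)
    then have "coord N (U, \<phi>) (\<gamma> t) (velocity N I \<gamma> t) = X (\<phi> (\<gamma> t))"
      using vector_derivative_unique_at[OF cc(2)] \<phi>y(1)[OF t] by simp
    then show "\<omega> (\<gamma> t) (velocity N I \<gamma> t) v - differential N H (\<gamma> t) v = 0"
      using hamilton_equation_chart[OF N H c(1) \<phi>y(2)[OF t] cc(1), of \<omega>]
        X[of "\<phi> (\<gamma> t)" "coord N (U, \<phi>) (\<gamma> t) (velocity N I \<gamma> t)"] yT[OF t] T(5) \<phi>y(1)[OF t] v by auto
  qed
  then show ?thesis using that I \<gamma>_def y(2) chart_inv[OF ch c(2)] by auto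
qed

lemma open_curve_preimage:
  assumes "open I" "smooth_map (interval_manifold I) N \<gamma>" "openin (mtop N) V"
  shows "open (I \<inter> \<gamma> -` V)"
proof -
  have "openin (mtop (interval_manifold I)) (I \<inter> \<gamma> -` V)"
    by (rule continuous_preimage_open[OF _ _ assms(3)]) (use assms in \<open>auto simp: smooth_map_def\<close>)
  then show ?thesis using assms(1) openin_open_eq by auto
qed

lemma hamiltonian_curve_chart:
  assumes N: "smooth_manifold N" and H: "smooth_map N real_line H" and I: "open I" and \<gamma>: "hamiltonian_curve N \<omega> H I \<gamma>"
    and c: "(U, \<phi>) \<in> maximal_atlas N" and t: "t \<in> I" "\<gamma> t \<in> U"
  obtains \<xi> where "((\<lambda>s. \<phi> (\<gamma> s)) has_vector_derivative \<xi>) (at t)" "\<xi> \<in> model N"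
    "\<forall>w\<in>model N. local_form N (U, \<phi>) \<omega> (\<phi> (\<gamma> t)) \<xi> w = fderiv (\<lambda>a. H (inv_into U \<phi> a)) (\<phi> ` U) (\<phi> (\<gamma> t)) w"
proof -
  have sm: "smooth_map (interval_manifold I) N \<gamma>"
    and eq: "\<forall>w\<in>model N. \<omega> (\<gamma> t) (velocity N I \<gamma> t) w - differential N H (\<gamma> t) w = 0"
    using \<gamma> t(1) by (auto simp: hamiltonian_curve_def tangent_space_def)
  note cc = curve_chart[OF N I sm c t]
  show ?thesis
    by (rule that[OF cc(2) coord_in[OF N c t(2) cc(1)]]) (use eq hamilton_equation_chart[OF N H c t(2) cc(1), of \<omega>] in blast)
qed

text \<open>The coincidence set of the curves contains \<open>t0\<close>, is closed because the
  manifold is Hausdorff, and is open by local uniqueness in a chart; the common interval is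
  connected.\<close>

lemma hamiltonian_curve_unique:
  fixes N :: "('p, 'e::euclidean_space) manifold"
  assumes sp: "symplectic_manifold N \<omega>" and H: "smooth_map N real_line H"
    and I: "open_interval I" "t0 \<in> I" "hamiltonian_curve N \<omega> H I \<gamma>"
    and J: "open_interval J" "t0 \<in> J" "hamiltonian_curve N \<omega> H J \<eta>"
    and eq: "\<gamma> t0 = \<eta> t0" and t: "t \<in> I \<inter> J"
  shows "\<gamma> t = \<eta> t"
proof -
  have N: "smooth_manifold N"
    using sp unfolding symplectic_manifold_def presymplectic_manifold_def by auto
  note E = smooth_manifold_subspace[OF N]
  have op: "open I" "open J" using I J by (auto simp: open_interval_def)
  have sm: "smooth_map (interval_manifold I) N \<gamma>" "smooth_map (interval_manifold J) N \<eta>"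
    using I J by (auto simp: hamiltonian_curve_def)
  define K where "K = I \<inter> J"
  have K: "open K" "connected K" "t0 \<in> K" "t \<in> K"
    using I J t by (auto simp: K_def open_interval_def intro!: is_interval_connected is_interval_Int)
  define Z where "Z = {t\<in>K. \<gamma> t = \<eta> t}"
  have cont: "continuous_map (top_of_set K) (mtop N) \<gamma>" "continuous_map (top_of_set K) (mtop N) \<eta>"
    using sm unfolding smooth_map_def K_def
    by (auto intro: continuous_map_from_subtopology_mono)
  have cl: "closedin (top_of_set K) Z"
    using closedin_continuous_maps_eq[OF _ cont] N unfolding Z_def smooth_manifold_def by auto
  have "\<exists>d>0. \<forall>s. dist s t1 < d \<longrightarrow> s \<in> Z" if t1: "t1 \<in> Z" for t1
  proof -
    have t1K: "t1 \<in> I" "t1 \<in> J" "\<gamma> t1 = \<eta> t1" using t1 by (auto simp: Z_def K_def)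
    have "\<gamma> t1 \<in> points N" using sm(1) t1K(1) by (auto simp: smooth_map_def continuous_map_def points_def)
    then obtain U \<phi> where ca: "(U, \<phi>) \<in> atlas N" "\<gamma> t1 \<in> U" by (rule atlas_cover[OF N])
    then have c: "(U, \<phi>) \<in> maximal_atlas N" using atlas_subset_maximal[OF N] by auto
    note ch = maximal_chart[OF c]
    obtain T X where T: "rel_open (model N) T" "\<phi> (\<gamma> t1) \<in> T" "T \<subseteq> \<phi> ` U" "smooth_on T X" "\<And>a. a \<in> T \<Longrightarrow> X a \<in> model N"
      and X: "\<And>a \<xi>. a \<in> T \<Longrightarrow> \<xi> \<in> model N \<Longrightarrow>
        (\<forall>w\<in>model N. local_form N (U, \<phi>) \<omega> a \<xi> w = fderiv (\<lambda>a. H (inv_into U \<phi> a)) (\<phi> ` U) a w) \<longleftrightarrow> \<xi> = X a"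
      by (rule hamiltonian_field_local[OF sp H c ca(2)]) (rule that)
    define Q where "Q = orth_proj (model N)"
    have Q: "Q a = a" if "a \<in> T" for a
      using that rel_open_subset[OF T(1)] orth_proj_id[OF E] unfolding Q_def by blast
    have opT: "open (Q -` T)" unfolding Q_def by (rule open_vimage_orth_proj[OF T(1)])
    have smX: "smooth_on (Q -` T) (\<lambda>a. X (Q a))" unfolding Q_def by (rule smooth_on_orth_proj_extend[OF T(1,4)])
    define V where "V = U \<inter> \<phi> -` T"
    have V: "openin (mtop N) V" unfolding V_def by (rule chart_preimage_open[OF ch E T(1)])
    \<comment> \<open>Times at which both curves are in the part of the chart where the field
      \<open>X\<close> is available; it is a neighbourhood of \<open>t1\<close>.\<close>
    define K1 where "K1 = (I \<inter> \<gamma> -` V) \<inter> (J \<inter> \<eta> -` V)"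
    have K1: "open K1" unfolding K1_def
      by (intro open_Int open_curve_preimage[OF op(1) sm(1) V] open_curve_preimage[OF op(2) sm(2) V])
    have t1K1: "t1 \<in> K1" using t1K ca(2) T(2) by (auto simp: K1_def V_def)
    have deriv: "((\<lambda>s. \<phi> (\<beta> s)) has_vector_derivative X (Q (\<phi> (\<beta> s)))) (at s)"
      if L: "open L" "hamiltonian_curve N \<omega> H L \<beta>" "s \<in> L" "\<beta> s \<in> V" for L \<beta> s
    proof -
      have s: "\<beta> s \<in> U" "\<phi> (\<beta> s) \<in> T" using that by (auto simp: V_def)
      obtain \<xi> where \<xi>: "((\<lambda>s. \<phi> (\<beta> s)) has_vector_derivative \<xi>) (at s)" "\<xi> \<in> model N"
        "\<forall>w\<in>model N. local_form N (U, \<phi>) \<omega> (\<phi> (\<beta> s)) \<xi> w = fderiv (\<lambda>a. H (inv_into U \<phi> a)) (\<phi> ` U) (\<phi> (\<beta> s)) w"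
        by (rule hamiltonian_curve_chart[OF N H L(1,2) c L(3) s(1)])
      then show ?thesis using X[OF s(2) \<xi>(2)] Q[OF s(2)] by simp
    qed
    obtain d where d: "d > 0" "\<And>s. dist s t1 < d \<Longrightarrow> \<phi> (\<gamma> s) = \<phi> (\<eta> s)"
    proof (rule ode_local_unique[OF opT smX K1 t1K1, of "\<lambda>s. \<phi> (\<gamma> s)" "\<lambda>s. \<phi> (\<eta> s)"])
      show "\<phi> (\<gamma> t1) = \<phi> (\<eta> t1)" using t1K by simp
      show "\<phi> (\<gamma> s) \<in> Q -` T" "\<phi> (\<eta> s) \<in> Q -` T" if "s \<in> K1" for s
        using that Q by (auto simp: K1_def V_def)
      show "((\<lambda>s. \<phi> (\<gamma> s)) has_vector_derivative X (Q (\<phi> (\<gamma> s)))) (at s)" if "s \<in> K1" for s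
        using deriv[OF op(1) I(3)] that by (simp add: K1_def)
      show "((\<lambda>s. \<phi> (\<eta> s)) has_vector_derivative X (Q (\<phi> (\<eta> s)))) (at s)" if "s \<in> K1" for s
        using deriv[OF op(2) J(3)] that by (simp add: K1_def)
    qed blast
    obtain d' where d': "d' > 0" "\<And>s. dist s t1 < d' \<Longrightarrow> s \<in> K1" using K1 t1K1 unfolding open_dist by blast
    have "s \<in> Z" if "dist s t1 < min d d'" for s
    proof -
      have s: "s \<in> K1" "\<phi> (\<gamma> s) = \<phi> (\<eta> s)" using d(2) d'(2) that by auto
      then have "\<gamma> s = \<eta> s" using inj_onD[OF chart_inj[OF ch] s(2)] by (auto simp: K1_def V_def)
      then show ?thesis using s(1) by (auto simp: Z_def K_def K1_def)
    qed
    then show ?thesis using d(1) d'(1) by (intro exI[of _ "min d d'"]) auto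
  qed
  then have "open Z" unfolding open_dist by blast
  then have "openin (top_of_set K) Z" using K(1) openin_open_eq by (auto simp: Z_def)
  then have "Z = {} \<or> Z = K" using K(2) cl unfolding connected_clopen by blast
  moreover have "t0 \<in> Z" using K(3) eq by (simp add: Z_def)
  ultimately show ?thesis using K(4) by (auto simp: Z_def)
qed

section \<open>Slice charts of the hidden constraint set\<close>

text \<open>Here \<open>T\<close> may be open in a smaller subspace than \<open>S\<close>, as for a
  slice in a chart; the derivatives then agree only in directions of the smaller subspace.\<close>

lemma fderiv_restrict:
  assumes "smooth_on S f" "rel_open F T" "T \<subseteq> S" "x \<in> T" "v \<in> F"
  shows "fderiv f T x v = fderiv f S x v"
  using assms smooth_on_has_derivative[OF assms(1), of x]
  by (intro fderiv_eq[OF assms(2,4) has_derivative_subset[OF _ assms(3)] assms(5)]) blast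

text \<open>Leaving the new chart involves the smooth inverse \<open>g\<close>, entering it involves
  \<open>\<Theta>\<close>; both transitions are compositions with transitions of the old
  chart.\<close>

lemma chart_compose:
  fixes M :: "('p, 'e::euclidean_space) manifold"
  assumes M: "smooth_manifold M" and c: "(U, \<phi>) \<in> maximal_atlas M"
    and A: "rel_open (model M) A" "A \<subseteq> \<phi> ` U" and \<Theta>: "smooth_on A \<Theta>" "rel_open (model M) (\<Theta> ` A)"
    and g: "smooth_on (\<Theta> ` A) g" "\<And>y. y \<in> A \<Longrightarrow> g (\<Theta> y) = y"
  shows "(U \<inter> \<phi> -` A, \<lambda>x. \<Theta> (\<phi> x)) \<in> maximal_atlas M"
proof -
  note E = smooth_manifold_subspace[OF M]
  note ch = maximal_chart[OF c]
  define U' where "U' = U \<inter> \<phi> -` A"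
  have im: "\<phi> ` U' = A" using A(2) by (auto simp: U'_def)
  then have im': "(\<lambda>x. \<Theta> (\<phi> x)) ` U' = \<Theta> ` A" by (auto simp: image_iff)
  have op: "openin (mtop M) U'" unfolding U'_def by (rule chart_preimage_open[OF ch E A(1)])
  have "homeomorphic_map (subtopology (subtopology (mtop M) U) U') (subtopology (top_of_set (\<phi> ` U)) A) \<phi>"
  proof (rule homeomorphic_map_subtopologies[OF chart_homeo[OF ch]])
    show "\<phi> ` (topspace (subtopology (mtop M) U) \<inter> U') = topspace (top_of_set (\<phi> ` U)) \<inter> A"
      unfolding chart_topspace[OF ch] using im A(2) by (auto simp: U'_def)
  qed
  moreover have "U \<inter> U' = U'" "\<phi> ` U \<inter> A = A" using A(2) by (auto simp: U'_def)
  ultimately have h1: "homeomorphic_map (subtopology (mtop M) U') (top_of_set A) \<phi>"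
    by (simp add: subtopology_subtopology)
  have "homeomorphic_maps (top_of_set A) (top_of_set (\<Theta> ` A)) \<Theta> g"
    unfolding homeomorphic_maps_def using smooth_on_continuous_on[OF \<Theta>(1)] smooth_on_continuous_on[OF g(1)] g(2) by auto
  then have "homeomorphic_map (top_of_set A) (top_of_set (\<Theta> ` A)) \<Theta>" using homeomorphic_maps_map by blast
  from homeomorphic_map_compose[OF h1 this]
  have chart: "chart M (U', \<lambda>x. \<Theta> (\<phi> x))"
    unfolding chart_def using op \<Theta>(2) im' by (simp add: rel_open_def o_def)
  note ci = chart_inv[OF ch] chart_inv[OF chart]
  have "smooth_transition (U', \<lambda>x. \<Theta> (\<phi> x)) d \<and> smooth_transition d (U', \<lambda>x. \<Theta> (\<phi> x))" if d: "d \<in> atlas M" for d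
  proof -
    obtain V \<psi> where dV: "d = (V, \<psi>)" by (metis surj_pair)
    have dm: "(V, \<psi>) \<in> maximal_atlas M" using atlas_subset_maximal[OF M] d dV by blast
    note dch = chart_inv[OF maximal_chart[OF dm]]
    have "smooth_on ((\<lambda>x. \<Theta> (\<phi> x)) ` (U' \<inter> V)) (\<lambda>b. \<psi> (inv_into U \<phi> (g b)))"
    proof (rule smooth_on_compose[OF transition_smooth(2)[OF M c dm]])
      show "smooth_on ((\<lambda>x. \<Theta> (\<phi> x)) ` (U' \<inter> V)) g"
        by (rule smooth_on_subset[OF g(1)]) (auto simp: U'_def)
    qed (auto simp: U'_def g(2))
    then have "smooth_on ((\<lambda>x. \<Theta> (\<phi> x)) ` (U' \<inter> V)) (\<lambda>b. \<psi> (inv_into U' (\<lambda>x. \<Theta> (\<phi> x)) b))"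
    proof (rule smooth_on_cong)
      fix b assume "b \<in> (\<lambda>x. \<Theta> (\<phi> x)) ` (U' \<inter> V)"
      then obtain y where y: "y \<in> U'" "b = \<Theta> (\<phi> y)" by blast
      then have "y \<in> U" "\<phi> y \<in> A" by (auto simp: U'_def)
      then show "\<psi> (inv_into U \<phi> (g b)) = \<psi> (inv_into U' (\<lambda>x. \<Theta> (\<phi> x)) b)"
        using ci(1) ci(2)[OF y(1)] g(2) y(2) by simp
    qed
    moreover have "smooth_on (\<psi> ` (V \<inter> U')) (\<lambda>b. \<Theta> (\<phi> (inv_into V \<psi> b)))"
    proof (rule smooth_on_compose[OF \<Theta>(1)])
      show "smooth_on (\<psi> ` (V \<inter> U')) (\<lambda>b. \<phi> (inv_into V \<psi> b))"
        by (rule smooth_on_subset[OF transition_smooth(2)[OF M dm c]]) (auto simp: U'_def)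
    qed (auto simp: dch U'_def)
    ultimately show ?thesis unfolding dV smooth_transition_def by (simp add: o_def)
  qed
  then show ?thesis using chart unfolding maximal_atlas_def U'_def by blast
qed

section \<open>The constraint set and the fibres in charts\<close>

locale hidden_constraint =
  fixes M :: "('p, 'e::euclidean_space) manifold" and \<nu> :: "'p \<Rightarrow> 'e \<Rightarrow> 'e \<Rightarrow> real" and H :: "'p \<Rightarrow> real" and k :: nat
  assumes presymplectic: "presymplectic_manifold M \<nu>"
    and rank: "\<And>x. x \<in> points M \<Longrightarrow> dim (form_ker M \<nu> x) = k"
    and smooth_H: "smooth_map M real_line H"
    and nondegenerate: "\<And>z y. z \<in> points M \<Longrightarrow> critical_point (fibre M \<nu> z) H y \<Longrightarrow>
      nondegenerate_critical_point (fibre M \<nu> z) H y"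
begin

abbreviation S where "S \<equiv> hidden_constraint_set M \<nu> H"

abbreviation E where "E \<equiv> model M"

lemma M: "smooth_manifold M" and two_form: "smooth_two_form M \<nu>" and closed: "closed_two_form M \<nu>"
  using presymplectic unfolding presymplectic_manifold_def by auto

lemmas subspace_E = smooth_manifold_subspace[OF M]

lemma S_subset: "S \<subseteq> points M"
  unfolding hidden_constraint_set_def by blast

lemma form_ker_subset: "form_ker M \<nu> x \<subseteq> E"
  by (auto simp: form_ker_eq_kern kern_def)

lemma subspace_form_ker: "x \<in> points M \<Longrightarrow> subspace (form_ker M \<nu> x)"
  unfolding form_ker_eq_kern by (rule subspace_kern[OF smooth_two_form_skew[OF two_form] subspace_E])

text \<open>By \<open>skew_form_range\<close> a covector is in the range of the form iff it vanishes
  on the kernel; this replaces the existential condition by one on \<open>dH\<close> along the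
  kernel, in any maximal chart.\<close>

lemma hidden_chart:
  assumes c: "(U, \<phi>) \<in> maximal_atlas M" "x \<in> U"
  shows "x \<in> S \<longleftrightarrow> (\<forall>\<kappa>\<in>kern E (local_form M (U, \<phi>) \<nu> (\<phi> x)). fderiv (\<lambda>a. H (inv_into U \<phi> a)) (\<phi> ` U) (\<phi> x) \<kappa> = 0)"
proof -
  have x: "x \<in> points M" using chart_subset[OF maximal_chart[OF c(1)]] c(2) by blast
  have a: "\<phi> x \<in> \<phi> ` U" using c(2) by blast
  note sk = smooth_two_form_skew[OF two_form x]
  let ?l = "\<lambda>v. fderiv (\<lambda>a. H (inv_into U \<phi> a)) (\<phi> ` U) (\<phi> x) (coord M (U, \<phi>) x v)"
  have lin: "linear ?l"
    using linear_compose[OF linear_coord[OF M c] linear_fderiv[OF smooth_function_chart[OF M smooth_H c(1)] a]]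
    by (simp add: o_def)
  have dH: "differential M H x v = ?l v" if "v \<in> E" for v by (rule differential_chart[OF M smooth_H c that])
  have "x \<in> S \<longleftrightarrow> (\<exists>u\<in>E. \<forall>v\<in>E. ?l v = \<nu> x u v)"
    unfolding hidden_constraint_set_def tangent_space_def using x dH by simp
  also have "\<dots> \<longleftrightarrow> (\<forall>\<kappa>\<in>form_ker M \<nu> x. ?l \<kappa> = 0)"
  proof
    assume "\<exists>u\<in>E. \<forall>v\<in>E. ?l v = \<nu> x u v"
    then obtain u where u: "u \<in> E" "\<And>v. v \<in> E \<Longrightarrow> ?l v = \<nu> x u v" by blast
    show "\<forall>\<kappa>\<in>form_ker M \<nu> x. ?l \<kappa> = 0"
    proof
      fix \<kappa> assume "\<kappa> \<in> form_ker M \<nu> x"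
      then have \<kappa>: "\<kappa> \<in> E" "\<nu> x \<kappa> u = 0" using u(1) by (auto simp: form_ker_eq_kern kern_def)
      then show "?l \<kappa> = 0" using u(2)[OF \<kappa>(1)] skew_form_skew[OF sk u(1) \<kappa>(1)] by simp
    qed
  next
    assume "\<forall>\<kappa>\<in>form_ker M \<nu> x. ?l \<kappa> = 0"
    then show "\<exists>u\<in>E. \<forall>v\<in>E. ?l v = \<nu> x u v"
      using skew_form_range[OF sk subspace_E lin] unfolding form_ker_eq_kern by metis
  qed
  finally show ?thesis unfolding kern_local_form[OF M c] by simp
qed

lemma leaf_atlasE:
  assumes "c \<in> atlas (fibre M \<nu> z)"
  obtains W \<sigma> where "c = (\<sigma> ` W, inv_into W \<sigma>)" "integral_param M (form_ker M \<nu>) (form_ker M \<nu> z) W \<sigma>"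
  using assms by (auto simp: leaf_def leaf_atlas_def)

text \<open>Charts of a leaf are inverses of parametrizations, so the inverse of a chart is the
  parametrization again. This translates the leaf atlas into statements about
  \<open>\<sigma>\<close>.\<close>

lemma leaf_function:
  assumes "integral_param M D F W \<sigma>"
  shows "inv_into W \<sigma> ` \<sigma> ` W = W" "\<And>u. u \<in> W \<Longrightarrow> inv_into (\<sigma> ` W) (inv_into W \<sigma>) u = \<sigma> u"
    "\<And>u. u \<in> W \<Longrightarrow> fderiv (f \<circ> inv_into (\<sigma> ` W) (inv_into W \<sigma>)) W u = fderiv (\<lambda>u. f (\<sigma> u)) W u"
proof -
  have inj: "inj_on \<sigma> W" and W: "rel_open F W"
    using assms by (auto simp: integral_param_def rel_open_def)
  show "inv_into W \<sigma> ` \<sigma> ` W = W" using inj by (simp add: inv_into_image_cancel)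
  show e: "inv_into (\<sigma> ` W) (inv_into W \<sigma>) u = \<sigma> u" if "u \<in> W" for u
    using that inj by (intro inv_into_f_eq[OF inj_on_inv_into]) auto
  show "fderiv (f \<circ> inv_into (\<sigma> ` W) (inv_into W \<sigma>)) W u = fderiv (\<lambda>u. f (\<sigma> u)) W u" if "u \<in> W" for u
    by (rule fderiv_rel_cong[OF W W W order_refl order_refl that]) (simp add: e)
qed

text \<open>At a constraint point \<open>dH\<close> vanishes on the kernel, to which every leaf
  chart is tangent, so the point is critical on its fibre. Taking the fibre through \<open>x\<close>
  itself makes the kernel at \<open>x\<close> the model of the leaf.\<close>

lemma nondegenerate_leaf_chart:
  assumes x: "x \<in> S"
  obtains W \<sigma> u0 where "integral_param M (form_ker M \<nu>) (form_ker M \<nu> x) W \<sigma>" "u0 \<in> W" "\<sigma> u0 = x"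
    "\<And>a. a \<in> form_ker M \<nu> x \<Longrightarrow>
      \<forall>b\<in>form_ker M \<nu> x. fderiv (\<lambda>u. fderiv (\<lambda>u. H (\<sigma> u)) W u a) W u0 b = 0 \<Longrightarrow> a = 0"
proof -
  let ?K = "form_ker M \<nu>"
  have xM: "x \<in> points M" using x S_subset by blast
  obtain U \<phi> where "(U, \<phi>) \<in> atlas M" "x \<in> U" by (rule atlas_cover[OF M xM])
  then have c: "(U, \<phi>) \<in> maximal_atlas M" "x \<in> U" using atlas_subset_maximal[OF M] by auto
  let ?h = "\<lambda>a. H (inv_into U \<phi> a)"
  have "critical_point (fibre M \<nu> x) H x"
    unfolding critical_point_def
  proof (intro conjI ballI, safe)
    \<comment> \<open>The empty chain of plaques joins \<open>x\<close> to itself.\<close>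
    have "x \<in> leaf_set M ?K x" by (simp add: leaf_set_def)
    then show "x \<in> points (fibre M \<nu> x)" by (simp add: points_def leaf_def)
    fix V \<psi> v assume "(V, \<psi>) \<in> atlas (fibre M \<nu> x)" "x \<in> V" and v: "v \<in> model (fibre M \<nu> x)"
    then obtain W \<sigma> where W\<sigma>: "V = \<sigma> ` W" "\<psi> = inv_into W \<sigma>" and p: "integral_param M ?K (?K x) W \<sigma>"
      by (auto elim: leaf_atlasE)
    have v: "v \<in> ?K x" using v by (simp add: leaf_def)
    have W: "rel_open (?K x) W" and inj: "inj_on \<sigma> W" and sm: "smooth_map (flat (?K x) W) M \<sigma>"
      using p by (auto simp: integral_param_def rel_open_def)
    obtain u0 where u0: "u0 \<in> W" "\<sigma> u0 = x" using W\<sigma> \<open>x \<in> V\<close> by auto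
    have \<psi>x: "\<psi> x = u0" using u0 inj W\<sigma> by auto
    note pc = param_chart[OF M W sm c(1)]
    let ?W' = "W \<inter> \<sigma> -` U"
    have u0': "u0 \<in> ?W'" using u0 c(2) by simp
    have "fderiv (\<lambda>u. H (\<sigma> u)) W u0 v = fderiv (\<lambda>u. ?h (\<phi> (\<sigma> u))) ?W' u0 v"
      by (rule arg_cong[of _ _ "\<lambda>F. F v"], rule fderiv_rel_cong[OF W pc(1) pc(1) _ order_refl u0'])
        (auto simp: chart_inv[OF maximal_chart[OF c(1)]])
    also have "\<dots> = fderiv ?h (\<phi> ` U) (\<phi> x) (fderiv (\<lambda>u. \<phi> (\<sigma> u)) ?W' u0 v)"
      using fderiv_compose[OF pc(1,2) smooth_function_chart[OF M smooth_H c(1)] _ u0' v] u0(2) by auto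
    also have "fderiv (\<lambda>u. \<phi> (\<sigma> u)) ?W' u0 v = coord M (U, \<phi>) x (tmap (flat (?K x) W) M \<sigma> u0 v)"
      using pc(3)[OF u0(1) _ v] u0(2) c(2) by simp
    \<comment> \<open>The tangent map of \<open>\<sigma>\<close> takes \<open>v\<close> into the
      kernel at \<open>x\<close>, where \<open>dH\<close> vanishes.\<close>
    also have "fderiv ?h (\<phi> ` U) (\<phi> x) \<dots> = 0"
    proof -
      have "tmap (flat (?K x) W) M \<sigma> u0 v \<in> ?K x"
        using p u0 v by (auto simp: integral_param_def bij_betw_def)
      then show ?thesis using x unfolding hidden_chart[OF c] kern_local_form[OF M c] by blast
    qed
    finally have "fderiv (\<lambda>u. H (\<sigma> u)) W u0 v = 0" .
    then show "fderiv (H \<circ> inv_into V \<psi>) (\<psi> ` V) (\<psi> x) v = 0"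
      unfolding \<psi>x unfolding W\<sigma> leaf_function(1)[OF p] leaf_function(3)[OF p u0(1)] .
  qed
  then have "nondegenerate_critical_point (fibre M \<nu> x) H x" by (rule nondegenerate[OF xM])
  then obtain c where cl: "c \<in> atlas (fibre M \<nu> x)" "x \<in> fst c"
    and nd: "\<And>a. a \<in> model (fibre M \<nu> x) \<Longrightarrow> \<forall>b\<in>model (fibre M \<nu> x). hessian c H x a b = 0 \<Longrightarrow> a = 0"
    unfolding nondegenerate_critical_point_def by blast
  obtain W \<sigma> where cW: "c = (\<sigma> ` W, inv_into W \<sigma>)" and p: "integral_param M ?K (?K x) W \<sigma>"
    using cl(1) by (rule leaf_atlasE)
  have W: "rel_open (?K x) W" and inj: "inj_on \<sigma> W" using p by (auto simp: integral_param_def rel_open_def)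
  obtain u0 where u0: "u0 \<in> W" "\<sigma> u0 = x" using cW cl(2) by auto
  have ix: "inv_into W \<sigma> x = u0" using u0 inj by auto
  have hess: "hessian c H x a b = fderiv (\<lambda>u. fderiv (\<lambda>u. H (\<sigma> u)) W u a) W u0 b" for a b
  proof -
    have "hessian c H x a b = fderiv (\<lambda>u. fderiv (H \<circ> inv_into (\<sigma> ` W) (inv_into W \<sigma>)) W u a) W u0 b"
      unfolding hessian_def cW prod.case ix leaf_function(1)[OF p] ..
    also have "\<dots> = fderiv (\<lambda>u. fderiv (\<lambda>u. H (\<sigma> u)) W u a) W u0 b"
      by (rule arg_cong[of _ _ "\<lambda>F. F b"], rule fderiv_rel_cong[OF W W W order_refl order_refl u0(1)])
        (simp only: leaf_function(3)[OF p])
    finally show ?thesis .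
  qed
  have "model (fibre M \<nu> x) = ?K x" by (simp add: leaf_def)
  then show ?thesis using that[OF p u0] nd hess by simp
qed

lemma dim_kern_local_form:
  assumes c: "(U, \<phi>) \<in> maximal_atlas M" and a: "a \<in> \<phi> ` U"
  shows "dim (kern E (local_form M (U, \<phi>) \<nu> a)) = k"
proof -
  obtain x where x: "x \<in> U" "a = \<phi> x" using a by blast
  have xM: "x \<in> points M" using chart_subset[OF maximal_chart[OF c]] x(1) by blast
  have "inj_on (coord M (U, \<phi>) x) (span (form_ker M \<nu> x))"
    using coord_bij[OF M c x(1)] form_ker_subset span_eq_iff[THEN iffD2, OF subspace_form_ker[OF xM]]
    by (metis bij_betw_def inj_on_subset)
  from dim_image_eq[OF linear_coord[OF M c x(1)] this]
  show ?thesis unfolding x(2) kern_local_form[OF M c x(1)] rank[OF xM] .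
qed

text \<open>The subspace \<open>F\<close> is prescribed independently of \<open>x\<close>, so that
  charts at all points together form the atlas of one submanifold. The last conclusion is the
  transversality needed for the splitting of the tangent space.\<close>

lemma slice_chart_exists:
  assumes x: "x \<in> S" and F: "subspace F" "F \<subseteq> E" "dim F + k = dim E"
  obtains U \<phi> where "(U, \<phi>) \<in> slice_charts M F S" "x \<in> U"
    "\<And>v. v \<in> form_ker M \<nu> x \<Longrightarrow> coord M (U, \<phi>) x v \<in> F \<Longrightarrow> v = 0"
proof -
  let ?K = "form_ker M \<nu>"
  have xM: "x \<in> points M" using x S_subset by blast
  obtain U \<phi> where "(U, \<phi>) \<in> atlas M" "x \<in> U" by (rule atlas_cover[OF M xM])
  then have c: "(U, \<phi>) \<in> maximal_atlas M" "x \<in> U" using atlas_subset_maximal[OF M] by auto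
  note ch = maximal_chart[OF c(1)]
  let ?h = "\<lambda>a. H (inv_into U \<phi> a)" and ?lf = "local_form M (U, \<phi>) \<nu>"
  note h = smooth_function_chart[OF M smooth_H c(1)]
  obtain W \<sigma> u0 where p: "integral_param M ?K (?K x) W \<sigma>" and u0: "u0 \<in> W" "\<sigma> u0 = x"
    and nd: "\<And>a. a \<in> ?K x \<Longrightarrow> \<forall>b\<in>?K x. fderiv (\<lambda>u. fderiv (\<lambda>u. H (\<sigma> u)) W u a) W u0 b = 0 \<Longrightarrow> a = 0"
    by (rule nondegenerate_leaf_chart[OF x]) (rule that)
  have W: "rel_open (?K x) W" and sm: "smooth_map (flat (?K x) W) M \<sigma>"
    using p by (auto simp: integral_param_def rel_open_def)
  have tm: "bij_betw (tmap (flat (?K x) W) M \<sigma> u) (?K x) (?K (\<sigma> u))" if "u \<in> W" for u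
    using p that by (simp add: integral_param_def)
  note pc = param_chart[OF M W sm c(1)]
  let ?W' = "W \<inter> \<sigma> -` U"
  have u0': "u0 \<in> ?W'" using u0 c(2) by simp
  obtain A \<Theta> g where A: "rel_open E A" "\<phi> x \<in> A" "A \<subseteq> \<phi> ` U" and \<Theta>: "smooth_on A \<Theta>" "rel_open E (\<Theta> ` A)"
    and g: "smooth_on (\<Theta> ` A) g" "\<And>y. y \<in> A \<Longrightarrow> g (\<Theta> y) = y"
    and \<Theta>F: "\<And>y. y \<in> A \<Longrightarrow> \<Theta> y \<in> F \<longleftrightarrow> (\<forall>\<kappa>\<in>kern E (?lf y). fderiv ?h (\<phi> ` U) y \<kappa> = 0)"
    and tr: "\<And>v. v \<in> kern E (?lf (\<phi> x)) \<Longrightarrow> fderiv \<Theta> A (\<phi> x) v \<in> F \<Longrightarrow> v = 0"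
  proof (rule local_slice[where lf = ?lf and h = ?h and k = k and \<sigma> = "\<lambda>u. \<phi> (\<sigma> u)"])
    show "rel_open E (\<phi> ` U)" by (rule chart_rel_open[OF ch subspace_E])
    show "\<phi> x \<in> \<phi> ` U" using c(2) by blast
    show "skew_form E (?lf a)" if "a \<in> \<phi> ` U" for a by (rule local_form_skew[OF M two_form c(1) that])
    show "smooth_on (\<phi> ` U) (\<lambda>a. ?lf a v w)" if "v \<in> E" "w \<in> E" for v w
      by (rule local_form_smooth[OF M two_form c(1) that])
    show "dim (kern E (?lf a)) = k" if "a \<in> \<phi> ` U" for a by (rule dim_kern_local_form[OF c(1) that])
    show "smooth_on (\<phi> ` U) ?h" by (rule h)
    show "fderiv ?h (\<phi> ` U) (\<phi> x) \<kappa> = 0" if "\<kappa> \<in> kern E (?lf (\<phi> x))" for \<kappa>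
      using x that unfolding hidden_chart[OF c] by blast
    show "rel_open (?K x) ?W'" by (rule pc(1))
    show "u0 \<in> ?W'" by (rule u0')
    show "smooth_on ?W' (\<lambda>u. \<phi> (\<sigma> u))" by (rule pc(2))
    show "(\<lambda>u. \<phi> (\<sigma> u)) ` ?W' \<subseteq> \<phi> ` U" by blast
    show "\<phi> (\<sigma> u0) = \<phi> x" using u0 by simp
    show "fderiv (\<lambda>u. \<phi> (\<sigma> u)) ?W' u a \<in> kern E (?lf (\<phi> (\<sigma> u)))" if "u \<in> ?W'" "a \<in> ?K x" for u a
    proof -
      have u: "u \<in> W" "\<sigma> u \<in> U" using that(1) by auto
      have "tmap (flat (?K x) W) M \<sigma> u a \<in> ?K (\<sigma> u)" using tm[OF u(1)] that(2) by (auto simp: bij_betw_def)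
      then show ?thesis using pc(3)[OF u that(2)] kern_local_form[OF M c(1) u(2), of \<nu>] by (metis imageI)
    qed
    show "kern E (?lf (\<phi> x)) \<subseteq> fderiv (\<lambda>u. \<phi> (\<sigma> u)) ?W' u0 ` ?K x"
    proof
      fix \<kappa> assume "\<kappa> \<in> kern E (?lf (\<phi> x))"
      then obtain v where v: "v \<in> ?K x" "\<kappa> = coord M (U, \<phi>) x v" unfolding kern_local_form[OF M c] by blast
      then obtain b where b: "b \<in> ?K x" "v = tmap (flat (?K x) W) M \<sigma> u0 b"
        using tm[OF u0(1)] u0(2) by (auto simp: bij_betw_def)
      then have "\<kappa> = fderiv (\<lambda>u. \<phi> (\<sigma> u)) ?W' u0 b" using pc(3)[OF u0(1) _ b(1)] u0(2) c(2) v(2) by simp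
      then show "\<kappa> \<in> fderiv (\<lambda>u. \<phi> (\<sigma> u)) ?W' u0 ` ?K x" using b(1) by blast
    qed
    fix a assume a: "a \<in> ?K x"
      and z: "\<And>b. b \<in> ?K x \<Longrightarrow> fderiv (\<lambda>u. fderiv (\<lambda>u. ?h (\<phi> (\<sigma> u))) ?W' u a) ?W' u0 b = 0"
    show "a = 0"
    proof (rule nd[OF a], rule ballI)
      fix b assume b: "b \<in> ?K x"
      \<comment> \<open>Where \<open>\<sigma>\<close> stays in the chart, the coordinate expression
        of \<open>H\<close> along \<open>\<sigma>\<close> is \<open>H\<close> along
        \<open>\<sigma>\<close>; hence shrinking \<open>W\<close> does not change the Hessian at
        \<open>u0\<close>.\<close>
      have e: "fderiv (\<lambda>u. ?h (\<phi> (\<sigma> u))) ?W' u = fderiv (\<lambda>u. H (\<sigma> u)) W u" if "u \<in> ?W'" for u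
        by (rule fderiv_rel_cong[OF pc(1) W pc(1) order_refl _ that]) (auto simp: chart_inv[OF ch])
      have "fderiv (\<lambda>u. fderiv (\<lambda>u. ?h (\<phi> (\<sigma> u))) ?W' u a) ?W' u0 = fderiv (\<lambda>u. fderiv (\<lambda>u. H (\<sigma> u)) W u a) W u0"
        by (rule fderiv_rel_cong[OF pc(1) W pc(1) order_refl _ u0']) (auto simp: e)
      then show "fderiv (\<lambda>u. fderiv (\<lambda>u. H (\<sigma> u)) W u a) W u0 b = 0" using z[OF b] by simp
    qed
  qed (rule F | rule that | assumption)+
  define U' where "U' = U \<inter> \<phi> -` A"
  have c': "(U', \<lambda>x. \<Theta> (\<phi> x)) \<in> maximal_atlas M"
    unfolding U'_def by (rule chart_compose[OF M c(1) A(1,3) \<Theta> g])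
  have "\<Theta> (\<phi> y) \<in> F \<longleftrightarrow> y \<in> S" if "y \<in> U'" for y
    using \<Theta>F[of "\<phi> y"] hidden_chart[OF c(1), of y] that by (simp add: U'_def)
  then have "(\<lambda>x. \<Theta> (\<phi> x)) ` (U' \<inter> S) = (\<lambda>x. \<Theta> (\<phi> x)) ` U' \<inter> F" by auto
  then have slice: "(U', \<lambda>x. \<Theta> (\<phi> x)) \<in> slice_charts M F S" using c' by (simp add: slice_charts_def)
  have x': "x \<in> U'" using c(2) A(2) by (simp add: U'_def)
  have im: "\<phi> ` (U \<inter> U') = A" using A(3) by (auto simp: U'_def)
  show ?thesis
  proof (rule that[OF slice x'])
    fix v assume v: "v \<in> ?K x" "coord M (U', \<lambda>x. \<Theta> (\<phi> x)) x v \<in> F"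
    have vE: "v \<in> E" using v(1) form_ker_subset by blast
    \<comment> \<open>Tangent coordinates in the new chart are those in the old one followed by the
      derivative of \<open>\<Theta>\<close>, which brings the question back to the transversality in
      coordinates.\<close>
    have "coord M (U', \<lambda>x. \<Theta> (\<phi> x)) x v = fderiv (\<lambda>a. \<Theta> (\<phi> (inv_into U \<phi> a))) A (\<phi> x) (coord M (U, \<phi>) x v)"
      using coord_transition[OF M c c' x' vE] unfolding im .
    also have "\<dots> = fderiv \<Theta> A (\<phi> x) (coord M (U, \<phi>) x v)"
      by (rule arg_cong[of _ _ "\<lambda>F. F (coord M (U, \<phi>) x v)"],
          rule fderiv_rel_cong[OF A(1) A(1) A(1) order_refl order_refl A(2)])
        (use A(3) in \<open>auto simp: f_inv_into_f subset_iff\<close>)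
    finally have "coord M (U, \<phi>) x v = 0"
      using tr[of "coord M (U, \<phi>) x v"] v unfolding kern_local_form[OF M c] by simp
    then show "v = 0" using coord_eqD[OF M c vE subspace_0[OF subspace_E]] linear_0[OF linear_coord[OF M c]] by simp
  qed
qed

end

section \<open>The symplectic manifold of hidden constraints\<close>

text \<open>The two charts share the coordinate map and differ only in their domains, a difference
  that the curve does not see. Stated symmetrically in the two manifolds to serve both
  directions.\<close>

lemma smooth_curve_transfer:
  assumes M: "smooth_manifold M" and N: "smooth_manifold N" and I: "open I" and sm: "smooth_map (interval_manifold I) M \<gamma>"
    and cont: "continuous_map (top_of_set I) (mtop N) \<gamma>"
    and charts: "\<And>t. t \<in> I \<Longrightarrow> \<exists>U V \<phi>. (U, \<phi>) \<in> maximal_atlas M \<and> (V, \<phi>) \<in> maximal_atlas N \<and> \<gamma> t \<in> U \<and> \<gamma> t \<in> V \<and>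
      I \<inter> \<gamma> -` U = I \<inter> \<gamma> -` V"
  shows "smooth_map (interval_manifold I) N \<gamma>"
proof -
  have ro: "rel_open UNIV I" using I by (simp add: rel_open_UNIV)
  note fl = flat_smooth_manifold[OF ro]
  show ?thesis
  proof (rule smooth_mapI[OF fl N])
    fix t assume "t \<in> points (interval_manifold I)"
    then have t: "t \<in> I" by simp
    obtain U V \<phi> where c: "(U, \<phi>) \<in> maximal_atlas M" "(V, \<phi>) \<in> maximal_atlas N" "\<gamma> t \<in> V" "I \<inter> \<gamma> -` U = I \<inter> \<gamma> -` V"
      using charts[OF t] by blast
    then have "smooth_on (id ` (I \<inter> \<gamma> -` V)) (\<lambda>a. \<phi> (\<gamma> (inv_into I id a)))"
      using smooth_map_maximal(2)[OF fl M sm flat_chart[OF ro] c(1)] by simp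
    then show "\<exists>V \<psi> V' \<psi>'. (V, \<psi>) \<in> maximal_atlas (interval_manifold I) \<and> (V', \<psi>') \<in> maximal_atlas N \<and> t \<in> V \<and>
        \<gamma> t \<in> V' \<and> smooth_on (\<psi> ` (V \<inter> \<gamma> -` V')) (\<lambda>a. \<psi>' (\<gamma> (inv_into V \<psi> a)))"
      using flat_chart[OF ro] c t by blast
  qed (use cont in simp)
qed

text \<open>The dimension identity is conditional because on an empty manifold \<open>k\<close> is
  arbitrary and may exceed the dimension of the model.\<close>

locale hidden_constraint_slices = hidden_constraint +
  fixes F :: "'b set"
  assumes F: "subspace F" "F \<subseteq> model M" and dim_F: "hidden_constraint_set M \<nu> H \<noteq> {} \<Longrightarrow> dim F + k = dim (model M)"
begin

abbreviation N where "N \<equiv> submfd M F S"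

abbreviation \<omega> where "\<omega> \<equiv> pullback N M id \<nu>"

lemma slice_cover:
  assumes "x \<in> S"
  obtains U \<phi> where "(U, \<phi>) \<in> slice_charts M F S" "x \<in> U"
    "\<And>v. v \<in> form_ker M \<nu> x \<Longrightarrow> coord M (U, \<phi>) x v \<in> F \<Longrightarrow> v = 0"
  using slice_chart_exists[OF assms F dim_F] assms that by blast

lemma submanifold_S: "submanifold M F S"
  unfolding submanifold_def using F S_subset slice_cover by (metis fst_conv)

lemma slice_maximal: "(U, \<phi>) \<in> slice_charts M F S \<Longrightarrow> (U, \<phi>) \<in> maximal_atlas M"
  by (simp add: slice_charts_def)

lemma slice_image: "(U, \<phi>) \<in> slice_charts M F S \<Longrightarrow> \<phi> ` (U \<inter> S) = \<phi> ` U \<inter> F"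
  by (simp add: slice_charts_def)

lemma slice_rel_open:
  assumes "(U, \<phi>) \<in> slice_charts M F S"
  shows "rel_open F (\<phi> ` (U \<inter> S))"
proof -
  have "rel_open E (\<phi> ` U)" by (rule chart_rel_open[OF maximal_chart[OF slice_maximal[OF assms]] subspace_E])
  then obtain T where T: "open T" "\<phi> ` U = E \<inter> T" unfolding rel_open_def openin_open by blast
  have "\<phi> ` (U \<inter> S) = F \<inter> T" unfolding slice_image[OF assms] T(2) using F(2) by blast
  then show ?thesis unfolding rel_open_def openin_open using F(1) T(1) by blast
qed

lemma N_simps [simp]: "mtop N = subtopology (mtop M) S" "model N = F"
  "atlas N = (\<lambda>(U, \<phi>). (U \<inter> S, \<phi>)) ` slice_charts M F S"
  by (simp_all add: submfd_def)

lemma points_N [simp]: "points N = S"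
  using S_subset unfolding points_def by (auto simp: submfd_def)

lemma inv_into_slice:
  assumes "(U, \<phi>) \<in> slice_charts M F S" "a \<in> \<phi> ` (U \<inter> S)"
  shows "inv_into (U \<inter> S) \<phi> a = inv_into U \<phi> a"
proof -
  note ch = chart_inj[OF maximal_chart[OF slice_maximal[OF assms(1)]]]
  obtain x where "x \<in> U \<inter> S" "a = \<phi> x" using assms(2) by blast
  then show ?thesis using inv_into_f_f[OF ch] inv_into_f_f[OF inj_on_subset[OF ch], of "U \<inter> S"] by simp
qed

lemma chart_N:
  assumes c: "(U, \<phi>) \<in> slice_charts M F S"
  shows "chart N (U \<inter> S, \<phi>)"
proof -
  note ch = maximal_chart[OF slice_maximal[OF c]]
  have "homeomorphic_map (subtopology (subtopology (mtop M) U) (U \<inter> S)) (subtopology (top_of_set (\<phi> ` U)) (\<phi> ` (U \<inter> S))) \<phi>"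
  proof (rule homeomorphic_map_subtopologies[OF chart_homeo[OF ch]])
    show "\<phi> ` (topspace (subtopology (mtop M) U) \<inter> (U \<inter> S)) = topspace (top_of_set (\<phi> ` U)) \<inter> \<phi> ` (U \<inter> S)"
      unfolding chart_topspace[OF ch] by auto
  qed
  moreover have "\<phi> ` U \<inter> \<phi> ` (U \<inter> S) = \<phi> ` (U \<inter> S)" "U \<inter> (U \<inter> S) = U \<inter> S" "S \<inter> (U \<inter> S) = U \<inter> S" by auto
  ultimately have "homeomorphic_map (subtopology (mtop N) (U \<inter> S)) (top_of_set (\<phi> ` (U \<inter> S))) \<phi>"
    by (simp add: subtopology_subtopology)
  moreover have "openin (mtop N) (U \<inter> S)" using chart_openin[OF ch] by (auto simp: openin_subtopology)
  ultimately show ?thesis unfolding chart_def using slice_rel_open[OF c] by (simp add: rel_open_def)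
qed

lemma smooth_manifold_N: "smooth_manifold N"
proof -
  have M': "Hausdorff_space (mtop M)" "second_countable (mtop M)" using M by (auto simp: smooth_manifold_def)
  have "\<Union> (fst ` atlas N) = points N"
  proof
    show "points N \<subseteq> \<Union> (fst ` atlas N)"
    proof
      fix x assume "x \<in> points N"
      then have x: "x \<in> S" by simp
      obtain U \<phi> where "(U, \<phi>) \<in> slice_charts M F S" "x \<in> U" by (rule slice_cover[OF x])
      then show "x \<in> \<Union> (fst ` atlas N)" using x by (auto intro!: bexI[of _ "(U, \<phi>)"])
    qed
  qed auto
  moreover have "smooth_transition (U \<inter> S, \<phi>) (V \<inter> S, \<psi>)"
    if c: "(U, \<phi>) \<in> slice_charts M F S" and d: "(V, \<psi>) \<in> slice_charts M F S" for U \<phi> V \<psi>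
  proof -
    have "smooth_on (\<phi> ` (U \<inter> S \<inter> (V \<inter> S))) (\<lambda>a. \<psi> (inv_into U \<phi> a))"
      by (rule smooth_on_subset[OF transition_smooth(2)[OF M slice_maximal[OF c] slice_maximal[OF d]]]) blast
    then have "smooth_on (\<phi> ` (U \<inter> S \<inter> (V \<inter> S))) (\<lambda>a. \<psi> (inv_into (U \<inter> S) \<phi> a))"
      by (rule smooth_on_cong) (auto simp: inv_into_slice[OF c])
    then show ?thesis unfolding smooth_transition_def by (simp add: o_def)
  qed
  moreover have "\<forall>c\<in>atlas N. chart N c" using chart_N by auto
  moreover have "Hausdorff_space (mtop N)" "second_countable (mtop N)" "subspace (model N)"
    using M' F(1) Hausdorff_space_subtopology second_countable_subtopology by auto
  ultimately show ?thesis unfolding smooth_manifold_def by auto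
qed

lemma N_maximal: "(U, \<phi>) \<in> slice_charts M F S \<Longrightarrow> (U \<inter> S, \<phi>) \<in> maximal_atlas N"
  by (rule subsetD[OF atlas_subset_maximal[OF smooth_manifold_N]]) (auto simp: image_iff intro: bexI[of _ "(U, \<phi>)"])

lemma N_chart_cover:
  assumes "x \<in> S"
  obtains U \<phi> where "(U, \<phi>) \<in> slice_charts M F S" "x \<in> U" "x \<in> U \<inter> S" "(U, \<phi>) \<in> maximal_atlas M" "(U \<inter> S, \<phi>) \<in> maximal_atlas N"
  using slice_cover[OF assms] slice_maximal N_maximal assms by (metis IntI)

lemma smooth_inclusion: "smooth_map N M id"
proof (rule smooth_mapI[OF smooth_manifold_N M])
  show "continuous_map (mtop N) (mtop M) id" by (simp add: continuous_map_from_subtopology)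
  fix x assume "x \<in> points N"
  then have x: "x \<in> S" by simp
  obtain U \<phi> where c: "(U, \<phi>) \<in> slice_charts M F S" "x \<in> U" "x \<in> U \<inter> S" "(U, \<phi>) \<in> maximal_atlas M" "(U \<inter> S, \<phi>) \<in> maximal_atlas N"
    by (rule N_chart_cover[OF x])
  have "smooth_on (\<phi> ` (U \<inter> S \<inter> id -` U)) (\<lambda>a. \<phi> (id (inv_into (U \<inter> S) \<phi> a)))"
    by (rule smooth_on_cong[OF smooth_on_id]) (auto simp: chart_inv[OF maximal_chart[OF c(5)]])
  then show "\<exists>V \<psi> V' \<psi>'. (V, \<psi>) \<in> maximal_atlas N \<and> (V', \<psi>') \<in> maximal_atlas M \<and> x \<in> V \<and> id x \<in> V' \<and>
      smooth_on (\<psi> ` (V \<inter> id -` V')) (\<lambda>a. \<psi>' (id (inv_into V \<psi> a)))"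
    using c by (metis id_apply)
qed

section \<open>The tangent space of the constraint set\<close>

text \<open>A slice chart and its restriction have the same coordinate map, so the inclusion is the
  identity in coordinates.\<close>

lemma coord_inclusion:
  assumes c: "(U, \<phi>) \<in> slice_charts M F S" and x: "x \<in> U \<inter> S" and v: "v \<in> F"
  shows "coord M (U, \<phi>) x (tmap N M id x v) = coord N (U \<inter> S, \<phi>) x v"
proof -
  note cN = N_maximal[OF c]
  note chN = maximal_chart[OF cN]
  note ro = slice_rel_open[OF c]
  have a: "\<phi> x \<in> \<phi> ` (U \<inter> S)" using x by blast
  have s: "U \<inter> S \<inter> id -` U = U \<inter> S" by auto
  have vN: "coord N (U \<inter> S, \<phi>) x v \<in> F" using coord_in[OF smooth_manifold_N cN x] v by simp
  have "coord M (U, \<phi>) x (tmap N M id x v) =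
      fderiv (\<lambda>a. \<phi> (id (inv_into (U \<inter> S) \<phi> a))) (\<phi> ` (U \<inter> S)) (\<phi> x) (coord N (U \<inter> S, \<phi>) x v)"
    using coord_tmap[OF smooth_manifold_N M smooth_inclusion cN x slice_maximal[OF c], of v] x v s by simp
  also have "\<dots> = coord N (U \<inter> S, \<phi>) x v"
    unfolding id_apply by (rule chart_self_transition[OF chN _ x]) (simp_all add: F(1) vN)
  finally show ?thesis .
qed

lemma inclusion_in: "x \<in> S \<Longrightarrow> v \<in> F \<Longrightarrow> tmap N M id x v \<in> E"
  using tmap_in[OF smooth_manifold_N M smooth_inclusion] by simp

text \<open>Describes the tangent space through one slice chart while the left side mentions no
  chart, so the condition on the right is the same for all slice charts at \<open>x\<close>.\<close>

lemma sub_tangent_space_chart: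
  assumes c: "(U, \<phi>) \<in> slice_charts M F S" and x: "x \<in> U \<inter> S"
  shows "sub_tangent_space M F S x = {v \<in> E. coord M (U, \<phi>) x v \<in> F}"
proof -
  note cN = N_maximal[OF c]
  have xU: "x \<in> U" using x by blast
  have "sub_tangent_space M F S x = tmap N M id x ` F" by (simp add: sub_tangent_space_def tangent_space_def)
  also have "\<dots> = {v \<in> E. coord M (U, \<phi>) x v \<in> F}"
  proof (intro set_eqI iffI)
    fix v assume "v \<in> tmap N M id x ` F"
    then obtain w where w: "w \<in> F" "v = tmap N M id x w" by blast
    then show "v \<in> {v \<in> E. coord M (U, \<phi>) x v \<in> F}"
      using inclusion_in[of x w] x coord_inclusion[OF c x w(1)] coord_in[OF smooth_manifold_N cN x, of w] by simp
  next
    fix v assume v: "v \<in> {v \<in> E. coord M (U, \<phi>) x v \<in> F}"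
    then obtain w where w: "w \<in> F" "coord N (U \<inter> S, \<phi>) x w = coord M (U, \<phi>) x v"
      using coord_surj[OF smooth_manifold_N cN x, of "coord M (U, \<phi>) x v"] by auto
    have "v = tmap N M id x w"
    proof (rule coord_eqD[OF M slice_maximal[OF c] xU])
      show "coord M (U, \<phi>) x v = coord M (U, \<phi>) x (tmap N M id x w)"
        unfolding coord_inclusion[OF c x w(1)] w(2) ..
    qed (use v inclusion_in[of x w] x w(1) in auto)
    then show "v \<in> tmap N M id x ` F" using w(1) by blast
  qed
  finally show ?thesis .
qed

text \<open>Transversality is constructed for one slice chart at each point; the tangent space of
  the submanifold carries it to every other slice chart.\<close>

lemma slice_transverse:
  assumes c: "(U, \<phi>) \<in> slice_charts M F S" and x: "x \<in> U \<inter> S"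
    and v: "v \<in> form_ker M \<nu> x" "coord M (U, \<phi>) x v \<in> F"
  shows "v = 0"
proof -
  have xS: "x \<in> S" using x by blast
  obtain V \<psi> where d: "(V, \<psi>) \<in> slice_charts M F S" "x \<in> V"
    and tr: "\<And>v. v \<in> form_ker M \<nu> x \<Longrightarrow> coord M (V, \<psi>) x v \<in> F \<Longrightarrow> v = 0"
    by (rule slice_cover[OF xS]) (rule that)
  have "v \<in> sub_tangent_space M F S x"
    unfolding sub_tangent_space_chart[OF c x] using v form_ker_subset by blast
  then have "coord M (V, \<psi>) x v \<in> F"
    using sub_tangent_space_chart[OF d(1), of x] d(2) xS by simp
  then show ?thesis using tr v(1) by blast
qed

text \<open>Transversality gives trivial intersection, and then the dimensions of \<open>F\<close>
  and the kernel add up to that of \<open>E\<close>.\<close>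

lemma slice_decomposition:
  assumes c: "(U, \<phi>) \<in> slice_charts M F S" and x: "x \<in> U \<inter> S"
  shows "F \<inter> kern E (local_form M (U, \<phi>) \<nu> (\<phi> x)) = {0}"
    and "{f + \<kappa> |f \<kappa>. f \<in> F \<and> \<kappa> \<in> kern E (local_form M (U, \<phi>) \<nu> (\<phi> x))} = E"
proof -
  let ?K = "kern E (local_form M (U, \<phi>) \<nu> (\<phi> x))"
  have xU: "x \<in> U" and xS: "x \<in> S" using x by auto
  note cm = slice_maximal[OF c]
  have a: "\<phi> x \<in> \<phi> ` U" using xU by blast
  have sK: "subspace ?K" by (rule subspace_kern[OF local_form_skew[OF M two_form cm a] subspace_E])
  have KE: "?K \<subseteq> E" by (auto simp: kern_def)
  show int: "F \<inter> ?K = {0}"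
  proof
    show "F \<inter> ?K \<subseteq> {0}"
      unfolding kern_local_form[OF M cm xU] using slice_transverse[OF c x] linear_0[OF linear_coord[OF M cm xU]] by auto
  qed (use subspace_0[OF F(1)] subspace_0[OF sK] in simp)
  have "dim {f + \<kappa> |f \<kappa>. f \<in> F \<and> \<kappa> \<in> ?K} = dim E"
    using dim_sums_Int[OF F(1) sK] int dim_kern_local_form[OF cm a] dim_F xS by auto
  moreover have "{f + \<kappa> |f \<kappa>. f \<in> F \<and> \<kappa> \<in> ?K} \<subseteq> E" using F(2) KE subspace_add[OF subspace_E] by auto
  ultimately show "{f + \<kappa> |f \<kappa>. f \<in> F \<and> \<kappa> \<in> ?K} = E"
    using subspace_dim_equal[OF subspace_sums[OF F(1) sK] subspace_E] by simp
qed

lemma tangent_decomposition: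
  assumes x: "x \<in> S"
  shows "{a + b | a b. a \<in> sub_tangent_space M F S x \<and> b \<in> form_ker M \<nu> x} = tangent_space M x"
    and "sub_tangent_space M F S x \<inter> form_ker M \<nu> x = {0}"
proof -
  obtain U \<phi> where c: "(U, \<phi>) \<in> slice_charts M F S" "x \<in> U" "x \<in> U \<inter> S" "(U, \<phi>) \<in> maximal_atlas M" "(U \<inter> S, \<phi>) \<in> maximal_atlas N"
    by (rule N_chart_cover[OF x])
  note T = sub_tangent_space_chart[OF c(1,3)]
  note lin = linear_coord[OF M c(4,2)]
  have z: "0 \<in> form_ker M \<nu> x" using subspace_0[OF subspace_form_ker] S_subset x by blast
  show "sub_tangent_space M F S x \<inter> form_ker M \<nu> x = {0}"
    unfolding T using slice_transverse[OF c(1,3)] z form_ker_subset subspace_0[OF F(1)] linear_0[OF lin] by auto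
  show "{a + b | a b. a \<in> sub_tangent_space M F S x \<and> b \<in> form_ker M \<nu> x} = tangent_space M x"
    unfolding tangent_space_def
  proof
    show "{a + b | a b. a \<in> sub_tangent_space M F S x \<and> b \<in> form_ker M \<nu> x} \<subseteq> E"
      unfolding T using form_ker_subset subspace_add[OF subspace_E] by blast
    show "E \<subseteq> {a + b | a b. a \<in> sub_tangent_space M F S x \<and> b \<in> form_ker M \<nu> x}"
    proof
      fix u assume u: "u \<in> E"
      obtain f \<kappa> where f: "coord M (U, \<phi>) x u = f + \<kappa>" "f \<in> F" "\<kappa> \<in> coord M (U, \<phi>) x ` form_ker M \<nu> x"
        using slice_decomposition(2)[OF c(1,3)] coord_in[OF M c(4,2) u] unfolding kern_local_form[OF M c(4,2)] by blast
      then obtain b where b: "b \<in> form_ker M \<nu> x" "\<kappa> = coord M (U, \<phi>) x b" by blast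
      have "coord M (U, \<phi>) x (u - b) = f" using f(1) b(2) by (simp add: linear_diff[OF lin])
      moreover have "u - b \<in> E" using subspace_diff[OF subspace_E u] b(1) form_ker_subset by blast
      ultimately have "u - b \<in> sub_tangent_space M F S x" unfolding T using f(2) by simp
      moreover have "u = (u - b) + b" by simp
      ultimately show "u \<in> {a + b | a b. a \<in> sub_tangent_space M F S x \<and> b \<in> form_ker M \<nu> x}"
        using b(1) by blast
    qed
  qed
qed

section \<open>The restricted form\<close>

text \<open>Since the inclusion is the identity in slice coordinates, the pullback is the same
  coordinate expression restricted to arguments in \<open>F\<close>.\<close>

lemma local_form_N:
  assumes c: "(U, \<phi>) \<in> slice_charts M F S" and a: "a \<in> \<phi> ` (U \<inter> S)" and vw: "v \<in> F" "w \<in> F"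
  shows "local_form N (U \<inter> S, \<phi>) \<omega> a v w = local_form M (U, \<phi>) \<nu> a v w"
proof -
  note cN = N_maximal[OF c]
  obtain x where x: "x \<in> U \<inter> S" "a = \<phi> x" using a by blast
  then have xU: "x \<in> U" "x \<in> S" by auto
  obtain v' where v: "v' \<in> F" "coord N (U \<inter> S, \<phi>) x v' = v"
    using coord_surj[OF smooth_manifold_N cN x(1), of v] vw(1) by auto
  obtain w' where w: "w' \<in> F" "coord N (U \<inter> S, \<phi>) x w' = w"
    using coord_surj[OF smooth_manifold_N cN x(1), of w] vw(2) by auto
  have "local_form N (U \<inter> S, \<phi>) \<omega> a v w = \<nu> x (tmap N M id x v') (tmap N M id x w')"
    using local_form_coord[OF smooth_manifold_N cN x(1), of v' w' \<omega>] v w x(2) by (simp add: pullback_def)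
  also have "\<dots> = local_form M (U, \<phi>) \<nu> a v w"
    using local_form_coord[OF M slice_maximal[OF c] xU(1) inclusion_in[OF xU(2) v(1)] inclusion_in[OF xU(2) w(1)], of \<nu>]
      coord_inclusion[OF c x(1) v(1)] coord_inclusion[OF c x(1) w(1)] v w x(2) by simp
  finally show ?thesis .
qed

text \<open>Read off in a slice chart, where the inclusion does not change coordinates and
  coordinates are linear in the vector.\<close>

lemma inclusion_linear:
  assumes x: "x \<in> S" and uv: "u \<in> F" "v \<in> F"
  shows "tmap N M id x (r *\<^sub>R u + s *\<^sub>R v) = r *\<^sub>R tmap N M id x u + s *\<^sub>R tmap N M id x v"
proof -
  obtain U \<phi> where c: "(U, \<phi>) \<in> slice_charts M F S" "x \<in> U" "x \<in> U \<inter> S" "(U, \<phi>) \<in> maximal_atlas M" "(U \<inter> S, \<phi>) \<in> maximal_atlas N"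
    by (rule N_chart_cover[OF x])
  have F': "r *\<^sub>R u + s *\<^sub>R v \<in> F" using uv F(1) by (simp add: subspace_add subspace_scale)
  note lin = linear_coord[OF M c(4,2)] and linN = linear_coord[OF smooth_manifold_N c(5,3)]
  show ?thesis
  proof (rule coord_eqD[OF M c(4,2)])
    show "r *\<^sub>R tmap N M id x u + s *\<^sub>R tmap N M id x v \<in> E"
      using inclusion_in[OF x] uv subspace_E by (simp add: subspace_add subspace_scale)
    show "coord M (U, \<phi>) x (tmap N M id x (r *\<^sub>R u + s *\<^sub>R v)) = coord M (U, \<phi>) x (r *\<^sub>R tmap N M id x u + s *\<^sub>R tmap N M id x v)"
      by (simp add: coord_inclusion[OF c(1,3)] F' uv linear_add[OF lin] linear_scale[OF lin] linear_add[OF linN] linear_scale[OF linN])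
  qed (rule inclusion_in[OF x F'])
qed

lemma two_form_N: "smooth_two_form N \<omega>"
  unfolding smooth_two_form_def
proof (intro conjI ballI allI)
  fix x u v assume "x \<in> points N" and uv': "u \<in> tangent_space N x" "v \<in> tangent_space N x"
  then have x: "x \<in> S" and uv: "u \<in> F" "v \<in> F" by (auto simp: tangent_space_def)
  have sk: "skew_form E (\<nu> x)" using smooth_two_form_skew[OF two_form] S_subset x by blast
  show "\<omega> x u v = - \<omega> x v u"
    using skew_form_skew[OF sk inclusion_in[OF x uv(1)] inclusion_in[OF x uv(2)]] by (simp add: pullback_def)
  fix w r s assume "w \<in> tangent_space N x"
  then have w: "w \<in> F" by (simp add: tangent_space_def)
  show "\<omega> x (r *\<^sub>R u + s *\<^sub>R v) w = r * \<omega> x u w + s * \<omega> x v w"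
    unfolding pullback_def inclusion_linear[OF x uv] id_apply[of x]
    using sk inclusion_in[OF x] uv w unfolding skew_form_def by blast
next
  have "smooth_on (\<phi> ` (U \<inter> S)) (\<lambda>a. local_form N (U \<inter> S, \<phi>) \<omega> a v w)"
    if c: "(U, \<phi>) \<in> slice_charts M F S" and vw: "v \<in> F" "w \<in> F" for U \<phi> v w
  proof (rule smooth_on_cong)
    show "smooth_on (\<phi> ` (U \<inter> S)) (\<lambda>a. local_form M (U, \<phi>) \<nu> a v w)"
      by (rule smooth_on_subset[OF local_form_smooth[OF M two_form slice_maximal[OF c]]]) (use vw F(2) in auto)
  qed (simp add: local_form_N[OF c _ vw])
  then show "case c of (U, \<phi>) \<Rightarrow> \<forall>v\<in>model N. \<forall>w\<in>model N. smooth_on (\<phi> ` U) (\<lambda>a. local_form N (U, \<phi>) \<omega> a v w)"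
    if "c \<in> atlas N" for c using that by auto
qed

text \<open>In a slice chart each derivative in directions of \<open>F\<close> is the one taken in
  the ambient chart, so the cyclic sum is that of \<open>\<nu>\<close> on vectors of
  \<open>F\<close>.\<close>

lemma closed_N: "closed_two_form N \<omega>"
proof -
  have "dform (\<phi> ` (U \<inter> S)) (local_form N (U \<inter> S, \<phi>) \<omega>) u p q r = 0"
    if c: "(U, \<phi>) \<in> slice_charts M F S" and u: "u \<in> \<phi> ` (U \<inter> S)" and pqr: "p \<in> F" "q \<in> F" "r \<in> F" for U \<phi> u p q r
  proof -
    note ro = slice_rel_open[OF c]
    have uU: "u \<in> \<phi> ` U" using u by blast
    have pE: "p \<in> E" "q \<in> E" "r \<in> E" using pqr F(2) by auto
    have d: "fderiv (\<lambda>y. local_form N (U \<inter> S, \<phi>) \<omega> y v w) (\<phi> ` (U \<inter> S)) u h =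
        fderiv (\<lambda>y. local_form M (U, \<phi>) \<nu> y v w) (\<phi> ` U) u h" if "v \<in> F" "w \<in> F" "h \<in> F" for v w h
    proof -
      have "fderiv (\<lambda>y. local_form N (U \<inter> S, \<phi>) \<omega> y v w) (\<phi> ` (U \<inter> S)) u h =
          fderiv (\<lambda>y. local_form M (U, \<phi>) \<nu> y v w) (\<phi> ` (U \<inter> S)) u h"
        by (rule arg_cong[of _ _ "\<lambda>F. F h"], rule fderiv_rel_cong[OF ro ro ro order_refl order_refl u])
          (rule local_form_N[OF c _ that(1,2)])
      also have "\<dots> = fderiv (\<lambda>y. local_form M (U, \<phi>) \<nu> y v w) (\<phi> ` U) u h"
        by (rule fderiv_restrict[OF local_form_smooth[OF M two_form slice_maximal[OF c]] ro _ u that(3)])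
          (use that F(2) in auto)
      finally show ?thesis .
    qed
    show ?thesis
      using local_form_closed[OF M two_form closed slice_maximal[OF c] uU pE]
      unfolding dform_def d[OF pqr(2,3,1)] d[OF pqr(3,1,2)] d[OF pqr(1,2,3)] .
  qed
  then show ?thesis unfolding closed_two_form_def dform_def by auto
qed

text \<open>A vector of \<open>F\<close> annihilating \<open>F\<close> also annihilates the
  complementary kernel of \<open>\<nu>\<close>, hence all of \<open>E\<close>; so it belongs to that
  kernel, which meets \<open>F\<close> only in 0.\<close>

lemma symplectic_N: "symplectic_manifold N \<omega>"
  unfolding symplectic_manifold_def presymplectic_manifold_def
proof (intro conjI ballI smooth_manifold_N two_form_N closed_N)
  fix x assume "x \<in> points N"
  then have x: "x \<in> S" by simp
  obtain U \<phi> where c: "(U, \<phi>) \<in> slice_charts M F S" "x \<in> U" "x \<in> U \<inter> S" "(U, \<phi>) \<in> maximal_atlas M" "(U \<inter> S, \<phi>) \<in> maximal_atlas N"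
    by (rule N_chart_cover[OF x])
  let ?lf = "local_form M (U, \<phi>) \<nu> (\<phi> x)"
  have a: "\<phi> x \<in> \<phi> ` (U \<inter> S)" "\<phi> x \<in> \<phi> ` U" using c by blast+
  have sk: "skew_form E ?lf" by (rule local_form_skew[OF M two_form c(4) a(2)])
  have "kern F (local_form N (U \<inter> S, \<phi>) \<omega> (\<phi> x)) \<subseteq> {0}"
  proof
    fix u assume u: "u \<in> kern F (local_form N (U \<inter> S, \<phi>) \<omega> (\<phi> x))"
    then have uF: "u \<in> F" and uE: "u \<in> E" using F(2) by (auto simp: kern_def)
    have "?lf u w = 0" if wE: "w \<in> E" for w
    proof -
      obtain f \<kappa> where w: "w = f + \<kappa>" "f \<in> F" "\<kappa> \<in> kern E ?lf"
        using wE slice_decomposition(2)[OF c(1,3)] by blast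
      then have E: "f \<in> E" "\<kappa> \<in> E" using F(2) by (auto simp: kern_def)
      have "?lf u f = 0" using u local_form_N[OF c(1) a(1) uF w(2)] w(2) by (simp add: kern_def)
      moreover have "?lf u \<kappa> = 0" using skew_form_skew[OF sk uE E(2)] w(3) uE by (simp add: kern_def)
      ultimately show ?thesis using skew_form_add_right[OF sk subspace_E E uE] w(1) by simp
    qed
    then have "u \<in> F \<inter> kern E ?lf" using uF uE by (simp add: kern_def)
    then show "u \<in> {0}" using slice_decomposition(1)[OF c(1,3)] by simp
  qed
  then have "coord N (U \<inter> S, \<phi>) x ` form_ker N \<omega> x \<subseteq> {0}"
    using kern_local_form[OF smooth_manifold_N c(5,3), of \<omega>] by simp
  moreover have 1: "form_ker N \<omega> x \<subseteq> F" by (auto simp: form_ker_def tangent_space_def)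
  ultimately have "form_ker N \<omega> x \<subseteq> {0}"
    using coord_eqD[OF smooth_manifold_N c(5,3), of _ 0] linear_0[OF linear_coord[OF smooth_manifold_N c(5,3)]] subspace_0[OF F(1)]
    by auto
  moreover have "0 \<in> form_ker N \<omega> x"
    unfolding form_ker_eq_kern using subspace_0[OF subspace_kern[OF smooth_two_form_skew[OF two_form_N, of x]]] x F(1) by simp
  ultimately show "form_ker N \<omega> x = {0}" by blast
qed

lemma smooth_H_N: "smooth_map N real_line H"
proof (rule smooth_mapI[OF smooth_manifold_N flat_smooth_manifold[OF rel_open_UNIV_UNIV]])
  show "continuous_map (mtop N) (mtop real_line) H"
    using smooth_H by (auto simp: smooth_map_def intro: continuous_map_from_subtopology)
  fix x assume "x \<in> points N"
  then have x: "x \<in> S" by simp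
  obtain U \<phi> where c: "(U, \<phi>) \<in> slice_charts M F S" "x \<in> U" "x \<in> U \<inter> S" "(U, \<phi>) \<in> maximal_atlas M" "(U \<inter> S, \<phi>) \<in> maximal_atlas N"
    by (rule N_chart_cover[OF x])
  have "smooth_on (\<phi> ` (U \<inter> S)) (\<lambda>a. H (inv_into U \<phi> a))"
    by (rule smooth_on_subset[OF smooth_function_chart[OF M smooth_H c(4)]]) blast
  then have "smooth_on (\<phi> ` (U \<inter> S)) (\<lambda>a. H (inv_into (U \<inter> S) \<phi> a))"
    by (rule smooth_on_cong) (simp add: inv_into_slice[OF c(1)])
  then have "smooth_on (\<phi> ` (U \<inter> S \<inter> H -` UNIV)) (\<lambda>a. id (H (inv_into (U \<inter> S) \<phi> a)))" by simp
  then show "\<exists>V \<psi> V' \<psi>'. (V, \<psi>) \<in> maximal_atlas N \<and> (V', \<psi>') \<in> maximal_atlas real_line \<and> x \<in> V \<and> H x \<in> V' \<and>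
      smooth_on (\<psi> ` (V \<inter> H -` V')) (\<lambda>a. \<psi>' (H (inv_into V \<psi> a)))"
    using c flat_chart[OF rel_open_UNIV_UNIV] by blast
qed

section \<open>Curves in the ambient and in the constraint manifold\<close>

text \<open>The velocity is itself a witness for the vector demanded by the hidden
  constraint.\<close>

lemma hamiltonian_curve_in_S:
  assumes "hamiltonian_curve M \<nu> H I \<gamma>" "t \<in> I" "open I"
  shows "\<gamma> t \<in> S"
proof -
  have sm: "smooth_map (interval_manifold I) M \<gamma>" and eq: "\<And>v. v \<in> E \<Longrightarrow> \<nu> (\<gamma> t) (velocity M I \<gamma> t) v - differential M H (\<gamma> t) v = 0"
    using assms by (auto simp: hamiltonian_curve_def tangent_space_def)
  have p: "\<gamma> t \<in> points M" using sm assms(2) by (auto simp: smooth_map_def continuous_map_def points_def)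
  obtain U \<phi> where "(U, \<phi>) \<in> atlas M" "\<gamma> t \<in> U" by (rule atlas_cover[OF M p])
  then have c: "(U, \<phi>) \<in> maximal_atlas M" "\<gamma> t \<in> U" using atlas_subset_maximal[OF M] by auto
  have "velocity M I \<gamma> t \<in> E" by (rule curve_chart(1)[OF M assms(3) sm c(1) assms(2) c(2)])
  moreover have "\<forall>v\<in>E. differential M H (\<gamma> t) v = \<nu> (\<gamma> t) (velocity M I \<gamma> t) v" using eq by simp
  ultimately show ?thesis
    using p unfolding hidden_constraint_set_def tangent_space_def by blast
qed

lemma smooth_curve_N_iff:
  assumes I: "open I" and S: "\<gamma> ` I \<subseteq> S"
  shows "smooth_map (interval_manifold I) N \<gamma> \<longleftrightarrow> smooth_map (interval_manifold I) M \<gamma>"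
proof -
  have cont: "continuous_map (top_of_set I) (mtop N) \<gamma> \<longleftrightarrow> continuous_map (top_of_set I) (mtop M) \<gamma>"
    using S by (auto simp: continuous_map_in_subtopology)
  have charts: "\<exists>U V \<phi>. (U, \<phi>) \<in> maximal_atlas M \<and> (V, \<phi>) \<in> maximal_atlas N \<and> \<gamma> t \<in> U \<and> \<gamma> t \<in> V \<and> I \<inter> \<gamma> -` U = I \<inter> \<gamma> -` V"
    if "t \<in> I" for t
  proof -
    have x: "\<gamma> t \<in> S" using S that by blast
    obtain U \<phi> where c: "(U, \<phi>) \<in> slice_charts M F S" "\<gamma> t \<in> U" "\<gamma> t \<in> U \<inter> S" "(U, \<phi>) \<in> maximal_atlas M" "(U \<inter> S, \<phi>) \<in> maximal_atlas N"
      by (rule N_chart_cover[OF x])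
    have "I \<inter> \<gamma> -` U = I \<inter> \<gamma> -` (U \<inter> S)" using S by blast
    then show ?thesis using c by blast
  qed
  show ?thesis
  proof
    assume sm: "smooth_map (interval_manifold I) N \<gamma>"
    show "smooth_map (interval_manifold I) M \<gamma>"
      by (rule smooth_curve_transfer[OF smooth_manifold_N M I sm]) (use sm cont charts in \<open>simp add: smooth_map_def, metis\<close>)
  next
    assume sm: "smooth_map (interval_manifold I) M \<gamma>"
    show "smooth_map (interval_manifold I) N \<gamma>"
      by (rule smooth_curve_transfer[OF M smooth_manifold_N I sm]) (use sm cont charts in \<open>simp add: smooth_map_def, metis\<close>)
  qed
qed

text \<open>Compared in a slice chart, the two equations concern the same vector
  \<open>\<xi>\<close> and differ only in the test vectors: all of \<open>E\<close> on one side,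
  \<open>F\<close> on the other.\<close>

lemma hamilton_equation_N_iff:
  assumes I: "open I" and smM: "smooth_map (interval_manifold I) M \<gamma>" and smN: "smooth_map (interval_manifold I) N \<gamma>"
    and t: "t \<in> I" and x: "\<gamma> t \<in> S"
  shows "(\<forall>v\<in>E. \<nu> (\<gamma> t) (velocity M I \<gamma> t) v - differential M H (\<gamma> t) v = 0) \<longleftrightarrow>
    (\<forall>v\<in>F. \<omega> (\<gamma> t) (velocity N I \<gamma> t) v - differential N H (\<gamma> t) v = 0)"
proof -
  obtain U \<phi> where c: "(U, \<phi>) \<in> slice_charts M F S" "\<gamma> t \<in> U" "\<gamma> t \<in> U \<inter> S" "(U, \<phi>) \<in> maximal_atlas M" "(U \<inter> S, \<phi>) \<in> maximal_atlas N"
    by (rule N_chart_cover[OF x])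
  let ?lf = "local_form M (U, \<phi>) \<nu> (\<phi> (\<gamma> t))" and ?dh = "fderiv (\<lambda>a. H (inv_into U \<phi> a)) (\<phi> ` U) (\<phi> (\<gamma> t))"
  note cM = curve_chart[OF M I smM c(4) t c(2)] and cN = curve_chart[OF smooth_manifold_N I smN c(5) t c(3)]
  define \<xi> where "\<xi> = coord M (U, \<phi>) (\<gamma> t) (velocity M I \<gamma> t)"
  \<comment> \<open>Both velocities are represented by the derivative of the same coordinate
    curve.\<close>
  have \<xi>N: "coord N (U \<inter> S, \<phi>) (\<gamma> t) (velocity N I \<gamma> t) = \<xi>"
    unfolding \<xi>_def using vector_derivative_unique_at[OF cN(2) cM(2)] .
  have \<xi>F: "\<xi> \<in> F" using coord_in[OF smooth_manifold_N c(5,3) cN(1)] \<xi>N by simp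
  then have \<xi>E: "\<xi> \<in> E" using F(2) by blast
  have a: "\<phi> (\<gamma> t) \<in> \<phi> ` (U \<inter> S)" "\<phi> (\<gamma> t) \<in> \<phi> ` U" using c by blast+
  have sk: "skew_form E ?lf" by (rule local_form_skew[OF M two_form c(4) a(2)])
  note h = smooth_function_chart[OF M smooth_H c(4)]
  note ro = slice_rel_open[OF c(1)]
  have dhN: "fderiv (\<lambda>a. H (inv_into (U \<inter> S) \<phi> a)) (\<phi> ` (U \<inter> S)) (\<phi> (\<gamma> t)) w = ?dh w" if w: "w \<in> F" for w
  proof -
    have "fderiv (\<lambda>a. H (inv_into (U \<inter> S) \<phi> a)) (\<phi> ` (U \<inter> S)) (\<phi> (\<gamma> t)) w =
        fderiv (\<lambda>a. H (inv_into U \<phi> a)) (\<phi> ` (U \<inter> S)) (\<phi> (\<gamma> t)) w"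
      by (rule arg_cong[of _ _ "\<lambda>F. F w"], rule fderiv_rel_cong[OF ro ro ro order_refl order_refl a(1)])
        (simp add: inv_into_slice[OF c(1)])
    also have "\<dots> = ?dh w" by (rule fderiv_restrict[OF h ro _ a(1) w]) blast
    finally show ?thesis .
  qed
  have "(\<forall>v\<in>F. \<omega> (\<gamma> t) (velocity N I \<gamma> t) v - differential N H (\<gamma> t) v = 0) \<longleftrightarrow> (\<forall>w\<in>F. ?lf \<xi> w = ?dh w)"
    using hamilton_equation_chart[OF smooth_manifold_N smooth_H_N c(5,3) cN(1), of \<omega>]
    by (simp add: \<xi>N dhN local_form_N[OF c(1) a(1) \<xi>F])
  \<comment> \<open>The test vectors missing in \<open>F\<close> are supplied by the kernel. There
    the form vanishes by skewness, and \<open>dH\<close> vanishes because the point satisfies the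
    hidden constraint.\<close>
  also have "\<dots> \<longleftrightarrow> (\<forall>w\<in>E. ?lf \<xi> w = ?dh w)"
  proof
    assume L: "\<forall>w\<in>F. ?lf \<xi> w = ?dh w"
    show "\<forall>w\<in>E. ?lf \<xi> w = ?dh w"
    proof
      fix w assume "w \<in> E"
      then obtain f \<kappa> where w: "w = f + \<kappa>" "f \<in> F" "\<kappa> \<in> kern E ?lf"
        using slice_decomposition(2)[OF c(1,3)] by blast
      then have E: "f \<in> E" "\<kappa> \<in> E" using F(2) by (auto simp: kern_def)
      have "?lf \<xi> \<kappa> = 0" using skew_form_skew[OF sk \<xi>E E(2)] w(3) \<xi>E by (simp add: kern_def)
      moreover have "?dh \<kappa> = 0" using x w(3) unfolding hidden_chart[OF c(4,2)] by blast
      ultimately show "?lf \<xi> w = ?dh w"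
        using L w(1,2) skew_form_add_right[OF sk subspace_E E \<xi>E] linear_add[OF linear_fderiv[OF h a(2)]] by simp
    qed
  qed (use F(2) in blast)
  also have "\<dots> \<longleftrightarrow> (\<forall>v\<in>E. \<nu> (\<gamma> t) (velocity M I \<gamma> t) v - differential M H (\<gamma> t) v = 0)"
    using hamilton_equation_chart[OF M smooth_H c(4,2) cM(1), of \<nu>] by (simp add: \<xi>_def)
  finally show ?thesis by blast
qed

text \<open>That the curve lies in \<open>S\<close> comes from the equation itself in one direction
  and from the topology of \<open>N\<close> in the other; after that the equations agree at each
  time.\<close>

lemma hamiltonian_curve_N_iff:
  assumes I: "open_interval I"
  shows "hamiltonian_curve M \<nu> H I \<gamma> \<longleftrightarrow> hamiltonian_curve N \<omega> H I \<gamma>"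
proof
  have op: "open I" using I by (simp add: open_interval_def)
  {
    assume M': "hamiltonian_curve M \<nu> H I \<gamma>"
    have S: "\<gamma> ` I \<subseteq> S" using hamiltonian_curve_in_S[OF M' _ op] by blast
    show "hamiltonian_curve N \<omega> H I \<gamma>"
      using M' smooth_curve_N_iff[OF op S] hamilton_equation_N_iff[OF op] S
      unfolding hamiltonian_curve_def tangent_space_def by (auto simp: image_subset_iff)
  next
    assume N': "hamiltonian_curve N \<omega> H I \<gamma>"
    then have "continuous_map (top_of_set I) (mtop N) \<gamma>" by (simp add: hamiltonian_curve_def smooth_map_def)
    then have S: "\<gamma> ` I \<subseteq> S" by (auto simp: continuous_map_in_subtopology)
    show "hamiltonian_curve M \<nu> H I \<gamma>"
      using N' smooth_curve_N_iff[OF op S] hamilton_equation_N_iff[OF op] S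
      unfolding hamiltonian_curve_def tangent_space_def by (auto simp: image_subset_iff)
  }
qed

end

theorem theorem2p7:
  fixes M :: "('p, 'e::euclidean_space) manifold"
    and \<nu> :: "'p \<Rightarrow> 'e \<Rightarrow> 'e \<Rightarrow> real"
    and H :: "'p \<Rightarrow> real"
    and k :: nat
  assumes "presymplectic_manifold M \<nu>"
    and "\<forall>x\<in>points M. dim (form_ker M \<nu> x) = k"
    and "smooth_map M real_line H"
    and "\<forall>z\<in>points M. \<forall>y. critical_point (fibre M \<nu> z) H y \<longrightarrow>
           nondegenerate_critical_point (fibre M \<nu> z) H y"
  shows "\<exists>F. let S = hidden_constraint_set M \<nu> H; N = submfd M F S; \<omega> = pullback N M id \<nu> in
     submanifold M F S \<and>
     (\<forall>x\<in>S. {a + b | a b. a \<in> sub_tangent_space M F S x \<and> b \<in> form_ker M \<nu> x} = tangent_space M x \<and>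
             sub_tangent_space M F S x \<inter> form_ker M \<nu> x = {0}) \<and>
     symplectic_manifold N \<omega> \<and>
     (\<forall>x\<in>S. \<forall>t\<^sub>0. \<exists>I \<gamma>. open_interval I \<and> t\<^sub>0 \<in> I \<and> hamiltonian_curve M \<nu> H I \<gamma> \<and> \<gamma> t\<^sub>0 = x) \<and>
     (\<forall>x\<in>S. \<forall>t\<^sub>0 I J \<gamma> \<eta>.
        open_interval I \<and> t\<^sub>0 \<in> I \<and> hamiltonian_curve M \<nu> H I \<gamma> \<and> \<gamma> t\<^sub>0 = x \<and>
        open_interval J \<and> t\<^sub>0 \<in> J \<and> hamiltonian_curve M \<nu> H J \<eta> \<and> \<eta> t\<^sub>0 = x \<longrightarrow>
        (\<forall>t\<in>I \<inter> J. \<gamma> t = \<eta> t)) \<and>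
     (\<forall>I \<gamma>. open_interval I \<longrightarrow>
        (hamiltonian_curve M \<nu> H I \<gamma> \<longleftrightarrow> hamiltonian_curve N \<omega> H I \<gamma>))"
proof -
  interpret hidden_constraint M \<nu> H k
    by unfold_locales (use assms in blast)+
  \<comment> \<open>Any subspace of this dimension will do as the model. The natural number
    subtraction is exact once a point exists, because the kernel at that point has dimension
    \<open>k\<close> inside the model.\<close>
  obtain F where F: "subspace F" "F \<subseteq> model M" "dim F = dim (model M) - k"
    using choose_subspace_of_subspace[of "dim (model M) - k" "model M"] span_eq_iff[THEN iffD2, OF subspace_E] by auto
  interpret hidden_constraint_slices M \<nu> H k F
  proof
    assume "S \<noteq> {}"
    then obtain x where "x \<in> points M" using S_subset by blast
    then have "k \<le> dim (model M)" using rank dim_subset[OF form_ker_subset] by metis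
    then show "dim F + k = dim (model M)" using F(3) by simp
  qed (rule F)+
  \<comment> \<open>The degenerate equation is not solved directly: a curve is found in the
    symplectic manifold \<open>N\<close> and is then a solution in \<open>M\<close>.\<close>
  have ex: "\<exists>I \<gamma>. open_interval I \<and> t0 \<in> I \<and> hamiltonian_curve M \<nu> H I \<gamma> \<and> \<gamma> t0 = x" if "x \<in> S" for x t0
  proof -
    have "x \<in> points N" using that by simp
    then obtain I \<gamma> where "open_interval I" "t0 \<in> I" "hamiltonian_curve N \<omega> H I \<gamma>" "\<gamma> t0 = x"
      by (rule hamiltonian_curve_exists[OF symplectic_N smooth_H_N])
    then show ?thesis using hamiltonian_curve_N_iff by blast
  qed
  have un: "\<gamma> t = \<eta> t"
    if "open_interval I" "t0 \<in> I" "hamiltonian_curve M \<nu> H I \<gamma>" "open_interval J" "t0 \<in> J" "hamiltonian_curve M \<nu> H J \<eta>"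
      "\<gamma> t0 = \<eta> t0" "t \<in> I \<inter> J" for t0 I J \<gamma> \<eta> t
  proof (rule hamiltonian_curve_unique[OF symplectic_N smooth_H_N])
    show "hamiltonian_curve N \<omega> H I \<gamma>" using hamiltonian_curve_N_iff that by blast
    show "hamiltonian_curve N \<omega> H J \<eta>" using hamiltonian_curve_N_iff that by blast
  qed (rule that)+
  show ?thesis
    unfolding Let_def
  proof (intro exI[of _ F] conjI ballI)
    show "submanifold M F S" by (rule submanifold_S)
    show "symplectic_manifold N \<omega>" by (rule symplectic_N)
    show "{a + b |a b. a \<in> sub_tangent_space M F S x \<and> b \<in> form_ker M \<nu> x} = tangent_space M x"
      "sub_tangent_space M F S x \<inter> form_ker M \<nu> x = {0}" if "x \<in> S" for x
      by (rule tangent_decomposition[OF that])+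
    show "\<forall>t\<^sub>0. \<exists>I \<gamma>. open_interval I \<and> t\<^sub>0 \<in> I \<and> hamiltonian_curve M \<nu> H I \<gamma> \<and> \<gamma> t\<^sub>0 = x" if "x \<in> S" for x
      using ex[OF that] by blast
    show "\<forall>t\<^sub>0 I J \<gamma> \<eta>. open_interval I \<and> t\<^sub>0 \<in> I \<and> hamiltonian_curve M \<nu> H I \<gamma> \<and> \<gamma> t\<^sub>0 = x \<and>
        open_interval J \<and> t\<^sub>0 \<in> J \<and> hamiltonian_curve M \<nu> H J \<eta> \<and> \<eta> t\<^sub>0 = x \<longrightarrow> (\<forall>t\<in>I \<inter> J. \<gamma> t = \<eta> t)" for x
    proof (intro allI impI ballI)
      fix t0 I J \<gamma> \<eta> t
      assume a: "open_interval I \<and> t0 \<in> I \<and> hamiltonian_curve M \<nu> H I \<gamma> \<and> \<gamma> t0 = x \<and>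
          open_interval J \<and> t0 \<in> J \<and> hamiltonian_curve M \<nu> H J \<eta> \<and> \<eta> t0 = x" and t: "t \<in> I \<inter> J"
      show "\<gamma> t = \<eta> t" by (rule un[of I t0 \<gamma> J \<eta>, OF _ _ _ _ _ _ _ t]) (simp_all add: a)
    qed
    show "\<forall>I \<gamma>. open_interval I \<longrightarrow> hamiltonian_curve M \<nu> H I \<gamma> = hamiltonian_curve N \<omega> H I \<gamma>"
      using hamiltonian_curve_N_iff by blast
  qed
qed

end
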